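(* Let $\mathcal{A}$ and $\mathcal{H}$ be the following collections of 4-element sets of oriented Reidemeister moves: \begin{align*} \mathcal{A} = \{&\{\Omega1a, \Omega1c, \Omega2a, \Omega3a\}, \{\Omega1a, \Omega1c, \Omega2b, \Omega3a\}, \{\Omega1b, \Omega1d, \Omega2a, \Omega3a\},\\ &\{\Omega1b, \Omega1d, \Omega2b, \Omega3a\}, \{\Omega1a, \Omega1b, \Omega2a, \Omega3a\}, \{\Omega1a, \Omega1b, \Omega2b, \Omega3a\}\},\\ \mathcal{H} = \{&\{\Omega1a, \Omega1c, \Omega2a, \Omega3h\}, \{\Omega1a, \Omega1c, \Omega2b, \Omega3h\}, \{\Omega1b, \Omega1d, \Omega2a, \Omega3h\},\\ &\{\Omega1b, \Omega1d, \Omega2b, \Omega3h\}, \{\Omega1c, \Omega1d, \Omega2a, \Omega3h\}, \{\Omega1c, \Omega1d, \Omega2b, \Omega3h\}\}. \end{align*} If $X \in \mathcal{A} \cup \mathcal{H}$, then $X$ is a generating set for all oriented Reidemeister moves for knot diagrams.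
   Context: "Knot" means knot or link. An oriented knot diagram is a generic projection to $\mathbb{R}^2$ with over/under information at its transversal double points (crossings). A crossing is positive (resp. negative) if (direction of the over-strand, direction of the under-strand) is a positively (resp. negatively) oriented basis of $\mathbb{R}^2$. An oriented Reidemeister move is a local replacement inside a disk in $\mathbb{R}^2$ (the localized disk of the move) which leaves the diagram unchanged outside the disk. A move may be applied in either direction (both directions count as the same move). Up to orientation-preserving homeomorphism of the disk there are 16 moves: Type 1 (add/remove a one-crossing loop on a strand): $\Omega1a$: positive crossing, clockwise loop; $\Omega1b$: positive crossing, counter-clockwise loop; $\Omega1c$: negative crossing, clockwise loop; $\Omega1d$: negative crossing, counter-clockwise loop. Type 2 (two non-crossing strands are replaced by two strands, one passing over the other, meeting in two crossings that bound a bigon, or conversely): in $\Omega2a$ and $\Omega2b$ the strands run in the same direction (the bigon is not coherently oriented); following the orientation one meets first a positive then a negative crossing in $\Omega2a$, and first a negative then a positive crossing in $\Omega2b$. In $\Omega2c$ and $\Omega2d$ the strands run in opposite directions and the bigon is coherently oriented, counter-clockwise in $\Omega2c$ and clockwise in $\Omega2d$. Type 3 (three pairwise crossing strands, top $t$, middle $m$, bottom $b$, bounding a triangle; a strand is slid past the crossing of the other two): the move is determined by the crossing signs $(\epsilon_{tm},\epsilon_{tb},\epsilon_{mb})$ of the crossings between the indicated strands, which are the same on both sides of the move: $\Omega3a=(+,-,+)$, $\Omega3b=(+,+,+)$, $\Omega3c=(-,-,+)$, $\Omega3d=(+,+,-)$, $\Omega3e=(-,+,+)$, $\Omega3f=(+,-,-)$,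 $\Omega3g=(-,-,-)$, $\Omega3h=(-,+,-)$. The triangle is coherently oriented exactly for $\Omega3a$ and $\Omega3h$. A set $S$ of oriented Reidemeister moves realizes (generates) a move $\Omega$ if one side of $\Omega$ can be transformed into the other by a finite sequence of planar isotopies and moves in $S$ applied inside the localized disk of $\Omega$. $S$ is a generating set if it generates all 16 oriented Reidemeister moves. *)

theory Defs
  imports "HOL-Analysis.Analysis"
begin

text \<open>
  Diagrams are polygonal.  A vertex is a point of the plane together with a height; an oriented
  diagram is a finite set of directed edges between vertices, and its picture is the projection
  that forgets the heights.  Heights only serve to record which strand passes over at a crossing:
  two height functions giving the same over/under information on the same picture, and the same
  heights at the endpoints, are joined by linear interpolation, which is a planar isotopy in the
  sense below.
\<close>

type_synonym vertex = "(real \<times> real) \<times> real"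
type_synonym edge = "vertex \<times> vertex"

definition shadow :: "edge \<Rightarrow> (real \<times> real) set" where
  "shadow e = closed_segment (fst (fst e)) (fst (snd e))"

definition open_shadow :: "edge \<Rightarrow> (real \<times> real) set" where
  "open_shadow e = open_segment (fst (fst e)) (fst (snd e))"

definition solid :: "edge \<Rightarrow> vertex set" where
  "solid e = closed_segment (fst e) (snd e)"

text \<open>
  Injectivity of the two projections on the edge set says that every vertex has at most one outgoing
  and at most one incoming edge, so that the edges form disjoint oriented arcs and closed polygons.
  The remaining conditions say that the projection is generic: its only singularities are transverse
  double points in the interior of edges, and there the two heights differ.
\<close>

definition generic_diagram :: "edge set \<Rightarrow> bool" where
  "generic_diagram D \<longleftrightarrow>
     finite D \<and> inj_on fst D \<and> inj_on snd D \<and>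
     (\<forall>e\<in>D. fst (fst e) \<noteq> fst (snd e)) \<and>
     (\<forall>e\<in>D. \<forall>f\<in>D. snd e = fst f \<longrightarrow> shadow e \<inter> shadow f = {fst (snd e)}) \<and>
     (\<forall>e\<in>D. \<forall>f\<in>D. e \<noteq> f \<and> snd e \<noteq> fst f \<and> snd f \<noteq> fst e \<longrightarrow>
        solid e \<inter> solid f = {} \<and>
        (shadow e \<inter> shadow f = {} \<or>
         (\<exists>p \<in> open_shadow e \<inter> open_shadow f. shadow e \<inter> shadow f = {p}))) \<and>
     (\<forall>e\<in>D. \<forall>f\<in>D. \<forall>g\<in>D. e \<noteq> f \<and> f \<noteq> g \<and> e \<noteq> g \<longrightarrow> shadow e \<inter> shadow f \<inter> shadow g = {})"

definition verts :: "edge set \<Rightarrow> vertex set" where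
  "verts D = fst ` D \<union> snd ` D"

definition ends :: "edge set \<Rightarrow> vertex set" where
  "ends D = (fst ` D - snd ` D) \<union> (snd ` D - fst ` D)"

text \<open>
  Diagrams in the closed unit disk, meeting the boundary circle exactly in the endpoints of their
  arcs.
\<close>

definition disk_diagram :: "edge set \<Rightarrow> bool" where
  "disk_diagram D \<longleftrightarrow>
     generic_diagram D \<and> fst ` verts D \<subseteq> cball 0 1 \<and>
     (\<forall>v\<in>verts D. v \<in> ends D \<longleftrightarrow> fst v \<in> sphere 0 1)"

text \<open>
  A planar isotopy is a continuous deformation through diagrams in the disk which fixes the
  endpoints.  Genericity at all times keeps the crossings and their over/under information.
  Together with the subdivision of edges, this gives all polygonal planar isotopies.
\<close>

definition planar_isotopic :: "edge set \<Rightarrow> edge set \<Rightarrow> bool" where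
  "planar_isotopic D D' \<longleftrightarrow>
     (\<exists>\<phi> :: real \<Rightarrow> vertex \<Rightarrow> vertex.
        (\<forall>v\<in>verts D. continuous_on {0..1} (\<lambda>t. \<phi> t v) \<and> \<phi> 0 v = v) \<and>
        (\<forall>t\<in>{0..1}. inj_on (\<phi> t) (verts D) \<and> disk_diagram (map_prod (\<phi> t) (\<phi> t) ` D) \<and>
           (\<forall>v\<in>ends D. \<phi> t v = v)) \<and>
        D' = map_prod (\<phi> 1) (\<phi> 1) ` D)"

definition subdivision :: "edge set \<Rightarrow> edge set \<Rightarrow> bool" where
  "subdivision D D' \<longleftrightarrow>
     disk_diagram D \<and> disk_diagram D' \<and>
     (\<exists>u v w. (u, v) \<in> D \<and> w \<in> open_segment u v \<and> D' = D - {(u, v)} \<union> {(u, w), (w, v)})"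

datatype move =
    \<Omega>1a | \<Omega>1b | \<Omega>1c | \<Omega>1d
  | \<Omega>2a | \<Omega>2b | \<Omega>2c | \<Omega>2d
  | \<Omega>3a | \<Omega>3b | \<Omega>3c | \<Omega>3d | \<Omega>3e | \<Omega>3f | \<Omega>3g | \<Omega>3h

text \<open>Each move is given by explicit pictures of its two sides in the unit disk.\<close>

definition polyline :: "vertex list \<Rightarrow> edge set" where
  "polyline ps = set (zip ps (tl ps))"

definition straight_strand :: "edge set" where
  "straight_strand = polyline [((-1, 0), 0), ((1, 0), 0)]"

text \<open>
  A strand with a loop whose crossing has sign \<open>w\<close>; the loop is counter-clockwise
  for \<open>s = 1\<close> and clockwise for \<open>s = -1\<close>.
\<close>

definition kink :: "real \<Rightarrow> real \<Rightarrow> edge set" where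
  "kink w s =
     polyline [((-1, 0), 0), ((1/2, s/2), - w * s), ((-1/2, s/2), w * s), ((1, 0), 0)]"

text \<open>
  A lower strand at height \<open>h\<close> and an upper strand at height \<open>- h\<close>; they run from left to
  right for \<open>d = 1\<close>, \<open>e = 1\<close> and from right to left for \<open>d = -1\<close>, \<open>e = -1\<close>, respectively.
  They are disjoint for \<open>k = -1/2\<close> and bound a bigon for \<open>k = 1/2\<close>.
\<close>

definition two_strands :: "real \<Rightarrow> real \<Rightarrow> real \<Rightarrow> real \<Rightarrow> edge set" where
  "two_strands d e h k =
     polyline [((- d * 4/5, -3/5), h), ((0, k), h), ((d * 4/5, -3/5), h)] \<union>
     polyline [((- e * 4/5, 3/5), - h), ((0, - k), - h), ((e * 4/5, 3/5), - h)]"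

text \<open>First crossing of sign \<open>w\<close>.\<close>

definition parallel_strands :: "real \<Rightarrow> real \<Rightarrow> edge set" where
  "parallel_strands w k = two_strands 1 1 (- w) k"

text \<open>Bigon counter-clockwise for \<open>s = 1\<close> and clockwise for \<open>s = -1\<close>.\<close>

definition antiparallel_strands :: "real \<Rightarrow> real \<Rightarrow> edge set" where
  "antiparallel_strands s k = two_strands (- s) s 1 k"

text \<open>
  The middle and the bottom strand are diameters; the top strand runs from left to right and passes
  their crossing above it for \<open>k = 1/2\<close> and below it for \<open>k = -1/2\<close>.
  The signs of the crossings are \<open>tm\<close>, \<open>tb\<close>, \<open>mb\<close>.  Reversing the direction of all strands amounts
  to rotating the disk by a half turn and exchanging the two sides of the move, so fixing the
  direction of the top strand is no restriction.
\<close>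

definition three_strands :: "real \<Rightarrow> real \<Rightarrow> real \<Rightarrow> real \<Rightarrow> edge set" where
  "three_strands tm tb mb k =
     (let c = tm * tb * mb;
          m = (tm * c * (3/5), tm * (4/5));
          b = (- tb * c * (3/5), tb * (4/5))
      in polyline [((-1, 0), 1), ((0, k), 1), ((1, 0), 1)] \<union>
         polyline [(- m, 0), (m, 0)] \<union>
         polyline [(- b, -1), (b, -1)])"

fun sides :: "move \<Rightarrow> edge set \<times> edge set" where
  "sides \<Omega>1a = (straight_strand, kink 1 (-1))"
| "sides \<Omega>1b = (straight_strand, kink 1 1)"
| "sides \<Omega>1c = (straight_strand, kink (-1) (-1))"
| "sides \<Omega>1d = (straight_strand, kink (-1) 1)"
| "sides \<Omega>2a = (parallel_strands 1 (-1/2), parallel_strands 1 (1/2))"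
| "sides \<Omega>2b = (parallel_strands (-1) (-1/2), parallel_strands (-1) (1/2))"
| "sides \<Omega>2c = (antiparallel_strands 1 (-1/2), antiparallel_strands 1 (1/2))"
| "sides \<Omega>2d = (antiparallel_strands (-1) (-1/2), antiparallel_strands (-1) (1/2))"
| "sides \<Omega>3a = (three_strands 1 (-1) 1 (-1/2), three_strands 1 (-1) 1 (1/2))"
| "sides \<Omega>3b = (three_strands 1 1 1 (-1/2), three_strands 1 1 1 (1/2))"
| "sides \<Omega>3c = (three_strands (-1) (-1) 1 (-1/2), three_strands (-1) (-1) 1 (1/2))"
| "sides \<Omega>3d = (three_strands 1 1 (-1) (-1/2), three_strands 1 1 (-1) (1/2))"
| "sides \<Omega>3e = (three_strands (-1) 1 1 (-1/2), three_strands (-1) 1 1 (1/2))"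
| "sides \<Omega>3f = (three_strands 1 (-1) (-1) (-1/2), three_strands 1 (-1) (-1) (1/2))"
| "sides \<Omega>3g = (three_strands (-1) (-1) (-1) (-1/2), three_strands (-1) (-1) (-1) (1/2))"
| "sides \<Omega>3h = (three_strands (-1) 1 (-1) (-1/2), three_strands (-1) 1 (-1) (1/2))"

text \<open>
  A move is applied in a disk by carrying its pictures there with an orientation-preserving affine
  map of the plane and leaving the diagram unchanged outside.  An arbitrary disk in which
  the diagram looks like one side of the move is brought into this form by a planar isotopy.
\<close>

definition orientation_preserving_affine :: "(real \<times> real \<Rightarrow> real \<times> real) \<Rightarrow> bool" where
  "orientation_preserving_affine A \<longleftrightarrow>
     (\<exists>a b c d p q. a * d - b * c > 0 \<and> A = (\<lambda>(x, y). (a * x + b * y + p, c * x + d * y + q)))"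

definition place :: "(real \<times> real \<Rightarrow> real \<times> real) \<Rightarrow> edge set \<Rightarrow> edge set" where
  "place A D = map_prod (map_prod A id) (map_prod A id) ` D"

definition apply_move :: "move \<Rightarrow> edge set \<Rightarrow> edge set \<Rightarrow> bool" where
  "apply_move r D D' \<longleftrightarrow>
     disk_diagram D \<and> disk_diagram D' \<and>
     (\<exists>A Out. orientation_preserving_affine A \<and> A ` cball 0 1 \<subseteq> cball 0 1 \<and>
        (\<forall>e\<in>Out. shadow e \<inter> A ` ball 0 1 = {}) \<and>
        D = Out \<union> place A (fst (sides r)) \<and>
        D' = Out \<union> place A (snd (sides r)))"

inductive step :: "move set \<Rightarrow> edge set \<Rightarrow> edge set \<Rightarrow> bool" for S where
  isotopy: "planar_isotopic D D' \<Longrightarrow> step S D D'"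
| subdivide: "subdivision D D' \<Longrightarrow> step S D D'"
| unsubdivide: "subdivision D' D \<Longrightarrow> step S D D'"
| move_forward: "r \<in> S \<Longrightarrow> apply_move r D D' \<Longrightarrow> step S D D'"
| move_backward: "r \<in> S \<Longrightarrow> apply_move r D' D \<Longrightarrow> step S D D'"

definition realizes :: "move set \<Rightarrow> move \<Rightarrow> bool" where
  "realizes S r \<longleftrightarrow> (step S)\<^sup>*\<^sup>* (fst (sides r)) (snd (sides r))"

definition generating_set :: "move set \<Rightarrow> bool" where
  "generating_set S \<longleftrightarrow> (\<forall>r. realizes S r)"

end

theory Submission
  imports Defs
begin

text \<open>
  A polygonal diagram with integer vertices is deformed by moving one vertex at a time.  The orientation of three
  points, the height difference of two edges at their crossing and the concurrence of three edges are affine functions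
  of the position of that vertex, so their signs need to be known only at the beginning and at the end.  Explicit
  deformations thus become finite computations.  Since a diagram in the disk can be exchanged for a diagram with the same
  ends inside any larger diagram, a move that has been realized can then be used like a generator.

  Four deformations suffice.  A kink and \<open>\<Omega>2c\<close> or \<open>\<Omega>2d\<close> give the kink with the opposite crossing and the opposite sense
  of rotation.  A kink, a move of type 2 and a move of type 3 give the move of type 2 with one strand reversed.  Two
  moves of type 2 between two of three strands turn a move of type 3 into the one with the opposite sign at the crossing
  of these two strands.  Finally, each of the three strands in a move of type 3 may play the part of the one that is slid.
  Each of the given sets yields \<open>\<Omega>2c\<close> or \<open>\<Omega>2d\<close> by the second deformation, then all kinks and both of \<open>\<Omega>2c\<close> and \<open>\<Omega>2d\<close>,
  then three more moves of type 3 by the third one, then \<open>\<Omega>2a\<close> and \<open>\<Omega>2b\<close>, and hence everything.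
\<close>

section \<open>Plane geometry\<close>

text \<open>In \<open>\<Omega>3a\<close> and \<open>\<Omega>3h\<close> the triangle is coherently
  oriented, so at each of its corners the two strands run in opposite directions, and the bigons
  that reverse the sign of such a crossing belong to \<open>\<Omega>2c\<close> and
  \<open>\<Omega>2d\<close>. The given sets offer only \<open>\<Omega>2a\<close> or
  \<open>\<Omega>2b\<close>; hence no further move of type 3 is in reach of these bigons until the
  antiparallel moves have been won, by a loop whose far side runs backwards. The crossing of this
  loop becomes the crossing of the two unbent strands of a triangle with bent top or bottom strand,
  which is positive in \<open>\<Omega>3a\<close> and negative in \<open>\<Omega>3h\<close>. This is
  the origin of the third pair of kinks in each family. The eight sign triples are the corners of a
  cube with \<open>\<Omega>3a\<close> and \<open>\<Omega>3h\<close> opposite to each other.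
  Reversing one crossing follows an edge of the cube, and the reversed crossing is that of the two
  unbent strands; therefore all three choices of the bent strand occur. All tests are strict
  inequalities between integers. Units of 1/1000 and Pythagorean end points such as (600, 800) put
  the ends of the pictures exactly on the circle.\<close>

definition turn :: "real \<times> real \<Rightarrow> real \<times> real \<Rightarrow> real \<times> real \<Rightarrow> real" where
  "turn a b c = (fst b - fst a) * (snd c - snd a) - (snd b - snd a) * (fst c - fst a)"

text \<open>The determinant of \<open>b - a\<close>, \<open>c - a\<close>, \<open>d - a\<close>, six
  times the signed volume of a tetrahedron, expanded along the heights. If the shadows of
  \<open>a b\<close> and \<open>c d\<close> cross transversally, it is nonzero iff the two heights
  at the crossing differ.\<close>

definition volume :: "vertex \<Rightarrow> vertex \<Rightarrow> vertex \<Rightarrow> vertex \<Rightarrow> real" where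
  "volume a b c d = (snd d - snd a) * turn (fst a) (fst b) (fst c)
     - (snd c - snd a) * turn (fst a) (fst b) (fst d)
     + (snd b - snd a) * turn (fst a) (fst c) (fst d)"

lemma turn_convex:
  "turn a b ((1 - t) *\<^sub>R c + t *\<^sub>R d) = (1 - t) * turn a b c + t * turn a b d"
  "turn a ((1 - t) *\<^sub>R c + t *\<^sub>R d) b = (1 - t) * turn a c b + t * turn a d b"
  by (simp_all add: turn_def algebra_simps)

lemma turn_degenerate [simp]: "turn a a b = 0" "turn a b a = 0" "turn a b b = 0"
  by (simp_all add: turn_def)

lemma volume_convex:
  "volume a ((1 - t) *\<^sub>R p + t *\<^sub>R q) c d = (1 - t) * volume a p c d + t * volume a q c d"
  by (simp add: volume_def turn_def algebra_simps)

lemma agree_convex: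
  fixes x y t :: real
  assumes "0 < x * y" "0 \<le> t" "t \<le> 1"
  shows "0 < x * ((1 - t) * x + t * y)"
proof -
  have "x \<noteq> 0" using assms by auto
  have "x * ((1 - t) * x + t * y) = (1 - t) * (x * x) + t * (x * y)"
    by (simp add: algebra_simps)
  moreover have "0 < (1 - t) * (x * x) + t * (x * y)"
  proof (cases "t = 1")
    case False
    then have "0 < (1 - t) * (x * x)" using assms \<open>x \<noteq> 0\<close> by (simp add: zero_less_mult_iff) linarith
    moreover have "0 \<le> t * (x * y)" using assms by simp
    ultimately show ?thesis by linarith
  qed (use assms in simp)
  ultimately show ?thesis by simp
qed

lemma convex_combination_nonzero:
  fixes x y t :: real
  assumes "0 < x * y" "0 \<le> t" "t \<le> 1"
  shows "(1 - t) * x + t * y \<noteq> 0"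
  using agree_convex[OF assms] by auto

lemma turn_on_segment:
  assumes "x \<in> closed_segment a b" shows "turn a b x = 0"
  using assms by (auto simp: closed_segment_def turn_convex)

lemma segments_apart:
  assumes "0 < turn c d a * turn c d b"
  shows "closed_segment a b \<inter> closed_segment c d = {}"
proof -
  have False if "x \<in> closed_segment a b" "x \<in> closed_segment c d" for x
  proof -
    obtain t where t: "0 \<le> t" "t \<le> 1" "x = (1 - t) *\<^sub>R a + t *\<^sub>R b"
      using \<open>x \<in> closed_segment a b\<close> by (auto simp: closed_segment_def)
    have "turn c d x \<noteq> 0"
      using convex_combination_nonzero[OF assms t(1,2)] by (simp add: t(3) turn_convex)
    then show False using turn_on_segment that by blast
  qed
  then show ?thesis by blast
qed

lemma segments_cross:
  assumes "turn c d a * turn c d b < 0" and "turn a b c * turn a b d < 0"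
  shows "\<exists>x \<in> open_segment a b \<inter> open_segment c d. closed_segment a b \<inter> closed_segment c d = {x}"
proof -
  define s where "s = turn c d a"
  define s' where "s' = turn c d b"
  define r where "r = turn a b c"
  define r' where "r' = turn a b d"
  \<comment> \<open>\<open>D\<close> is the cross product of \<open>b - a\<close> and
    \<open>d - c\<close>. Cramer's rule with this denominator gives the parameters \<open>t\<close>
    and \<open>k\<close> of the common point, and the same rule shows below that there is no second
    one.\<close>
  define D where "D = s - s'"
  have D': "D = r' - r"
    by (simp add: D_def s_def s'_def r_def r'_def turn_def algebra_simps)
  have ss: "s * s' < 0" and rr: "r * r' < 0" using assms by (auto simp: s_def s'_def r_def r'_def)
  have D0: "D \<noteq> 0" using ss unfolding D_def by (auto simp: mult_less_0_iff)
  define t where "t = s / D"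
  define k where "k = - r / D"
  have t: "0 < t" "t < 1" using ss unfolding t_def D_def
    by (auto simp: mult_less_0_iff divide_simps)
  have k: "0 < k" "k < 1" using rr unfolding k_def D'
    by (auto simp: mult_less_0_iff divide_simps)
  define x where "x = (1 - t) *\<^sub>R a + t *\<^sub>R b"
  have "D * (fst a - fst c) + s * (fst b - fst a) + r * (fst d - fst c) = 0"
    "D * (snd a - snd c) + s * (snd b - snd a) + r * (snd d - snd c) = 0"
    by (simp_all add: D_def s_def s'_def r_def turn_def algebra_simps)
  moreover have "z + t * w - k * w' = (D * z + s * w + r * w') / D" for z w w'
    using D0 by (simp add: t_def k_def add_divide_distrib)
  ultimately have "(fst a - fst c) + t * (fst b - fst a) - k * (fst d - fst c) = 0"
    "(snd a - snd c) + t * (snd b - snd a) - k * (snd d - snd c) = 0"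
    by simp_all
  then have x': "x = (1 - k) *\<^sub>R c + k *\<^sub>R d"
    unfolding x_def by (simp add: prod_eq_iff algebra_simps)
  have ab: "a \<noteq> b" and cd: "c \<noteq> d" using ss rr by (auto simp: s_def s'_def r_def r'_def mult_less_0_iff)
  have "x \<in> open_segment a b" "x \<in> open_segment c d"
    using t k ab cd x_def x' by (auto simp: in_segment)
  moreover have "y = x" if "y \<in> closed_segment a b" "y \<in> closed_segment c d" for y
  proof -
    have y: "turn a b y = 0" "turn c d y = 0" using that turn_on_segment by auto
    have xx: "turn a b x = 0" "turn c d x = 0"
      using \<open>x \<in> open_segment a b\<close> \<open>x \<in> open_segment c d\<close>
      by (auto intro!: turn_on_segment simp: open_segment_def simp del: split_paired_All)
    have "D * (fst y - fst x) = (fst d - fst c) * (turn a b y - turn a b x) - (fst b - fst a) * (turn c d y -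
        turn c d x)"
      "D * (snd y - snd x) = (snd d - snd c) * (turn a b y - turn a b x) - (snd b - snd a) * (turn c d y - turn
          c d x)"
      by (simp_all add: D_def s_def s'_def turn_def algebra_simps)
    then show ?thesis using y xx D0 by (simp add: prod_eq_iff)
  qed
  moreover have "x \<in> closed_segment a b \<inter> closed_segment c d"
    using calculation(1,2) by (simp add: open_segment_def)
  ultimately show ?thesis by blast
qed

text \<open>Two segments issuing from \<open>a\<close> overlap only if they have the same direction.
  A nonzero turn excludes parallel directions, a negative inner product excludes equal ones; the
  second alternative serves straight vertices, as they arise by subdivision.\<close>

lemma segments_meet_at_corner:
  assumes "turn x a q \<noteq> 0 \<or> (x - a) \<bullet> (q - a) < 0"
  shows "closed_segment x a \<inter> closed_segment a q = {a}"
proof -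
  have "y = a" if y: "y \<in> closed_segment x a" "y \<in> closed_segment a q" for y
  proof -
    obtain s where s: "0 \<le> s" "s \<le> 1" "y = (1 - s) *\<^sub>R a + s *\<^sub>R x"
      using y(1) by (subst (asm) closed_segment_commute) (auto simp: closed_segment_def)
    obtain r where r: "0 \<le> r" "r \<le> 1" "y = (1 - r) *\<^sub>R a + r *\<^sub>R q"
      using y(2) by (auto simp: closed_segment_def)
    have e: "s *\<^sub>R (x - a) = r *\<^sub>R (q - a)"
      using s(3) r(3) by (simp add: algebra_simps)
    have "s = 0"
      using assms
    proof
      assume n: "turn x a q \<noteq> 0"
      have "s * turn x a q = (s * (snd x - snd a)) * (fst q - fst a) - (s * (fst x - fst a)) * (snd q - snd a)"
        by (simp add: turn_def algebra_simps)
      moreover have "s * (snd x - snd a) = r * (snd q - snd a)" "s * (fst x - fst a) = r * (fst q - fst a)"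
        using e by (auto simp: prod_eq_iff)
      ultimately have "s * turn x a q = 0" by simp
      then show "s = 0" using n by simp
    next
      assume n: "(x - a) \<bullet> (q - a) < 0"
      have "s * ((x - a) \<bullet> (q - a)) = r * ((q - a) \<bullet> (q - a))"
        using arg_cong[OF e, of "\<lambda>v. v \<bullet> (q - a)"] by simp
      moreover have "0 \<le> r * ((q - a) \<bullet> (q - a))" using r by simp
      ultimately have "0 \<le> s * ((x - a) \<bullet> (q - a))" by simp
      then show "s = 0" using n s(1) by (auto simp: zero_le_mult_iff)
    qed
    then show ?thesis using s by simp
  qed
  then show ?thesis by auto
qed

text \<open>For \<open>y\<close> on the first segment, \<open>volume a b x y\<close> vanishes for
  every \<open>x\<close>. With \<open>x = c\<close> and \<open>x = d\<close>, and \<open>y\<close>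
  written as a convex combination of \<open>c\<close> and \<open>d\<close>, each of the two weights
  annihilates the volume, although they add up to 1.\<close>

lemma solids_apart:
  assumes "volume a b c d \<noteq> 0"
  shows "closed_segment a b \<inter> closed_segment c d = {}"
proof -
  have False if y: "y \<in> closed_segment a b" "y \<in> closed_segment c d" for y
  proof -
    obtain s where s: "y = (1 - s) *\<^sub>R a + s *\<^sub>R b"
      using y(1) by (auto simp: closed_segment_def)
    obtain r where r: "y = (1 - r) *\<^sub>R c + r *\<^sub>R d"
      using y(2) by (auto simp: closed_segment_def)
    have 0: "volume a b x y = - volume a b y x" for x y
      by (simp add: volume_def turn_def algebra_simps)
    have lin: "volume a b x ((1 - t) *\<^sub>R v + t *\<^sub>R w) = (1 - t) * volume a b x v + t * volume a b x w" for x v w t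
      by (simp add: volume_def turn_def algebra_simps)
    have deg: "volume a b x a = 0" "volume a b x b = 0" "volume a b x x = 0" for x
      by (simp_all add: volume_def turn_def algebra_simps)
    have y0: "volume a b x y = 0" for x
      unfolding s lin deg by simp
    have "r * volume a b c d = 0" using y0[of c] unfolding r lin deg by simp
    moreover have "(1 - r) * volume a b d c = 0" using y0[of d] unfolding r lin deg by simp
    ultimately show False using assms 0[of d c] by auto
  qed
  then show ?thesis by blast
qed

text \<open>Along \<open>g g'\<close> the other two lines are the zero sets of two affine functions;
  a common zero makes the determinant of their end values vanish. This determinant is affine in
  \<open>b\<close>, so its sign can be followed while \<open>b\<close> moves.\<close>

lemma not_concurrent:
  assumes "turn a b g * turn f f' g' - turn a b g' * turn f f' g \<noteq> 0"
  shows "closed_segment a b \<inter> closed_segment f f' \<inter> closed_segment g g' = {}"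
proof -
  have False if x: "x \<in> closed_segment a b" "x \<in> closed_segment f f'" "x \<in> closed_segment g g'" for x
  proof -
    obtain r where r: "x = (1 - r) *\<^sub>R g + r *\<^sub>R g'"
      using x(3) by (auto simp: closed_segment_def)
    have 1: "(1 - r) * turn a b g + r * turn a b g' = 0" "(1 - r) * turn f f' g + r * turn f f' g' = 0"
      using turn_on_segment[OF x(1)] turn_on_segment[OF x(2)] unfolding r turn_convex by auto
    have "r * (turn a b g * turn f f' g' - turn a b g' * turn f f' g) = 0"
      "(1 - r) * (turn a b g * turn f f' g' - turn a b g' * turn f f' g) = 0"
      using 1 by algebra+
    then show False using assms by auto
  qed
  then show ?thesis by blast
qed

section \<open>Generic diagrams\<close>

definition transverse :: "edge \<Rightarrow> edge \<Rightarrow> bool" where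
  "transverse e f \<longleftrightarrow> solid e \<inter> solid f = {} \<and>
     (shadow e \<inter> shadow f = {} \<or> (\<exists>p \<in> open_shadow e \<inter> open_shadow f. shadow e \<inter> shadow f = {p}))"

lemma transverse_point:
  assumes "transverse e f" "x \<in> shadow e" "x \<in> shadow f"
  shows "x \<in> open_shadow e" "x \<in> open_shadow f"
proof -
  have x: "x \<in> shadow e \<inter> shadow f" using assms by simp
  then obtain p where "p \<in> open_shadow e \<inter> open_shadow f" "shadow e \<inter> shadow f = {p}"
    using assms(1) unfolding transverse_def by (metis empty_iff)
  then show "x \<in> open_shadow e" "x \<in> open_shadow f" using x by simp_all
qed

lemma transverse_sym: "transverse e f \<Longrightarrow> transverse f e"
  unfolding transverse_def by (simp add: Int_commute)

lemma generic_iff: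
  "generic_diagram D \<longleftrightarrow>
     finite D \<and> inj_on fst D \<and> inj_on snd D \<and>
     (\<forall>e\<in>D. fst (fst e) \<noteq> fst (snd e)) \<and>
     (\<forall>e\<in>D. \<forall>f\<in>D. snd e = fst f \<longrightarrow> shadow e \<inter> shadow f = {fst (snd e)}) \<and>
     (\<forall>e\<in>D. \<forall>f\<in>D. e \<noteq> f \<and> snd e \<noteq> fst f \<and> snd f \<noteq> fst e \<longrightarrow> transverse e f) \<and>
     (\<forall>e\<in>D. \<forall>f\<in>D. \<forall>g\<in>D. e \<noteq> f \<and> f \<noteq> g \<and> e \<noteq> g \<longrightarrow> shadow e \<inter> shadow f \<inter> shadow g = {})"
  unfolding generic_diagram_def transverse_def ..

lemma genericI:
  assumes "finite D" "inj_on fst D" "inj_on snd D"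
    and "\<And>e. e \<in> D \<Longrightarrow> fst (fst e) \<noteq> fst (snd e)"
    and "\<And>e f. e \<in> D \<Longrightarrow> f \<in> D \<Longrightarrow> snd e = fst f \<Longrightarrow> shadow e \<inter> shadow f = {fst (snd e)}"
    and "\<And>e f. e \<in> D \<Longrightarrow> f \<in> D \<Longrightarrow> e \<noteq> f \<Longrightarrow> snd e \<noteq> fst f \<Longrightarrow> snd f \<noteq> fst e \<Longrightarrow> transverse e f"
    and "\<And>e f g. e \<in> D \<Longrightarrow> f \<in> D \<Longrightarrow> g \<in> D \<Longrightarrow> e \<noteq> f \<Longrightarrow> f \<noteq> g \<Longrightarrow> e \<noteq> g \<Longrightarrow>
           shadow e \<inter> shadow f \<inter> shadow g = {}"
  shows "generic_diagram D"
  unfolding generic_iff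
  by (intro conjI ballI impI; (elim conjE)?) (fact assms(1-3) | rule assms(4-7); assumption)+

lemma genericD:
  assumes "generic_diagram D"
  shows "finite D" "inj_on fst D" "inj_on snd D"
    and "\<And>e. e \<in> D \<Longrightarrow> fst (fst e) \<noteq> fst (snd e)"
    and "\<And>e f. e \<in> D \<Longrightarrow> f \<in> D \<Longrightarrow> snd e = fst f \<Longrightarrow> shadow e \<inter> shadow f = {fst (snd e)}"
    and "\<And>e f. e \<in> D \<Longrightarrow> f \<in> D \<Longrightarrow> e \<noteq> f \<Longrightarrow> snd e \<noteq> fst f \<Longrightarrow> snd f \<noteq> fst e \<Longrightarrow> transverse e f"
    and "\<And>e f g. e \<in> D \<Longrightarrow> f \<in> D \<Longrightarrow> g \<in> D \<Longrightarrow> e \<noteq> f \<Longrightarrow> f \<noteq> g \<Longrightarrow> e \<noteq> g \<Longrightarrow>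
           shadow e \<inter> shadow f \<inter> shadow g = {}"
  using assms unfolding generic_iff by (elim conjE; (assumption | simp only: simp_thms | metis))+

lemma generic_subset:
  assumes "generic_diagram D" "R \<subseteq> D" shows "generic_diagram R"
proof (rule genericI)
  note G = genericD[OF assms(1)]
  show "finite R" using G(1) assms(2) by (rule rev_finite_subset)
  show "inj_on fst R" "inj_on snd R" using G(2,3) assms(2) by (auto intro: inj_on_subset)
  show "fst (fst e) \<noteq> fst (snd e)" if "e \<in> R" for e using G(4) assms(2) that by blast
  show "shadow e \<inter> shadow f = {fst (snd e)}" if "e \<in> R" "f \<in> R" "snd e = fst f" for e f
    using G(5)[of e f] assms(2) that by blast
  show "transverse e f" if "e \<in> R" "f \<in> R" "e \<noteq> f" "snd e \<noteq> fst f" "snd f \<noteq> fst e" for e f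
    using G(6)[of e f] assms(2) that by blast
  show "shadow e \<inter> shadow f \<inter> shadow g = {}"
    if "e \<in> R" "f \<in> R" "g \<in> R" "e \<noteq> f" "f \<noteq> g" "e \<noteq> g" for e f g
    using G(7)[of e f g] assms(2) that by blast
qed

lemma generic_insert:
  assumes R: "generic_diagram R" and uv: "fst u \<noteq> fst v" "u \<notin> fst ` R" "v \<notin> snd ` R"
    and before: "\<And>f. f \<in> R \<Longrightarrow> snd f = u \<Longrightarrow> shadow f \<inter> shadow (u, v) = {fst u}"
    and after: "\<And>f. f \<in> R \<Longrightarrow> fst f = v \<Longrightarrow> shadow (u, v) \<inter> shadow f = {fst v}"
    and other: "\<And>f. f \<in> R \<Longrightarrow> snd f \<noteq> u \<Longrightarrow> fst f \<noteq> v \<Longrightarrow> transverse (u, v) f"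
    and triple: "\<And>f g. f \<in> R \<Longrightarrow> g \<in> R \<Longrightarrow> f \<noteq> g \<Longrightarrow> shadow (u, v) \<inter> shadow f \<inter> shadow g = {}"
  shows "generic_diagram (insert (u, v) R)"
proof (rule genericI)
  note G = genericD[OF R]
  show "finite (insert (u, v) R)" using G(1) by simp
  show "inj_on fst (insert (u, v) R)" using G(2) uv by (auto simp: inj_on_insert)
  show "inj_on snd (insert (u, v) R)" using G(3) uv by (auto simp: inj_on_insert)
  show "fst (fst e) \<noteq> fst (snd e)" if "e \<in> insert (u, v) R" for e
    using that G(4)[of e] uv(1) by (cases "e = (u, v)") simp_all
  show "shadow e \<inter> shadow f = {fst (snd e)}"
    if "e \<in> insert (u, v) R" "f \<in> insert (u, v) R" "snd e = fst f" for e f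
  proof -
    consider "e = (u, v)" "f = (u, v)" | "e = (u, v)" "f \<in> R" | "e \<in> R" "f = (u, v)" | "e \<in> R" "f \<in> R"
      using \<open>e \<in> insert (u, v) R\<close> \<open>f \<in> insert (u, v) R\<close> by blast
    then show ?thesis
    proof cases
      case 1 then show ?thesis using \<open>snd e = fst f\<close> uv by simp
    next
      case 2 then show ?thesis using after[of f] \<open>snd e = fst f\<close> by simp
    next
      case 3 then show ?thesis using before[of e] \<open>snd e = fst f\<close> by simp
    next
      case 4 then show ?thesis using G(5) \<open>snd e = fst f\<close> by simp
    qed
  qed
  show "transverse e f"
    if ef: "e \<in> insert (u, v) R" "f \<in> insert (u, v) R" "e \<noteq> f" "snd e \<noteq> fst f" "snd f \<noteq> fst e" for e f
  proof -
    consider "e = (u, v)" "f \<in> R" | "e \<in> R" "f = (u, v)" | "e \<in> R" "f \<in> R"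
      using ef(1-3) by blast
    then show ?thesis
    proof cases
      case 1 then show ?thesis using other[of f] ef by simp
    next
      case 2 then show ?thesis using other[of e] ef by (simp add: transverse_sym)
    next
      case 3 then show ?thesis using G(6) ef by simp
    qed
  qed
  show "shadow e \<inter> shadow f \<inter> shadow g = {}"
    if ef: "e \<in> insert (u, v) R" "f \<in> insert (u, v) R" "g \<in> insert (u, v) R" "e \<noteq> f" "f \<noteq> g" "e \<noteq> g" for e f g
  proof -
    consider "e = (u, v)" "f \<in> R" "g \<in> R" | "e \<in> R" "f = (u, v)" "g \<in> R" | "e \<in> R" "f \<in> R" "g = (u, v)"
      | "e \<in> R" "f \<in> R" "g \<in> R"
      using ef by blast
    then show ?thesis
    proof cases
      case 1 then show ?thesis using triple[of f g] ef by simp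
    next
      case 2 then show ?thesis using triple[of e g] ef by blast
    next
      case 3 then show ?thesis using triple[of e f] ef by blast
    next
      case 4 then show ?thesis using G(7) ef by simp
    qed
  qed
qed

definition bent :: "edge set \<Rightarrow> vertex \<Rightarrow> vertex \<Rightarrow> vertex \<Rightarrow> edge set" where
  "bent R u q v = insert (q, v) (insert (u, q) R)"

text \<open>
  An edge from \<open>a\<close> to \<open>q\<close>, in either direction, can be attached to the diagram \<open>R\<close> at its vertex \<open>a\<close>.
\<close>

definition hooks :: "edge set \<Rightarrow> vertex \<Rightarrow> vertex \<Rightarrow> bool" where
  "hooks R a q \<longleftrightarrow> fst a \<noteq> fst q \<and>
     (\<forall>f\<in>R. if fst f = a \<or> snd f = a then shadow (a, q) \<inter> shadow f = {fst a} else transverse (a, q) f) \<and>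
     (\<forall>f\<in>R. \<forall>g\<in>R. f \<noteq> g \<longrightarrow> shadow (a, q) \<inter> shadow f \<inter> shadow g = {})"

lemma hooksD:
  assumes "hooks R a q"
  shows "fst a \<noteq> fst q"
    and "\<And>f. f \<in> R \<Longrightarrow> if fst f = a \<or> snd f = a then shadow (a, q) \<inter> shadow f = {fst a} else transverse (a, q) f"
    and "\<And>f g. f \<in> R \<Longrightarrow> g \<in> R \<Longrightarrow> f \<noteq> g \<Longrightarrow> shadow (a, q) \<inter> shadow f \<inter> shadow g = {}"
  using assms unfolding hooks_def by blast+

lemma shadow_swap: "shadow (a, b) = shadow (b, a)"
  "open_shadow (a, b) = open_shadow (b, a)" "solid (a, b) = solid (b, a)"
  by (auto simp: shadow_def open_shadow_def solid_def closed_segment_commute open_segment_commute)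

lemma transverse_swap: "transverse (a, b) f \<longleftrightarrow> transverse (b, a) f"
  unfolding transverse_def shadow_swap[of a b] ..

lemma ends_in_shadow: "fst (fst e) \<in> shadow e" "fst (snd e) \<in> shadow e" "fst e \<in> solid e" "snd e \<in> solid e"
  by (simp_all add: shadow_def solid_def)

lemma ends_not_in_open_shadow: "fst (fst e) \<notin> open_shadow e" "fst (snd e) \<notin> open_shadow e"
  by (simp_all add: open_shadow_def open_segment_def)

text \<open>A common point of the new edge and an old one is either \<open>fst a\<close> or interior
  to both edges. The free end \<open>q\<close> is neither, so it lies off the old curve.\<close>

lemma hooks_tip:
  assumes "hooks R a q" "f \<in> R"
  shows "fst f \<noteq> q" "snd f \<noteq> q" "fst q \<notin> shadow f"
proof -
  have fa: "fst a \<noteq> fst q" by (rule hooksD(1)[OF assms(1)])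
  have s: "fst q \<notin> shadow f"
  proof
    assume "fst q \<in> shadow f"
    then have q: "fst q \<in> shadow (a, q) \<inter> shadow f" using ends_in_shadow(2)[of "(a, q)"] by simp
    have "if fst f = a \<or> snd f = a then shadow (a, q) \<inter> shadow f = {fst a} else transverse (a, q) f"
      by (rule hooksD(2)[OF assms])
    moreover have "fst q \<notin> {fst a}" using fa by simp
    ultimately have "transverse (a, q) f" using q by (metis (full_types))
    then have "fst q \<in> open_shadow (a, q)" using transverse_point(1) q by blast
    then show False using ends_not_in_open_shadow(2)[of "(a, q)"] by simp
  qed
  then show "fst q \<notin> shadow f" .
  show "fst f \<noteq> q" "snd f \<noteq> q" using s ends_in_shadow(1,2)[of f] by auto
qed

lemma generic_bent:
  assumes R: "generic_diagram R" and u: "u \<notin> fst ` R" and v: "v \<notin> snd ` R"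
    and hu: "hooks R u q" and hv: "hooks R v q"
    and q: "shadow (u, q) \<inter> shadow (q, v) = {fst q}"
  shows "generic_diagram (bent R u q v)"
proof -
  have uq: "fst u \<noteq> fst q" "fst v \<noteq> fst q" using hooksD(1)[OF hu] hooksD(1)[OF hv] by simp_all
  have "u \<noteq> v"
  proof
    assume "u = v"
    then have "fst u \<in> shadow (u, q) \<inter> shadow (q, v)"
      using ends_in_shadow(1)[of "(u, q)"] ends_in_shadow(2)[of "(q, v)"] by simp
    then show False using q uq by simp
  qed
  have hu1: "if fst f = u \<or> snd f = u then shadow (u, q) \<inter> shadow f = {fst u} else transverse (u, q) f"
    and hv1: "if fst f = v \<or> snd f = v then shadow (v, q) \<inter> shadow f = {fst v} else transverse (v, q) f"
    if "f \<in> R" for f using hooksD(2)[OF hu that] hooksD(2)[OF hv that] .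
  have 1: "generic_diagram (insert (u, q) R)"
  proof (rule generic_insert[OF R uq(1) u])
    show "q \<notin> snd ` R" using hooks_tip(2)[OF hu] by (metis imageE)
    show "shadow f \<inter> shadow (u, q) = {fst u}" if "f \<in> R" "snd f = u" for f
      using hu1[OF that(1)] that by (simp add: Int_commute)
    show "shadow (u, q) \<inter> shadow f = {fst q}" if "f \<in> R" "fst f = q" for f
      using hooks_tip(1)[OF hu that(1)] that by simp
    show "transverse (u, q) f" if "f \<in> R" "snd f \<noteq> u" for f
    proof -
      have "fst f \<noteq> u" using u that(1) by blast
      then show ?thesis using hu1[OF that(1)] that by simp
    qed
    show "shadow (u, q) \<inter> shadow f \<inter> shadow g = {}" if "f \<in> R" "g \<in> R" "f \<noteq> g" for f g
      using hooksD(3)[OF hu that] .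
  qed
  show ?thesis unfolding bent_def
  proof (rule generic_insert[OF 1])
    show "fst q \<noteq> fst v" using uq by simp
    have "q \<notin> fst ` R" using hooks_tip(1)[OF hu] by (metis imageE)
    moreover have "u \<noteq> q" "v \<noteq> q" using uq by blast+
    ultimately show "q \<notin> fst ` insert (u, q) R" by simp
    show "v \<notin> snd ` insert (u, q) R" using v \<open>v \<noteq> q\<close> by simp
    show "shadow f \<inter> shadow (q, v) = {fst q}" if "f \<in> insert (u, q) R" "snd f = q" for f
      using that hooks_tip(2)[OF hu, of f] q by (cases "f = (u, q)") simp_all
    show "shadow (q, v) \<inter> shadow f = {fst v}" if "f \<in> insert (u, q) R" "fst f = v" for f
    proof -
      have "f \<in> R" using that \<open>u \<noteq> v\<close> by (cases "f = (u, q)") simp_all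
      then show ?thesis using hv1 that by (simp add: shadow_swap(1)[of q v])
    qed
    show "transverse (q, v) f" if "f \<in> insert (u, q) R" "snd f \<noteq> q" "fst f \<noteq> v" for f
    proof -
      have "f \<in> R" using that by (cases "f = (u, q)") simp_all
      moreover have "snd f \<noteq> v" using v \<open>f \<in> R\<close> by blast
      ultimately show ?thesis using hv1[of f] that by (simp add: transverse_swap[of q v])
    qed
    have t: "shadow (q, v) \<inter> shadow (u, q) \<inter> shadow g = {}" if "g \<in> R" for g
    proof -
      have "shadow (q, v) \<inter> shadow (u, q) = {fst q}" using q by (simp add: Int_commute)
      then show ?thesis using hooks_tip(3)[OF hu that] by simp
    qed
    show "shadow (q, v) \<inter> shadow f \<inter> shadow g = {}"
      if fg: "f \<in> insert (u, q) R" "g \<in> insert (u, q) R" "f \<noteq> g" for f g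
    proof -
      consider "f = (u, q)" "g \<in> R" | "f \<in> R" "g = (u, q)" | "f \<in> R" "g \<in> R" using fg by blast
      then show ?thesis
      proof cases
        case 1 then show ?thesis using t by simp
      next
        case 2 then show ?thesis using t[of f] by blast
      next
        case 3 then show ?thesis using hooksD(3)[OF hv] fg by (simp add: shadow_swap(1)[of q v])
      qed
    qed
  qed
qed

text \<open>\<open>ends\<close> forgets directions. When the inside of a disk is exchanged, a strand
  must still begin where one began and end where one ended; otherwise two edges could leave the same
  boundary vertex.\<close>

definition starts :: "edge set \<Rightarrow> vertex set" where
  "starts D = fst ` D - snd ` D"

definition finishes :: "edge set \<Rightarrow> vertex set" where
  "finishes D = snd ` D - fst ` D"

lemma ends_eq: "ends D = starts D \<union> finishes D"
  by (simp add: ends_def starts_def finishes_def)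

lemma ends_subset_verts: "ends D \<subseteq> verts D"
  by (auto simp: ends_def verts_def)

section \<open>Diagrams in the disk and motions of a single vertex\<close>

lemma disk_diagramD:
  assumes "disk_diagram D"
  shows "generic_diagram D" and "\<And>v. v \<in> verts D \<Longrightarrow> fst v \<in> cball 0 1"
    and "\<And>v. v \<in> verts D \<Longrightarrow> v \<in> ends D \<longleftrightarrow> fst v \<in> sphere 0 1"
  using assms unfolding disk_diagram_def by blast+

lemma disk_diagramI:
  assumes "generic_diagram D" and "\<And>v. v \<in> verts D \<Longrightarrow> fst v \<in> cball 0 1"
    and "\<And>v. v \<in> verts D \<Longrightarrow> v \<in> ends D \<longleftrightarrow> fst v \<in> sphere 0 1"
  shows "disk_diagram D"
  using assms unfolding disk_diagram_def by blast

text \<open>The part of \<open>disk_diagram\<close> that concerns the circle. It is insensitive to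
  the position of a vertex in the open disk, so it needs to be known only once for a whole motion of
  such a vertex.\<close>

definition framed :: "edge set \<Rightarrow> bool" where
  "framed D \<longleftrightarrow> (\<forall>v\<in>verts D. fst v \<in> cball 0 1 \<and> (v \<in> ends D \<longleftrightarrow> fst v \<in> sphere 0 1))"

lemma disk_diagram_iff: "disk_diagram D \<longleftrightarrow> generic_diagram D \<and> framed D"
  unfolding disk_diagram_def framed_def by blast

text \<open>
  An edge from \<open>u\<close> to \<open>v\<close> can be replaced by two edges meeting at \<open>q\<close>; \<open>R\<close> is the rest of the diagram.
\<close>

definition clean :: "edge set \<Rightarrow> vertex \<Rightarrow> vertex \<Rightarrow> vertex \<Rightarrow> bool" where
  "clean R u q v \<longleftrightarrow> hooks R u q \<and> hooks R v q \<and>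
     shadow (u, q) \<inter> shadow (q, v) = {fst q} \<and> fst q \<in> ball 0 1"

lemma cleanD:
  assumes "clean R u q v"
  shows "hooks R u q" "hooks R v q" "shadow (u, q) \<inter> shadow (q, v) = {fst q}" "fst q \<in> ball 0 1"
    and "fst u \<noteq> fst q" "fst v \<noteq> fst q" "q \<noteq> u" "q \<noteq> v" "q \<notin> fst ` R" "q \<notin> snd ` R"
proof -
  show h: "hooks R u q" "hooks R v q" "shadow (u, q) \<inter> shadow (q, v) = {fst q}" "fst q \<in> ball 0 1"
    using assms unfolding clean_def by blast+
  show "fst u \<noteq> fst q" "fst v \<noteq> fst q" using hooksD(1) h by blast+
  then show "q \<noteq> u" "q \<noteq> v" by blast+
  show "q \<notin> fst ` R" "q \<notin> snd ` R" using hooks_tip(1,2)[OF h(1)] by (metis imageE)+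
qed

lemma verts_bent: "verts (bent R u q v) = insert q (verts (insert (u, v) R))"
  by (simp add: verts_def bent_def insert_commute)

lemma ends_bent:
  assumes "q \<notin> fst ` R" "q \<notin> snd ` R" "q \<noteq> u" "q \<noteq> v"
  shows "ends (bent R u q v) = ends (insert (u, v) R)"
  using assms by (simp add: ends_def bent_def) blast

lemma framed_bent:
  assumes "q \<notin> fst ` R" "q \<notin> snd ` R" "q \<noteq> u" "q \<noteq> v" "fst q \<in> ball 0 1"
  shows "framed (bent R u q v) \<longleftrightarrow> framed (insert (u, v) R)"
proof -
  have q: "q \<notin> verts (insert (u, v) R)" using assms by (simp add: verts_def)
  then have "q \<notin> ends (insert (u, v) R)" using ends_subset_verts by blast
  then show ?thesis
    using assms(5) unfolding framed_def verts_bent ends_bent[OF assms(1-4)] by simp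
qed

lemma disk_bent:
  assumes "generic_diagram R" "u \<notin> fst ` R" "v \<notin> snd ` R" "framed (insert (u, v) R)" "clean R u q v"
  shows "disk_diagram (bent R u q v)"
  unfolding disk_diagram_iff
  using generic_bent[OF assms(1-3) cleanD(1-3)[OF assms(5)]] framed_bent[OF cleanD(9,10,7,8,4)[OF assms(5)]]
    assms(4) by simp

lemma map_bent:
  assumes "p \<notin> fst ` R" "p \<notin> snd ` R" "p \<noteq> u" "p \<noteq> v"
  shows "map_prod (id(p := q)) (id(p := q)) ` bent R u p v = bent R u q v"
proof -
  have "map_prod (id(p := q)) (id(p := q)) e = e" if "e \<in> R" for e
  proof -
    have "fst e \<noteq> p" "snd e \<noteq> p" using assms that by blast+
    then show ?thesis by (cases e) simp
  qed
  then have "map_prod (id(p := q)) (id(p := q)) ` R = R" by force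
  then show ?thesis using assms by (simp add: bent_def)
qed

text \<open>Only \<open>p\<close> moves, so \<open>id(p := r t)\<close> is the isotopy. What has to
  be known at each time is how the two edges at the moving vertex meet the rest; the genericity of
  \<open>R\<close> and the frame are read off from the initial diagram.\<close>

lemma slide_isotopic:
  assumes D: "disk_diagram (bent R u p v)" and new: "(u, p) \<notin> R" "(p, v) \<notin> R"
    and c: "\<And>t. 0 \<le> t \<Longrightarrow> t \<le> 1 \<Longrightarrow> clean R u ((1 - t) *\<^sub>R p + t *\<^sub>R q) v"
  shows "planar_isotopic (bent R u p v) (bent R u q v)" and "disk_diagram (bent R u q v)"
proof -
  define r where "r t = (1 - t) *\<^sub>R p + t *\<^sub>R q" for t :: real
  have r01: "r 0 = p" "r 1 = q" by (simp_all add: r_def)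
  have c': "clean R u (r t) v" if "t \<in> {0..1}" for t using c that by (simp add: r_def)
  note p = cleanD[OF c'[of 0, unfolded r01, simplified]]
  have G: "generic_diagram (bent R u p v)" using D unfolding disk_diagram_iff by simp
  have R: "generic_diagram R" by (rule generic_subset[OF G]) (auto simp: bent_def)
  have u: "u \<notin> fst ` R"
  proof
    assume "u \<in> fst ` R"
    then obtain f where "f \<in> R" "fst f = fst (u, p)" by auto
    then show False using genericD(2)[OF G] new unfolding bent_def by (metis inj_onD insertI1 insertI2)
  qed
  have v: "v \<notin> snd ` R"
  proof
    assume "v \<in> snd ` R"
    then obtain f where "f \<in> R" "snd f = snd (p, v)" by auto
    then show False using genericD(3)[OF G] new unfolding bent_def by (metis inj_onD insertI1 insertI2)
  qed
  have F: "framed (insert (u, v) R)"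
    using D framed_bent[OF p(9,10,7,8,4)] unfolding disk_diagram_iff by simp
  have dd: "disk_diagram (bent R u (r t) v)" if "t \<in> {0..1}" for t
    using disk_bent[OF R u v F c'[OF that]] .
  then show "disk_diagram (bent R u q v)" using r01 by (metis atLeastAtMost_iff order_refl zero_le_one)
  define \<phi> where "\<phi> t = id(p := r t)" for t
  have m: "map_prod (\<phi> t) (\<phi> t) ` bent R u p v = bent R u (r t) v" for t
    unfolding \<phi>_def by (rule map_bent[OF p(9,10,7,8)])
  show "planar_isotopic (bent R u p v) (bent R u q v)"
    unfolding planar_isotopic_def
  proof (intro exI[of _ \<phi>] conjI ballI)
    fix w assume w: "w \<in> verts (bent R u p v)"
    show "continuous_on {0..1} (\<lambda>t. \<phi> t w)"
      by (cases "w = p") (auto simp: \<phi>_def r_def intro!: continuous_intros)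
    show "\<phi> 0 w = w" by (simp add: \<phi>_def r01)
  next
    fix t :: real assume t: "t \<in> {0..1}"
    note q = cleanD[OF c'[OF t]]
    have "r t \<notin> verts (insert (u, v) R)" using q(7-10) by (simp add: verts_def)
    then show "inj_on (\<phi> t) (verts (bent R u p v))"
      unfolding verts_bent \<phi>_def by (auto simp: inj_on_def simp del: split_paired_All)
    show "disk_diagram (map_prod (\<phi> t) (\<phi> t) ` bent R u p v)"
      unfolding m using dd t .
    fix w assume "w \<in> ends (bent R u p v)"
    then have "w \<noteq> p" using ends_bent[OF p(9,10,7,8)] p(7-10) ends_subset_verts[of "insert (u, v) R"]
      by (auto simp: verts_def simp del: split_paired_All)
    then show "\<phi> t w = w" by (simp add: \<phi>_def)
  next
    show "bent R u q v = map_prod (\<phi> 1) (\<phi> 1) ` bent R u p v" unfolding m r01 ..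
  qed
qed

lemma subdivide_edge:
  assumes D: "disk_diagram (insert (u, v) R)" and new: "(u, v) \<notin> R"
    and m: "m \<in> open_segment u v" and c: "clean R u m v"
  shows "subdivision (insert (u, v) R) (bent R u m v)"
proof -
  have G: "generic_diagram (insert (u, v) R)" and F: "framed (insert (u, v) R)"
    using D unfolding disk_diagram_iff by simp_all
  have R: "generic_diagram R" by (rule generic_subset[OF G]) auto
  have u: "u \<notin> fst ` R"
  proof
    assume "u \<in> fst ` R"
    then obtain f where "f \<in> R" "fst f = fst (u, v)" by auto
    then show False using genericD(2)[OF G] new by (metis inj_onD insertI1 insertI2)
  qed
  have v: "v \<notin> snd ` R"
  proof
    assume "v \<in> snd ` R"
    then obtain f where "f \<in> R" "snd f = snd (u, v)" by auto
    then show False using genericD(3)[OF G] new by (metis inj_onD insertI1 insertI2)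
  qed
  have "bent R u m v = insert (u, v) R - {(u, v)} \<union> {(u, m), (m, v)}"
    using new by (auto simp: bent_def simp del: split_paired_All)
  then show ?thesis
    unfolding subdivision_def using D disk_bent[OF R u v F c] m by blast
qed

section \<open>Removing a straight vertex\<close>

lemma in_segment_of_halves:
  fixes u :: "'a::euclidean_space"
  assumes "m \<in> closed_segment u v" "x \<in> closed_segment u m" "y \<in> closed_segment m v"
  shows "m \<in> closed_segment x y"
proof -
  have "between (v, x) m"
    using assms(1,2) between_trans_2[of u v m x] by (simp add: between_mem_segment closed_segment_commute)
  then show ?thesis
    using assms(3) between_trans_2[of v x m y] by (simp add: between_mem_segment closed_segment_commute)
qed

lemma fst_in_segment:
  fixes u v m :: vertex
  shows "m \<in> closed_segment u v \<Longrightarrow> fst m \<in> closed_segment (fst u) (fst v)"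
  by (auto simp: closed_segment_def)

text \<open>
  Removing a straight vertex: an edge that met both halves would, being convex, contain the vertex.
\<close>

lemma generic_merge:
  assumes G: "generic_diagram R" and u: "u \<notin> fst ` R" and v: "v \<notin> snd ` R"
    and m: "m \<in> closed_segment u v" and c: "clean R u m v"
  shows "generic_diagram (insert (u, v) R)"
proof -
  note c = cleanD[OF c]
  have s: "shadow (u, v) = shadow (u, m) \<union> shadow (m, v)"
    using Un_closed_segment[OF fst_in_segment[OF m]] by (simp add: shadow_def)
  have sol: "solid (u, v) = solid (u, m) \<union> solid (m, v)"
    using Un_closed_segment[OF m] by (simp add: solid_def)
  have swap: "shadow (v, m) = shadow (m, v)" by (rule shadow_swap)
  have one: "shadow (u, m) \<inter> shadow f = {} \<or> shadow (m, v) \<inter> shadow f = {}" if f: "f \<in> R" for f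
  proof (rule ccontr)
    assume "\<not> ?thesis"
    then obtain x y where xy: "x \<in> shadow (u, m)" "x \<in> shadow f" "y \<in> shadow (m, v)" "y \<in> shadow f" by blast
    have "fst m \<in> closed_segment x y"
      using in_segment_of_halves[OF fst_in_segment[OF m]] xy by (simp add: shadow_def)
    then have "fst m \<in> shadow f"
      using closed_segment_subset[of x "shadow f" y] xy by (auto simp: shadow_def)
    then show False using hooks_tip(3)[OF c(1) f] by simp
  qed
  have op: "open_shadow (u, m) \<subseteq> open_shadow (u, v)" "open_shadow (m, v) \<subseteq> open_shadow (u, v)"
    using fst_in_segment[OF m] unfolding open_shadow_def by (auto simp: subset_open_segment)
  have h: "if fst f = u \<or> snd f = u then shadow (u, m) \<inter> shadow f = {fst u} else transverse (u, m) f"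
    "if fst f = v \<or> snd f = v then shadow (m, v) \<inter> shadow f = {fst v} else transverse (m, v) f"
    if "f \<in> R" for f
    using hooksD(2)[OF c(1) that] hooksD(2)[OF c(2) that] unfolding swap transverse_swap[of v m] .
  have uf: "shadow (u, m) \<inter> shadow f = {fst u}" if "f \<in> R" "snd f = u" for f using h(1)[OF that(1)] that by simp
  have vf: "shadow (m, v) \<inter> shadow f = {fst v}" if "f \<in> R" "fst f = v" for f using h(2)[OF that(1)] that by simp
  show ?thesis
  proof (rule generic_insert[OF G _ u v])
    show "fst u \<noteq> fst v" using fst_in_segment[OF m] c(5) by (metis closed_segment_idem singletonD)
    show "shadow f \<inter> shadow (u, v) = {fst u}" if "f \<in> R" "snd f = u" for f
      using uf[OF that] one[OF that(1)] unfolding s by blast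
    show "shadow (u, v) \<inter> shadow f = {fst v}" if "f \<in> R" "fst f = v" for f
      using vf[OF that] one[OF that(1)] unfolding s by blast
    show "transverse (u, v) f" if f: "f \<in> R" "snd f \<noteq> u" "fst f \<noteq> v" for f
    proof -
      have "fst f \<noteq> u" "snd f \<noteq> v" using u v f by blast+
      then have t: "transverse (u, m) f" "transverse (m, v) f" using h[OF f(1)] f by simp_all
      show ?thesis unfolding transverse_def
      proof
        show "solid (u, v) \<inter> solid f = {}" using t unfolding transverse_def sol by blast
        show "shadow (u, v) \<inter> shadow f = {} \<or>
          (\<exists>p\<in>open_shadow (u, v) \<inter> open_shadow f. shadow (u, v) \<inter> shadow f = {p})"
          using one[OF f(1)]
        proof
          assume "shadow (u, m) \<inter> shadow f = {}"
          then have e: "shadow (u, v) \<inter> shadow f = shadow (m, v) \<inter> shadow f" unfolding s by blast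
          show ?thesis unfolding e using t(2) op(2) unfolding transverse_def by (meson IntD1 IntD2 IntI subsetD)
        next
          assume "shadow (m, v) \<inter> shadow f = {}"
          then have e: "shadow (u, v) \<inter> shadow f = shadow (u, m) \<inter> shadow f" unfolding s by blast
          show ?thesis unfolding e using t(1) op(1) unfolding transverse_def by (meson IntD1 IntD2 IntI subsetD)
        qed
      qed
    qed
    show "shadow (u, v) \<inter> shadow f \<inter> shadow g = {}" if "f \<in> R" "g \<in> R" "f \<noteq> g" for f g
      using hooksD(3)[OF c(1) that] hooksD(3)[OF c(2) that] unfolding s swap by blast
  qed
qed

section \<open>Ends of strands under isotopies, and reversal of steps\<close>

lemma verts_map: "verts (map_prod g g ` D) = g ` verts D"
  by (simp add: verts_def image_Un image_image)

lemma starts_map: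
  assumes "inj_on g (verts D)"
  shows "starts (map_prod g g ` D) = g ` starts D" "finishes (map_prod g g ` D) = g ` finishes D"
proof -
  have V: "fst ` D \<subseteq> verts D" "snd ` D \<subseteq> verts D" by (auto simp: verts_def)
  have I: "fst ` map_prod g g ` D = g ` fst ` D" "snd ` map_prod g g ` D = g ` snd ` D"
    by (simp_all add: image_image)
  have W: "fst ` D - snd ` D \<subseteq> verts D" "snd ` D - fst ` D \<subseteq> verts D" using V by blast+
  show "starts (map_prod g g ` D) = g ` starts D" "finishes (map_prod g g ` D) = g ` finishes D"
    unfolding starts_def finishes_def I
    by (rule inj_on_image_set_diff[OF assms W(1) V(2), symmetric] inj_on_image_set_diff[OF assms W(2) V(1),
        symmetric])+
qed

lemma isotopicD:
  assumes "planar_isotopic D D'"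
  obtains \<phi> :: "real \<Rightarrow> vertex \<Rightarrow> vertex"
  where "\<And>v. v \<in> verts D \<Longrightarrow> continuous_on {0..1} (\<lambda>t. \<phi> t v)" "\<And>v. v \<in> verts D \<Longrightarrow> \<phi> 0 v = v"
    "\<And>t. t \<in> {0..1} \<Longrightarrow> inj_on (\<phi> t) (verts D)"
    "\<And>t. t \<in> {0..1} \<Longrightarrow> disk_diagram (map_prod (\<phi> t) (\<phi> t) ` D)"
    "\<And>t v. t \<in> {0..1} \<Longrightarrow> v \<in> ends D \<Longrightarrow> \<phi> t v = v"
    "D' = map_prod (\<phi> 1) (\<phi> 1) ` D"
proof -
  from assms obtain \<phi> :: "real \<Rightarrow> vertex \<Rightarrow> vertex" where
    1: "\<forall>v\<in>verts D. continuous_on {0..1} (\<lambda>t. \<phi> t v) \<and> \<phi> 0 v = v"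
    and 2: "\<forall>t\<in>{0..1}. inj_on (\<phi> t) (verts D) \<and> disk_diagram (map_prod (\<phi> t) (\<phi> t) ` D) \<and>
           (\<forall>v\<in>ends D. \<phi> t v = v)"
    and 3: "D' = map_prod (\<phi> 1) (\<phi> 1) ` D"
    unfolding planar_isotopic_def by (elim exE conjE)
  show thesis
    by (rule that[of \<phi>]; (rule 1[rule_format, THEN conjunct1] 1[rule_format, THEN conjunct2]
        2[rule_format, THEN conjunct1] 2[rule_format, THEN conjunct2, THEN conjunct1]
        2[rule_format, THEN conjunct2, THEN conjunct2, rule_format] 3; assumption?))
qed

lemma map_prod_ident:
  assumes "\<And>v. v \<in> verts D \<Longrightarrow> g v = v" shows "map_prod g g ` D = D"
proof -
  have "map_prod g g e = e" if "e \<in> D" for e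
  proof -
    have "fst e \<in> verts D" "snd e \<in> verts D" using that by (auto simp: verts_def)
    then show ?thesis using assms by (simp add: map_prod_def case_prod_unfold)
  qed
  then have "map_prod g g ` D = (\<lambda>e. e) ` D" by (rule image_cong[OF refl])
  then show ?thesis by (rule trans[OF _ image_ident])
qed

lemma isotopic_boundary:
  assumes "planar_isotopic D D'"
  shows "disk_diagram D" "disk_diagram D'" "starts D' = starts D" "finishes D' = finishes D"
proof -
  obtain \<phi> :: "real \<Rightarrow> vertex \<Rightarrow> vertex" where
    "\<And>v. v \<in> verts D \<Longrightarrow> continuous_on {0..1} (\<lambda>t. \<phi> t v)" and \<phi>:
    "\<And>v. v \<in> verts D \<Longrightarrow> \<phi> 0 v = v" "\<And>t. t \<in> {0..1} \<Longrightarrow> inj_on (\<phi> t) (verts D)"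
    "\<And>t. t \<in> {0..1} \<Longrightarrow> disk_diagram (map_prod (\<phi> t) (\<phi> t) ` D)"
    "\<And>t v. t \<in> {0..1} \<Longrightarrow> v \<in> ends D \<Longrightarrow> \<phi> t v = v" "D' = map_prod (\<phi> 1) (\<phi> 1) ` D"
    by (rule isotopicD[OF assms]) (rule that)
  show "disk_diagram D" using \<phi>(3)[of 0] map_prod_ident[of D "\<phi> 0"] \<phi>(1) by simp
  show "disk_diagram D'" using \<phi>(3)[of 1] \<phi>(5) by simp
  have "\<phi> 1 ` starts D = starts D" "\<phi> 1 ` finishes D = finishes D"
    using image_cong[of _ _ "\<phi> 1" "\<lambda>v. v"] \<phi>(4)[of 1] unfolding ends_eq by simp_all
  then show "starts D' = starts D" "finishes D' = finishes D"
    using starts_map[OF \<phi>(2)[of 1]] \<phi>(5) by simp_all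
qed

text \<open>Time runs backwards: the vertex that \<open>v\<close> has become at time 1 travels back
  along the path of \<open>v\<close>. Injectivity of \<open>\<phi> 1\<close> on the vertices makes
  \<open>v\<close> recoverable as the value of \<open>g\<close>.\<close>

lemma isotopic_sym:
  assumes "planar_isotopic D D'"
  shows "planar_isotopic D' D"
proof -
  obtain \<phi> :: "real \<Rightarrow> vertex \<Rightarrow> vertex" where \<phi>:
    "\<And>v. v \<in> verts D \<Longrightarrow> continuous_on {0..1} (\<lambda>t. \<phi> t v)"
    "\<And>v. v \<in> verts D \<Longrightarrow> \<phi> 0 v = v" "\<And>t. t \<in> {0..1} \<Longrightarrow> inj_on (\<phi> t) (verts D)"
    "\<And>t. t \<in> {0..1} \<Longrightarrow> disk_diagram (map_prod (\<phi> t) (\<phi> t) ` D)"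
    "\<And>t v. t \<in> {0..1} \<Longrightarrow> v \<in> ends D \<Longrightarrow> \<phi> t v = v" "D' = map_prod (\<phi> 1) (\<phi> 1) ` D"
    by (rule isotopicD[OF assms]) (rule that)
  define g where "g = inv_into (verts D) (\<phi> 1)"
  have inj: "inj_on (\<phi> 1) (verts D)" using \<phi>(3) by simp
  have g: "g (\<phi> 1 v) = v" if "v \<in> verts D" for v
    unfolding g_def using inj that by (rule inv_into_f_f)
  have V: "verts D' = \<phi> 1 ` verts D" unfolding \<phi>(6) by (rule verts_map)
  have E: "ends D' = ends D"
    using isotopic_boundary(3,4)[OF assms] by (simp add: ends_eq)
  have m: "map_prod (\<lambda>v. \<phi> (1 - t) (g v)) (\<lambda>v. \<phi> (1 - t) (g v)) ` D' = map_prod (\<phi> (1 - t)) (\<phi> (1 - t)) ` D" for t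
    unfolding \<phi>(6) image_image
  proof (rule image_cong[OF refl])
    fix e assume "e \<in> D"
    then have "fst e \<in> verts D" "snd e \<in> verts D" by (auto simp: verts_def)
    then show "map_prod (\<lambda>v. \<phi> (1 - t) (g v)) (\<lambda>v. \<phi> (1 - t) (g v)) (map_prod (\<phi> 1) (\<phi> 1) e)
        = map_prod (\<phi> (1 - t)) (\<phi> (1 - t)) e"
      using g by (cases e) simp
  qed
  show ?thesis
    unfolding planar_isotopic_def
  proof (intro exI[of _ "\<lambda>t v. \<phi> (1 - t) (g v)"] conjI ballI)
    fix w assume "w \<in> verts D'"
    then obtain v where v: "v \<in> verts D" "w = \<phi> 1 v" using V by blast
    have "continuous_on {0..1} ((\<lambda>t. \<phi> t v) \<circ> (\<lambda>t. 1 - t))"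
      by (intro continuous_on_compose continuous_intros continuous_on_subset[OF \<phi>(1)[OF v(1)]]) auto
    then show "continuous_on {0..1} (\<lambda>t. \<phi> (1 - t) (g w))"
      using g v by (simp add: o_def)
    show "\<phi> (1 - 0) (g w) = w" using g v by simp
  next
    fix t :: real assume t: "t \<in> {0..1}"
    then have t': "1 - t \<in> {0..1}" by simp
    show "inj_on (\<lambda>v. \<phi> (1 - t) (g v)) (verts D')"
      using \<phi>(3)[OF t'] g unfolding V by (auto simp: inj_on_def simp del: split_paired_All)
    show "disk_diagram (map_prod (\<lambda>v. \<phi> (1 - t) (g v)) (\<lambda>v. \<phi> (1 - t) (g v)) ` D')"
      unfolding m using \<phi>(4) t' .
    fix v assume "v \<in> ends D'"
    then have v: "v \<in> ends D" "v \<in> verts D" using E ends_subset_verts by blast+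
    then have "\<phi> 1 v = v" using \<phi>(5)[of 1] by simp
    then have "g v = v" using g[OF v(2)] by simp
    then show "\<phi> (1 - t) (g v) = v" using \<phi>(5)[OF t' v(1)] by simp
  next
    show "D = map_prod (\<lambda>v. \<phi> (1 - 1) (g v)) (\<lambda>v. \<phi> (1 - 1) (g v)) ` D'"
      unfolding m using map_prod_ident[of D "\<phi> 0"] \<phi>(2) by simp
  qed
qed

lemma step_sym: "step S D D' \<Longrightarrow> step S D' D"
  by (induction rule: step.induct) (auto intro: step.intros isotopic_sym simp del: split_paired_All)

lemma steps_sym:
  assumes "(step S)\<^sup>*\<^sup>* D D'" shows "(step S)\<^sup>*\<^sup>* D' D"
  using assms
proof (induction rule: rtranclp_induct)
  case (step y z) then show ?case using step_sym[OF step(2)] by (metis converse_rtranclp_into_rtranclp)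
qed simp

section \<open>Integer tests for deformations\<close>

text \<open>
  Points stand for vertices in units of 1/1000.
\<close>

type_synonym point = "int \<times> int \<times> int"

fun orient :: "point \<Rightarrow> point \<Rightarrow> point \<Rightarrow> int" where
  "orient (ax, ay, _) (bx, by, _) (cx, cy, _) = (bx - ax) * (cy - ay) - (by - ay) * (cx - ax)"

fun orient3 :: "point \<Rightarrow> point \<Rightarrow> point \<Rightarrow> point \<Rightarrow> int" where
  "orient3 (ax, ay, ah) (bx, by, bh) (cx, cy, ch) (dx, dy, dh) =
     (bx - ax) * ((cy - ay) * (dh - ah) - (ch - ah) * (dy - ay))
   - (by - ay) * ((cx - ax) * (dh - ah) - (ch - ah) * (dx - ax))
   + (bh - ah) * ((cx - ax) * (dy - ay) - (cy - ay) * (dx - ax))"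

fun dot :: "point \<Rightarrow> point \<Rightarrow> point \<Rightarrow> int" where
  "dot (ax, ay, _) (bx, by, _) (cx, cy, _) = (bx - ax) * (cx - ax) + (by - ay) * (cy - ay)"

text \<open>The determinant of \<open>not_concurrent\<close> for the edge from \<open>a\<close> to
  \<open>p\<close>; it is affine in \<open>p\<close>.\<close>

fun concurrence :: "point \<Rightarrow> point \<Rightarrow> point \<times> point \<Rightarrow> point \<times> point \<Rightarrow> int" where
  "concurrence a p (f, f') (g, g') = orient a p g * orient f f' g' - orient a p g' * orient f f' g"

datatype contact = Apart | Crossing | Bad

definition same_sign :: "int \<Rightarrow> int \<Rightarrow> bool" where
  "same_sign s t = (if 0 < s then 0 < t else if s < 0 then t < 0 else False)"

definition below :: "int \<Rightarrow> int \<Rightarrow> int \<Rightarrow> int \<Rightarrow> int \<Rightarrow> bool" where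
  "below a p q c d =
     (if a < c then if a < d then if p < c then if p < d then if q < c then q < d
      else False else False else False else False else False)"

definition above :: "int \<Rightarrow> int \<Rightarrow> int \<Rightarrow> int \<Rightarrow> int \<Rightarrow> bool" where
  "above a p q c d =
     (if c < a then if d < a then if c < p then if d < p then if c < q then d < q
      else False else False else False else False else False)"

text \<open>Separation by a line parallel to an axis: all three positions \<open>a\<close>,
  \<open>p\<close>, \<open>q\<close> lie strictly on one side of \<open>c\<close> and
  \<open>d\<close>. It needs no products and is tried before the determinants.\<close>

fun boxed :: "point \<Rightarrow> point \<Rightarrow> point \<Rightarrow> point \<Rightarrow> point \<Rightarrow> bool" where
  "boxed (ax, ay, _) (px, py, _) (qx, qy, _) (cx, cy, _) (dx, dy, _) =
     (if below ax px qx cx dx then True else if above ax px qx cx dx then True else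
      if below ay py qy cy dy then True else above ay py qy cy dy)"

definition opposite :: "int \<Rightarrow> int \<Rightarrow> bool" where
  "opposite s t = same_sign s (- t)"

text \<open>
  The edge between \<open>a\<close> and a vertex that moves from \<open>p\<close> to \<open>q\<close> is compared with a fixed edge between
  \<open>c\<close> and \<open>d\<close>.  All quantities are affine in the moving vertex, so equal signs at the two ends persist in
  between.  Nested conditionals, here and below, keep the evaluation lazy.
\<close>

definition contact3 :: "bool \<Rightarrow> int \<Rightarrow> int \<Rightarrow> int \<Rightarrow> int \<Rightarrow> point \<Rightarrow> point \<Rightarrow> point \<Rightarrow> point \<Rightarrow> point \<Rightarrow> contact" where
  "contact3 split pc qc pd qd a p q c d =
     (if same_sign pc qc then
        if same_sign pd qd then
          if same_sign pc pd then Apart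
          else if split then if same_sign (orient3 a p c d) (orient3 a q c d) then Crossing else Bad else Bad
        else Bad
      else Bad)"

definition contact2 :: "int \<Rightarrow> int \<Rightarrow> int \<Rightarrow> point \<Rightarrow> point \<Rightarrow> point \<Rightarrow> point \<Rightarrow> point \<Rightarrow> contact" where
  "contact2 sa sp sq a p q c d =
     (if (if same_sign sa sp then same_sign sa sq else False) then Apart
      else contact3 (if opposite sa sp then opposite sa sq else False)
             (orient a p c) (orient a q c) (orient a p d) (orient a q d) a p q c d)"

definition contact :: "point \<Rightarrow> point \<Rightarrow> point \<Rightarrow> point \<Rightarrow> point \<Rightarrow> contact" where
  "contact a p q c d =
     (if boxed a p q c d then Apart
      else contact2 (orient c d a) (orient c d p) (orient c d q) a p q c d)"

definition corner :: "point \<Rightarrow> point \<Rightarrow> point \<Rightarrow> point \<Rightarrow> bool" where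
  "corner x a p q =
     (if same_sign (orient x a p) (orient x a q) then True
      else if dot a x p < 0 then dot a x q < 0 else False)"

text \<open>This excludes a triple point on an edge that crosses both \<open>f\<close> and
  \<open>g\<close>. Sharing a vertex is good enough: then \<open>f\<close> and \<open>g\<close> meet
  only there, whereas the third edge meets them only in their interiors.\<close>

fun apart :: "point \<times> point \<Rightarrow> point \<times> point \<Rightarrow> bool" where
  "apart (f, f') (g, g') =
     (if f = g then True else if f = g' then True else if f' = g then True else if f' = g' then True
      else if same_sign (orient f f' g) (orient f f' g') then True
      else same_sign (orient g g' f) (orient g g' f'))"

fun clear :: "point \<Rightarrow> point \<Rightarrow> point \<Rightarrow> point \<times> point \<Rightarrow> (point \<times> point) list \<Rightarrow> bool" where
  "clear a p q f [] = True"
| "clear a p q f (g # gs) =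
     (if (if same_sign (concurrence a p f g) (concurrence a q f g) then True else apart f g)
      then clear a p q f gs else False)"

text \<open>\<open>cs\<close> collects the edges found to be crossed by the moving edge. Only these
  can pass through a triple point with it away from \<open>a\<close>, so each newly crossed edge is
  tested for concurrence with the earlier ones. An edge incident with \<open>a\<close> is tested as
  a corner instead.\<close>

fun scan :: "point \<Rightarrow> point \<Rightarrow> point \<Rightarrow> (point \<times> point) list \<Rightarrow> (point \<times> point) list \<Rightarrow> bool" where
  "scan a p q cs [] = True"
| "scan a p q cs ((c, d) # es) =
     (if c = a then if corner d a p q then scan a p q cs es else False
      else if d = a then if corner c a p q then scan a p q cs es else False
      else case contact a p q c d of
        Apart \<Rightarrow> scan a p q cs es
      | Crossing \<Rightarrow> if clear a p q (c, d) cs then scan a p q ((c, d) # cs) es else False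
      | Bad \<Rightarrow> False)"

fun inner_point :: "point \<Rightarrow> bool" where
  "inner_point (x, y, _) = (x * x + y * y < 1000000)"

text \<open>
  The moving vertex \<open>q\<close> is a proper corner between \<open>u\<close> and \<open>v\<close> if it is off their line, or inside the circle
  with diameter \<open>u v\<close>, a convex region.  The last alternative is a vertex that leaves the segment.
\<close>

definition bend :: "(point \<times> point) list \<Rightarrow> point \<Rightarrow> point \<Rightarrow> point \<Rightarrow> point \<Rightarrow> bool" where
  "bend es u v p q =
     (if inner_point q then
        if (if same_sign (orient u p v) (orient u q v) then True
            else if dot p u v < 0 then if dot q u v < 0 then True else orient u p v = 0 \<and> orient u q v \<noteq> 0
            else False)
        then if scan u p q [] es then scan v p q [] es else False
        else False
      else False)"

fun without :: "point \<Rightarrow> (point \<times> point) list \<Rightarrow> (point \<times> point) list" where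
  "without p [] = []"
| "without p ((a, b) # es) =
     (if a = p then without p es else if b = p then without p es else (a, b) # without p es)"

fun before :: "point \<Rightarrow> (point \<times> point) list \<Rightarrow> point option" where
  "before p [] = None"
| "before p ((a, b) # es) = (if b = p then Some a else before p es)"

fun after :: "point \<Rightarrow> (point \<times> point) list \<Rightarrow> point option" where
  "after p [] = None"
| "after p ((a, b) # es) = (if a = p then Some b else after p es)"

text \<open>The three equations say that the cross product of \<open>m - u\<close> and
  \<open>v - u\<close> in space vanishes, the inequality that the projection of \<open>m\<close> is
  strictly between. Heights take part, so the points of subdivision in the scripts carry
  interpolated heights, with denominators that divide exactly.\<close>

fun on_segment :: "point \<Rightarrow> point \<Rightarrow> point \<Rightarrow> bool" where
  "on_segment (ux, uy, uh) (mx, my, mh) (vx, vy, vh) =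
     ((mx - ux) * (vy - uy) = (my - uy) * (vx - ux) \<and>
      (mx - ux) * (vh - uh) = (mh - uh) * (vx - ux) \<and>
      (my - uy) * (vh - uh) = (mh - uh) * (vy - uy) \<and>
      (ux - mx) * (vx - mx) + (uy - my) * (vy - my) < 0)"

type_synonym affine = "int \<times> int \<times> int \<times> int \<times> int \<times> int"

fun carry :: "affine \<Rightarrow> point \<Rightarrow> point" where
  "carry (a, b, c, d, r, s) (x, y, h) = ((a * x + b * y) div 1000 + r, (c * x + d * y) div 1000 + s, h)"

fun exact :: "affine \<Rightarrow> point \<Rightarrow> bool" where
  "exact (a, b, c, d, r, s) (x, y, h) = ((a * x + b * y) mod 1000 = 0 \<and> (c * x + d * y) mod 1000 = 0)"

text \<open>The adjugate matrix in place of the inverse keeps the coordinates integral. The price is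
  a factor: the image of the unit disk is pulled back to the disk of radius
  \<open>area\<close>.\<close>

fun pull :: "affine \<Rightarrow> point \<Rightarrow> int \<times> int" where
  "pull (a, b, c, d, r, s) (x, y, h) = (d * (x - r) - b * (y - s), a * (y - s) - c * (x - r))"

text \<open>
  The segment from \<open>(x, y)\<close> to \<open>(x', y')\<close> stays outside the disk of radius \<open>n\<close>.
\<close>

fun avoids :: "int \<Rightarrow> int \<times> int \<Rightarrow> int \<times> int \<Rightarrow> bool" where
  "avoids n (x, y) (x', y') =
     (if n * n \<le> x * x + y * y \<and> x * x + y * y \<le> x * x' + y * y' then True
      else if n * n \<le> x' * x' + y' * y' \<and> x' * x' + y' * y' \<le> x * x' + y * y' then True
      else n * n * ((x' - x) * (x' - x) + (y' - y) * (y' - y)) \<le> (x * y' - y * x') * (x * y' - y * x'))"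

fun area :: "affine \<Rightarrow> int" where
  "area (a, b, c, d, r, s) = a * d - b * c"

text \<open>A sufficient condition for the image of the unit disk to stay in the unit disk: for a
  matrix M and a translation w, the squared length of Mz + w is at most twice the sum of the squares
  of all coefficients.\<close>

fun small :: "affine \<Rightarrow> bool" where
  "small (a, b, c, d, r, s) =
     (0 < a * d - b * c \<and> 2 * (a * a + b * b + c * c + d * d + r * r + s * s) \<le> 1000000)"

type_synonym picture = "(point \<times> point) list \<times> (point \<times> point) list"

definition carry_edges :: "affine \<Rightarrow> (point \<times> point) list \<Rightarrow> (point \<times> point) list" where
  "carry_edges A es = map (\<lambda>(u, v). (carry A u, carry A v)) es"

definition outer :: "affine \<Rightarrow> (point \<times> point) list \<Rightarrow> (point \<times> point) list \<Rightarrow> (point \<times> point) list" where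
  "outer A L es = filter (\<lambda>e. \<not> List.member (carry_edges A L) e) es"

definition substitute :: "(point \<times> point) list \<Rightarrow> (point \<times> point) list \<Rightarrow> affine \<Rightarrow>
    (point \<times> point) list \<Rightarrow> (point \<times> point) list option" where
  "substitute L R A es =
     (if small A then
        if list_all (\<lambda>(u, v). exact A u \<and> exact A v) (L @ R) then
          if list_all (List.member es) (carry_edges A L) then
            if list_all (\<lambda>(u, v). avoids (area A) (pull A u) (pull A v)) (outer A L es)
            then Some (carry_edges A R @ outer A L es) else None
          else None
        else None
      else None)"

text \<open>\<open>Insert u v m w\<close> subdivides an edge at \<open>m\<close> and moves the new
  vertex to \<open>w\<close>; \<open>Delete p m\<close> brings \<open>p\<close> back to the point
  \<open>m\<close> of the line between its neighbours and drops it. \<open>Forward\<close> and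
  \<open>Backward\<close> take an arbitrary picture rather than a move, so that pictures realized
  before can be used.\<close>

datatype edit =
    Slide point point
  | Insert point point point point
  | Delete point point
  | Forward picture affine
  | Backward picture affine

definition insert_at :: "point \<Rightarrow> point \<Rightarrow> point \<Rightarrow> point \<Rightarrow>
    (point \<times> point) list \<Rightarrow> (point \<times> point) list option" where
  "insert_at u v m w es =
     (if on_segment u m v then
        if bend (removeAll (u, v) es) u v m w
        then Some ((u, w) # (w, v) # removeAll (u, v) es) else None
      else None)"

text \<open>\<open>Insert\<close> looks for its edge in both directions, which lets one script serve
  strands of either orientation. \<open>Delete\<close> is checked as the insertion that it undoes,
  from \<open>m\<close> to \<open>p\<close>, because \<open>bend\<close> allows a vertex to leave a
  segment but not to arrive on it along a general path.\<close>

fun exec :: "edit \<Rightarrow> (point \<times> point) list \<Rightarrow> (point \<times> point) list option" where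
  "exec (Slide p q) es =
     (case before p es of None \<Rightarrow> None | Some u \<Rightarrow>
      (case after p es of None \<Rightarrow> None | Some v \<Rightarrow>
        if bend (without p es) u v p q then Some ((u, q) # (q, v) # without p es) else None))"
| "exec (Insert u v m w) es =
     (if List.member es (u, v) then insert_at u v m w es
      else if List.member es (v, u) then insert_at v u m w es else None)"
| "exec (Delete p m) es =
     (case before p es of None \<Rightarrow> None | Some u \<Rightarrow>
      (case after p es of None \<Rightarrow> None | Some v \<Rightarrow>
        if on_segment u m v then
          if bend (without p es) u v m p then Some ((u, v) # without p es) else None
        else None))"
| "exec (Forward P A) es = substitute (fst P) (snd P) A es"
| "exec (Backward P A) es = substitute (snd P) (fst P) A es"

fun reflect_point :: "int \<Rightarrow> int \<Rightarrow> point \<Rightarrow> point" where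
  "reflect_point a b (x, y, h) = (a * x, b * y, h)"

text \<open>The signs \<open>a\<close> and \<open>b\<close> mirror or rotate the drawing only. The
  moves within a script stay as they are: a mirror image reverses orientation, which no placement
  may do, so each use supplies its moves with placements that fit the reflected drawing.\<close>

fun reflect :: "int \<Rightarrow> int \<Rightarrow> edit \<Rightarrow> edit" where
  "reflect a b (Slide p q) = Slide (reflect_point a b p) (reflect_point a b q)"
| "reflect a b (Insert u v m w) =
     Insert (reflect_point a b u) (reflect_point a b v) (reflect_point a b m) (reflect_point a b w)"
| "reflect a b (Delete p m) = Delete (reflect_point a b p) (reflect_point a b m)"
| "reflect a b (Forward P A) = Forward P A"
| "reflect a b (Backward P A) = Backward P A"

fun run :: "edit list \<Rightarrow> (point \<times> point) list \<Rightarrow> (point \<times> point) list option" where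
  "run [] es = Some es"
| "run (s # ss) es = (case exec s es of None \<Rightarrow> None | Some es' \<Rightarrow> run ss es')"

fun vert :: "point \<Rightarrow> vertex" where
  "vert (x, y, h) = ((of_int x / 1000, of_int y / 1000), of_int h / 1000)"

abbreviation arc :: "point \<times> point \<Rightarrow> edge" where
  "arc \<equiv> map_prod vert vert"

definition diag :: "(point \<times> point) list \<Rightarrow> edge set" where
  "diag es = arc ` set es"

section \<open>Integer coordinates as points of the plane\<close>

lemma vert_inj [simp]: "vert p = vert q \<longleftrightarrow> p = q"
  by (cases p; cases q) simp

lemma arc_inj: "inj arc"
  by (rule injI) (auto simp: map_prod_def split: prod.splits)

abbreviation shade :: "point \<Rightarrow> real \<times> real" where
  "shade p \<equiv> fst (vert p)"

lemma turn_vert: "turn (shade a) (shade b) (shade c) = of_int (orient a b c) / 1000000"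
  by (cases a; cases b; cases c) (simp add: turn_def diff_divide_distrib[symmetric])

lemma volume_vert: "volume (vert a) (vert b) (vert c) (vert d) = of_int (orient3 a b c d) / 1000000000"
proof -
  obtain ax ay ah bx "by" bh cx cy ch dx dy dh where
    "a = (ax, ay, ah)" "b = (bx, by, bh)" "c = (cx, cy, ch)" "d = (dx, dy, dh)"
    by (cases a; cases b; cases c; cases d)
  then show ?thesis
    by (simp add: volume_def turn_def diff_divide_distrib[symmetric]) (simp add: field_simps)
qed

lemma dot_vert: "(shade b - shade a) \<bullet> (shade c - shade a) = of_int (dot a b c) / 1000000"
  by (cases a; cases b; cases c) (simp add: diff_divide_distrib[symmetric] add_divide_distrib)

lemma same_sign_iff: "same_sign s t \<longleftrightarrow> 0 < s * t"
  by (auto simp: same_sign_def zero_less_mult_iff)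

abbreviation slid :: "point \<Rightarrow> point \<Rightarrow> real \<Rightarrow> vertex" where
  "slid p q t \<equiv> (1 - t) *\<^sub>R vert p + t *\<^sub>R vert q"

lemma convex_pos:
  fixes x y t :: real
  assumes "0 < x" "0 < y" "0 \<le> t" "t \<le> 1" shows "0 < (1 - t) * x + t * y"
proof (cases "t = 0")
  case False
  then show ?thesis using assms by (simp add: add_nonneg_pos)
qed (use assms in simp)

lemma turn_slid:
  "turn (shade c) (shade d) ((1 - t) *\<^sub>R shade p + t *\<^sub>R shade q) = ((1 - t) * of_int (orient c d p) + t *
      of_int (orient c d q)) / 1000000"
  "turn (shade c) ((1 - t) *\<^sub>R shade p + t *\<^sub>R shade q) (shade d) = ((1 - t) * of_int (orient c p d) + t *
      of_int (orient c q d)) / 1000000"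
  by (simp_all add: turn_convex turn_vert add_divide_distrib)

lemma volume_slid:
  "volume (vert a) (slid p q t) (vert c) (vert d)
     = ((1 - t) * of_int (orient3 a p c d) + t * of_int (orient3 a q c d)) / 1000000000"
  by (simp add: volume_convex volume_vert add_divide_distrib)

lemma same_slid:
  assumes "same_sign s t" "same_sign s t'" "0 \<le> r" "r \<le> 1"
  shows "0 < of_int s * ((1 - r) * of_int t + r * of_int t' :: real)"
proof -
  have "0 < (of_int (s * t) :: real)" "0 < (of_int (s * t') :: real)"
    using assms unfolding same_sign_iff of_int_0_less_iff by simp_all
  from convex_pos[OF this assms(3,4)] show ?thesis by (simp add: algebra_simps)
qed

lemma same_slid_nonzero:
  assumes "same_sign s s'" "0 \<le> r" "r \<le> 1"
  shows "(1 - r) * of_int s + r * of_int s' \<noteq> (0 :: real)"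
proof -
  have "same_sign s s" using assms(1) by (auto simp: same_sign_def split: if_splits)
  then show ?thesis using same_slid[OF _ assms] by force
qed

lemma opp_slid:
  assumes "opposite s t" "opposite s t'" "0 \<le> r" "r \<le> 1"
  shows "of_int s * ((1 - r) * of_int t + r * of_int t' :: real) < 0"
  using same_slid[of s "- t" "- t'" r] assms by (simp add: opposite_def algebra_simps)

lemma segment_coordinate:
  assumes "x \<in> closed_segment a (b :: real \<times> real)"
  shows "fst a < k \<Longrightarrow> fst b < k \<Longrightarrow> fst x < k" "snd a < k \<Longrightarrow> snd b < k \<Longrightarrow> snd x < k"
    "k < fst a \<Longrightarrow> k < fst b \<Longrightarrow> k < fst x" "k < snd a \<Longrightarrow> k < snd b \<Longrightarrow> k < snd x"
proof -
  obtain t where t: "0 \<le> t" "t \<le> 1" "x = (1 - t) *\<^sub>R a + t *\<^sub>R b"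
    using assms by (auto simp: closed_segment_def)
  have *: "0 < (1 - t) * (k - z) + t * (k - w)" if "z < k" "w < k" for z w
    using convex_pos[of "k - z" "k - w" t] that t by simp
  have **: "0 < (1 - t) * (z - k) + t * (w - k)" if "k < z" "k < w" for z w
    using convex_pos[of "z - k" "w - k" t] that t by simp
  show "fst a < k \<Longrightarrow> fst b < k \<Longrightarrow> fst x < k" using *[of "fst a" "fst b"] by (simp add: t(3) algebra_simps)
  show "snd a < k \<Longrightarrow> snd b < k \<Longrightarrow> snd x < k" using *[of "snd a" "snd b"] by (simp add: t(3) algebra_simps)
  show "k < fst a \<Longrightarrow> k < fst b \<Longrightarrow> k < fst x" using **[of "fst a" "fst b"] by (simp add: t(3) algebra_simps)
  show "k < snd a \<Longrightarrow> k < snd b \<Longrightarrow> k < snd x" using **[of "snd a" "snd b"] by (simp add: t(3) algebra_simps)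
qed

lemma boxes_apart:
  fixes a b c d :: "real \<times> real"
  assumes "fst a < k \<and> fst b < k \<and> k < fst c \<and> k < fst d \<or>
    snd a < k \<and> snd b < k \<and> k < snd c \<and> k < snd d"
  shows "closed_segment a b \<inter> closed_segment c d = {}"
proof -
  have False if x: "x \<in> closed_segment a b" "x \<in> closed_segment c d" for x
    using segment_coordinate(1,2)[OF x(1), of k] segment_coordinate(3,4)[OF x(2), of k] assms by linarith
  then show ?thesis by blast
qed

section \<open>Soundness of the tests for a moving edge\<close>

lemma slid_bounds:
  fixes p q k :: real
  assumes "0 \<le> t" "t \<le> 1"
  shows "p < k \<Longrightarrow> q < k \<Longrightarrow> (1 - t) * p + t * q < k" "k < p \<Longrightarrow> k < q \<Longrightarrow> k < (1 - t) * p + t * q"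
  using convex_pos[of "k - p" "k - q" t] convex_pos[of "p - k" "q - k" t] assms
  by (auto simp: algebra_simps)

lemma below_gap:
  assumes "below a p q c d"
  obtains k :: real where "of_int a / 1000 < k" "of_int p / 1000 < k" "of_int q / 1000 < k"
    "k < of_int c / 1000" "k < of_int d / 1000"
proof -
  have l: "a < c" "a < d" "p < c" "p < d" "q < c" "q < d"
    using assms by (auto simp: below_def split: if_splits)
  \<comment> \<open>For integers the value half a unit below the smaller of \<open>c\<close> and
    \<open>d\<close> separates strictly.\<close>
  show thesis
    by (rule that[of "(of_int (min c d) - 1/2) / 1000"])
      (use l in \<open>auto simp: min_def divide_strict_right_mono field_simps\<close>)
qed

lemma above_gap:
  assumes "above a p q c d"
  obtains k :: real where "k < of_int a / 1000" "k < of_int p / 1000" "k < of_int q / 1000"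
    "of_int c / 1000 < k" "of_int d / 1000 < k"
proof -
  have l: "c < a" "d < a" "c < p" "d < p" "c < q" "d < q"
    using assms by (auto simp: above_def split: if_splits)
  show thesis
    by (rule that[of "(of_int (max c d) + 1/2) / 1000"])
      (use l in \<open>auto simp: max_def divide_strict_right_mono field_simps\<close>)
qed

lemma boxed_apart:
  assumes "boxed a p q c d" "0 \<le> t" "t \<le> 1"
  shows "closed_segment (shade a) (fst (slid p q t)) \<inter> closed_segment (shade c) (shade d) = {}"
proof -
  obtain ax ay ah px py ph qx qy qh cx cy ch dx dy dh where
    e: "a = (ax, ay, ah)" "p = (px, py, ph)" "q = (qx, qy, qh)" "c = (cx, cy, ch)" "d = (dx, dy, dh)"
    by (cases a; cases p; cases q; cases c; cases d)
  have "below ax px qx cx dx \<or> above ax px qx cx dx \<or> below ay py qy cy dy \<or> above ay py qy cy dy"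
    using assms(1) unfolding e by (simp split: if_splits)
  then show ?thesis
  proof (elim disjE)
    assume "below ax px qx cx dx"
    then obtain k :: real where k: "of_int ax / 1000 < k" "of_int px / 1000 < k" "of_int qx / 1000 < k"
      "k < of_int cx / 1000" "k < of_int dx / 1000" by (rule below_gap)
    show ?thesis by (rule boxes_apart[of _ k]) (use k slid_bounds(1)[OF assms(2,3) k(2,3)] in \<open>simp add: e\<close>)
  next
    assume "below ay py qy cy dy"
    then obtain k :: real where k: "of_int ay / 1000 < k" "of_int py / 1000 < k" "of_int qy / 1000 < k"
      "k < of_int cy / 1000" "k < of_int dy / 1000" by (rule below_gap)
    show ?thesis by (rule boxes_apart[of _ k]) (use k slid_bounds(1)[OF assms(2,3) k(2,3)] in \<open>simp add: e\<close>)
  next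
    assume "above ax px qx cx dx"
    then obtain k :: real where k: "k < of_int ax / 1000" "k < of_int px / 1000" "k < of_int qx / 1000"
      "of_int cx / 1000 < k" "of_int dx / 1000 < k" by (rule above_gap)
    show ?thesis unfolding Int_commute[of "closed_segment (shade a) _"]
      by (rule boxes_apart[of _ k]) (use k slid_bounds(2)[OF assms(2,3) k(2,3)] in \<open>simp add: e\<close>)
  next
    assume "above ay py qy cy dy"
    then obtain k :: real where k: "k < of_int ay / 1000" "k < of_int py / 1000" "k < of_int qy / 1000"
      "of_int cy / 1000 < k" "of_int dy / 1000 < k" by (rule above_gap)
    show ?thesis unfolding Int_commute[of "closed_segment (shade a) _"]
      by (rule boxes_apart[of _ k]) (use k slid_bounds(2)[OF assms(2,3) k(2,3)] in \<open>simp add: e\<close>)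
  qed
qed

text \<open>Disjoint shadows follow from a separating line: one parallel to an axis, the fixed line
  through \<open>c\<close> and \<open>d\<close>, or the moving line through \<open>a\<close>. For a
  crossing, each edge separates the ends of the other at all times, and the volume keeps the two
  heights apart.\<close>

lemma contact_sound:
  assumes "contact a p q c d = k" "k \<noteq> Bad" and t: "0 \<le> t" "t \<le> 1"
  shows "transverse (vert a, slid p q t) (vert c, vert d)"
    and "k = Apart \<Longrightarrow> shadow (vert a, slid p q t) \<inter> shadow (vert c, vert d) = {}"
proof -
  let ?q = "slid p q t"
  have apart: "transverse (vert a, ?q) (vert c, vert d) \<and> shadow (vert a, ?q) \<inter> shadow (vert c, vert d) = {}"
    if "closed_segment (shade a) (fst ?q) \<inter> closed_segment (shade c) (shade d) = {}"
  proof -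
    have "solid (vert a, ?q) \<inter> solid (vert c, vert d) = {}"
      using that fst_in_segment[of _ "vert a" ?q] fst_in_segment[of _ "vert c" "vert d"]
      unfolding solid_def fst_conv snd_conv by blast
    then show ?thesis using that unfolding transverse_def shadow_def by simp
  qed
  consider (box) "boxed a p q c d"
    | (line) "same_sign (orient c d a) (orient c d p)" "same_sign (orient c d a) (orient c d q)"
    | (side) "same_sign (orient a p c) (orient a q c)" "same_sign (orient a p d) (orient a q d)"
        "same_sign (orient a p c) (orient a p d)"
    | (cross) "k = Crossing" "same_sign (orient a p c) (orient a q c)" "same_sign (orient a p d) (orient a q d)"
        "\<not> same_sign (orient a p c) (orient a p d)"
       "opposite (orient c d a) (orient c d p)" "opposite (orient c d a) (orient c d q)"
           "same_sign (orient3 a p c d) (orient3 a q c d)"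
    using assms(1,2) unfolding contact_def contact2_def contact3_def by (auto split: if_splits)
  then have "(transverse (vert a, ?q) (vert c, vert d) \<and> shadow (vert a, ?q) \<inter> shadow (vert c, vert d) = {}) \<or>
    transverse (vert a, ?q) (vert c, vert d) \<and> k = Crossing"
  proof cases
    case box
    then show ?thesis using apart boxed_apart t by blast
  next
    case line
    have "0 < turn (shade c) (shade d) (shade a) * turn (shade c) (shade d) (fst ?q)"
      using same_slid[OF line t] by (simp add: turn_vert turn_slid)
    then show ?thesis using apart segments_apart by blast
  next
    case side
    have "0 < turn (shade a) (fst ?q) (shade c) * turn (shade a) (fst ?q) (shade d)"
    proof -
      have ss: "same_sign (orient a q c) (orient a p d)" "same_sign (orient a q c) (orient a q d)"
          "same_sign (orient a p c) (orient a p d)"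
         "same_sign (orient a p c) (orient a q d)"
        using side by (auto simp: same_sign_def split: if_splits)
      \<comment> \<open>A product of two quantities that vary with \<open>t\<close> is not affine in
        \<open>t\<close>. It is expanded in the first factor alone; the two resulting terms are
        positive for every \<open>t\<close> by the affine case.\<close>
      have "0 < (1 - t) * (of_int (orient a p c) * ((1 - t) * of_int (orient a p d) + t * of_int (orient a q d))) +
         t * (of_int (orient a q c) * ((1 - t) * of_int (orient a p d) + t * of_int (orient a q d) :: real))"
        by (rule convex_pos[OF same_slid[OF ss(3,4) t] same_slid[OF ss(1,2) t] t])
      then have "0 < ((1 - t) * of_int (orient a p c) + t * of_int (orient a q c)) *
          ((1 - t) * of_int (orient a p d) + t * of_int (orient a q d) :: real)"
        by (simp add: algebra_simps)
      then show ?thesis by (simp add: turn_slid)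
    qed
    then show ?thesis using apart segments_apart[of "shade a" "fst ?q" "shade c" "shade d"] by (simp add: Int_commute)
  next
    case cross
    have o: "opposite (orient a p c) (orient a p d)" "opposite (orient a p c) (orient a q d)"
        "opposite (orient a q c) (orient a p d)" "opposite (orient a q c) (orient a q d)"
      using cross(2-4) by (auto simp: same_sign_def opposite_def split: if_splits)
    have "0 < (1 - t) * (- (of_int (orient a p c) * ((1 - t) * of_int (orient a p d) + t * of_int (orient a q d)))) +
       t * (- (of_int (orient a q c) * ((1 - t) * of_int (orient a p d) + t * of_int (orient a q d) :: real)))"
      by (rule convex_pos[OF _ _ t]) (use opp_slid[OF o(1,2) t] opp_slid[OF o(3,4) t] in simp_all)
    then have "((1 - t) * of_int (orient a p c) + t * of_int (orient a q c)) *
        ((1 - t) * of_int (orient a p d) + t * of_int (orient a q d) :: real) < 0"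
      by (simp add: algebra_simps)
    then have 1: "turn (shade a) (fst ?q) (shade c) * turn (shade a) (fst ?q) (shade d) < 0"
      by (simp add: turn_slid divide_less_0_iff)
    have 2: "turn (shade c) (shade d) (shade a) * turn (shade c) (shade d) (fst ?q) < 0"
      using opp_slid[OF cross(5,6) t] by (simp add: turn_vert turn_slid mult_less_0_iff)
    have 3: "volume (vert a) ?q (vert c) (vert d) \<noteq> 0"
      using same_slid_nonzero[OF cross(7) t] by (simp add: volume_slid)
    have "transverse (vert a, ?q) (vert c, vert d)"
      unfolding transverse_def solid_def shadow_def open_shadow_def fst_conv snd_conv
      using segments_cross[OF 2 1] solids_apart[OF 3] by blast
    then show ?thesis using cross(1) by blast
  qed
  then show "transverse (vert a, ?q) (vert c, vert d)"
    "k = Apart \<Longrightarrow> shadow (vert a, ?q) \<inter> shadow (vert c, vert d) = {}" by auto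
qed

lemma corner_sound:
  assumes "corner x a p q" and t: "0 \<le> t" "t \<le> 1"
  shows "shadow (vert x, vert a) \<inter> shadow (vert a, slid p q t) = {shade a}"
proof -
  consider "same_sign (orient x a p) (orient x a q)" | "dot a x p < 0" "dot a x q < 0"
    using assms(1) unfolding corner_def by (auto split: if_splits)
  then have "turn (shade x) (shade a) (fst (slid p q t)) \<noteq> 0 \<or>
    (shade x - shade a) \<bullet> (fst (slid p q t) - shade a) < 0"
  proof cases
    case 1
    then show ?thesis using same_slid_nonzero[OF 1 t] by (simp add: turn_slid)
  next
    case 2
    have "fst (slid p q t) - shade a = (1 - t) *\<^sub>R (shade p - shade a) + t *\<^sub>R (shade q - shade a)"
      by (simp add: algebra_simps)
    then have "(shade x - shade a) \<bullet> (fst (slid p q t) - shade a) =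
       (1 - t) * (of_int (dot a x p) / 1000000) + t * (of_int (dot a x q) / 1000000)"
      by (simp add: inner_add_right dot_vert)
    also have "\<dots> < 0" using slid_bounds(1)[OF t, of "of_int (dot a x p) / 1000000" 0
        "of_int (dot a x q) / 1000000"] 2 by simp
    finally show ?thesis by blast
  qed
  then show ?thesis using segments_meet_at_corner by (simp add: shadow_def)
qed

lemma conc_vert:
  "turn (shade a) (fst (slid p q t)) (shade g) * turn (shade f) (shade f') (shade g')
     - turn (shade a) (fst (slid p q t)) (shade g') * turn (shade f) (shade f') (shade g)
   = ((1 - t) * of_int (concurrence a p (f, f') (g, g')) + t * of_int (concurrence a q (f, f') (g, g'))) /
       1000000000000"
  unfolding fst_add fst_scaleR turn_slid turn_vert concurrence.simps of_int_diff of_int_mult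
  by (simp add: field_simps)

lemma same_conc_sound:
  assumes "same_sign (concurrence a p f g) (concurrence a q f g)" and t: "0 \<le> t" "t \<le> 1"
  shows "shadow (vert a, slid p q t) \<inter> shadow (arc f) \<inter> shadow (arc g) = {}"
  using not_concurrent[of "shade a" "fst (slid p q t)" "shade (fst g)" "shade (fst f)" "shade (snd f)"
      "shade (snd g)"]
    same_slid_nonzero[OF assms(1) t]
    conc_vert[where a = a and p = p and q = q and t = t and g = "fst g" and g' = "snd g" and f = "fst f"
        and f' = "snd f"]
  by (simp add: shadow_def)

lemma apart_cases:
  assumes "apart f g"
  shows "fst f = fst g \<or> fst f = snd g \<or> snd f = fst g \<or> snd f = snd g \<or> shadow (arc f) \<inter> shadow (arc g) = {}"
proof -
  obtain a b c d where e: "f = (a, b)" "g = (c, d)" by (cases f; cases g)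
  have 1: "closed_segment (shade a) (shade b) \<inter> closed_segment (shade c) (shade d) = {}" if
      "same_sign (orient a b c) (orient a b d)"
    using segments_apart[of "shade a" "shade b" "shade c" "shade d"] that
        by (simp add: turn_vert same_sign_iff Int_commute flip: of_int_mult)
  have 2: "closed_segment (shade a) (shade b) \<inter> closed_segment (shade c) (shade d) = {}" if
      "same_sign (orient c d a) (orient c d b)"
    using segments_apart[of "shade c" "shade d" "shade a" "shade b"] that
        by (simp add: turn_vert same_sign_iff flip: of_int_mult)
  show ?thesis
    using assms 1 2 unfolding e by (auto simp: shadow_def split: if_splits)
qed

definition transversal :: "point \<Rightarrow> point \<Rightarrow> point \<Rightarrow> point \<times> point \<Rightarrow> bool" where
  "transversal a p q e \<longleftrightarrow> fst e \<noteq> a \<and> snd e \<noteq> a \<and> contact a p q (fst e) (snd e) = Crossing"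

lemma clear_mem:
  assumes "clear a p q f gs" "g \<in> set gs"
  shows "same_sign (concurrence a p f g) (concurrence a q f g) \<or> apart f g"
  using assms by (induction gs) (auto split: if_splits)

lemma scan_edges:
  assumes "scan a p q cs es" "e \<in> set es"
  shows "if fst e = a then corner (snd e) a p q
     else if snd e = a then corner (fst e) a p q
     else contact a p q (fst e) (snd e) \<noteq> Bad"
  using assms
proof (induction a p q cs es rule: scan.induct)
  case (2 a p q cs c d es)
  show ?case
  proof (cases "e = (c, d)")
    case True
    then show ?thesis using 2(5) by (auto split: if_splits)
  next
    case False
    then have "e \<in> set es" using 2(6) by simp
    then show ?thesis using 2 by (auto split: if_splits contact.splits)
  qed
qed simp

text \<open>Pairs within the initial \<open>cs\<close> have not been tested by this run, hence the
  first alternative, which is void when the scan starts with an empty list. The order of a pair in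
  the list decides in which order it was tested, hence the symmetric alternatives.\<close>

lemma scan_pairs:
  assumes "scan a p q cs es"
    and "f \<in> set cs \<union> {e \<in> set es. transversal a p q e}" "g \<in> set cs \<union> {e \<in> set es. transversal a p q e}" "f \<noteq> g"
  shows "(f \<in> set cs \<and> g \<in> set cs) \<or> same_sign (concurrence a p f g) (concurrence a q f g) \<or> apart f g
    \<or> same_sign (concurrence a p g f) (concurrence a q g f) \<or> apart g f"
  using assms
proof (induction a p q cs es arbitrary: f g rule: scan.induct)
  case (2 a p q cs c d es)
  note ih = 2
  show ?case
  proof (cases "transversal a p q (c, d)")
    case False
    then have X: "set cs \<union> {e \<in> set ((c, d) # es). transversal a p q e} = set cs \<union> {e \<in> set es. transversal a p q e}"
      by auto
    have sc: "scan a p q cs es"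
      using 2(5) False by (auto simp: transversal_def split: if_splits contact.splits)
    consider "c = a" "corner d a p q" | "c \<noteq> a" "d = a" "corner c a p q" | "c \<noteq> a" "d \<noteq> a" "contact a p q c d = Apart"
      using 2(5) False by (auto simp: transversal_def split: if_splits contact.splits)
    then show ?thesis
    proof cases
      case 1 show ?thesis by (rule ih(1)[OF 1 sc ih(6,7)[unfolded X] ih(8)])
    next
      case 2 show ?thesis by (rule ih(2)[OF 2 sc ih(6,7)[unfolded X] ih(8)])
    next
      case 3 show ?thesis by (rule ih(3)[OF 3 sc ih(6,7)[unfolded X] ih(8)])
    qed
  next
    case True
    then have t: "c \<noteq> a" "d \<noteq> a" "contact a p q c d = Crossing" by (auto simp: transversal_def)
    then have s: "clear a p q (c, d) cs" "scan a p q ((c, d) # cs) es" using 2(5) by (auto split: if_splits)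
    have X: "set cs \<union> {e \<in> set ((c, d) # es). transversal a p q e} = set ((c, d) # cs) \<union> {e \<in> set es.
        transversal a p q e}"
      using True by auto
    have "(f \<in> set ((c, d) # cs) \<and> g \<in> set ((c, d) # cs)) \<or> same_sign (concurrence a p f g) (concurrence a q f
        g) \<or> apart f g
       \<or> same_sign (concurrence a p g f) (concurrence a q g f) \<or> apart g f"
      using 2(4)[OF t s(1) s(2), of f g] 2(6-8) unfolding X by blast
    moreover have "same_sign (concurrence a p (c, d) g) (concurrence a q (c, d) g) \<or> apart (c, d) g" if
        "g \<in> set cs" for g
      using clear_mem[OF s(1) that] .
    ultimately show ?thesis using ih(8) by (metis set_ConsD)
  qed
qed simp

text \<open>By injectivity of the projections, \<open>f\<close> and \<open>g\<close> are
  consecutive, so they meet only in the shared vertex. That vertex is an end of \<open>f\<close>,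
  and an edge transverse to \<open>f\<close> meets it only in the interior.\<close>

lemma shared_vertex_off_curve:
  assumes "generic_diagram (diag es)" "f \<in> set es" "g \<in> set es" "f \<noteq> g"
    and "transverse e (arc f)" and v: "fst f = fst g \<or> fst f = snd g \<or> snd f = fst g \<or> snd f = snd g"
  shows "shadow e \<inter> shadow (arc f) \<inter> shadow (arc g) = {}"
proof -
  note G = genericD[OF assms(1)]
  have mem: "arc f \<in> diag es" "arc g \<in> diag es" using assms by (simp_all add: diag_def)
  have ne: "arc f \<noteq> arc g" using assms(4) arc_inj by (simp add: inj_eq)
  have "fst f \<noteq> fst g"
    using inj_onD[OF G(2) _ mem] ne by (metis fst_map_prod)
  moreover have "snd f \<noteq> snd g"
    using inj_onD[OF G(3) _ mem] ne by (metis snd_map_prod)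
  ultimately consider "snd (arc f) = fst (arc g)" | "snd (arc g) = fst (arc f)" using v by auto
  then show ?thesis
  proof cases
    case 1
    then have w: "shadow (arc f) \<inter> shadow (arc g) = {fst (snd (arc f))}" using G(5)[OF mem] by simp
    have "fst (snd (arc f)) \<notin> shadow e"
      using transverse_point(2)[OF assms(5) _ ends_in_shadow(2)] ends_not_in_open_shadow(2)[of "arc f"] by metis
    then show ?thesis unfolding Int_assoc w by simp
  next
    case 2
    then have w: "shadow (arc f) \<inter> shadow (arc g) = {fst (fst (arc f))}"
      using G(5)[OF mem(2,1)] by (simp add: Int_commute)
    have "fst (fst (arc f)) \<notin> shadow e"
      using transverse_point(2)[OF assms(5) _ ends_in_shadow(1)] ends_not_in_open_shadow(1)[of "arc f"] by metis
    then show ?thesis unfolding Int_assoc w by simp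
  qed
qed

text \<open>The hypothesis \<open>unique\<close> reflects the use: \<open>a\<close> has given up its
  edge towards the moving vertex, so at most one edge remains there. It rules out a triple point at
  \<open>a\<close> itself; elsewhere triples are excluded by the concurrence tests.\<close>

lemma scan_hooks:
  assumes G: "generic_diagram (diag es)" and s: "scan a p q [] es" and t: "0 \<le> t" "t \<le> 1"
    and ne: "shade a \<noteq> fst (slid p q t)"
    and unique: "\<And>f g. f \<in> set es \<Longrightarrow> g \<in> set es \<Longrightarrow> fst f = a \<or> snd f = a \<Longrightarrow> fst g = a \<or> snd g = a \<Longrightarrow> f = g"
  shows "hooks (diag es) (vert a) (slid p q t)"
proof -
  let ?e = "(vert a, slid p q t)"
  have edge: "if fst f = a \<or> snd f = a then shadow ?e \<inter> shadow (arc f) = {shade a} else transverse ?e (arc f)"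
    if f: "f \<in> set es" for f
  proof -
    obtain c d where cd: "f = (c, d)" by (cases f)
    have k: "if c = a then corner d a p q else if d = a then corner c a p q else contact a p q c d \<noteq> Bad"
      using scan_edges[OF s f] unfolding cd fst_conv snd_conv .
    consider "c = a" "corner d a p q" | "c \<noteq> a" "d = a" "corner c a p q" | "c \<noteq> a" "d \<noteq> a" "contact a p q c d \<noteq> Bad"
      using k by (cases "c = a"; cases "d = a") auto
    then show ?thesis
    proof cases
      case 1
      then show ?thesis using corner_sound[OF 1(2) t] unfolding cd by (simp add: shadow_swap(1)[of
          "vert d"] Int_commute)
    next
      case 2
      then show ?thesis using corner_sound[OF 2(3) t] unfolding cd by (simp add: Int_commute)
    next
      case 3
      then show ?thesis using contact_sound(1)[OF refl 3(3) t] unfolding cd by simp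
    qed
  qed
  have off: "shade a \<notin> shadow (arc g)" if "g \<in> set es" "\<not> (fst g = a \<or> snd g = a)" for g
  proof
    assume "shade a \<in> shadow (arc g)"
    moreover have "transverse ?e (arc g)" using edge[OF that(1)] that(2) by simp
    moreover have "shade a \<in> shadow ?e" using ends_in_shadow(1)[of ?e] by simp
    ultimately have "shade a \<in> open_shadow ?e" using transverse_point(1) by blast
    then show False using ends_not_in_open_shadow(1)[of ?e] by simp
  qed
  have perm: "shadow ?e \<inter> shadow (arc f) \<inter> shadow (arc g) = shadow ?e \<inter> shadow (arc g) \<inter> shadow (arc f)" for f g
    by (simp only: Int_ac)
  have triple: "shadow ?e \<inter> shadow (arc f) \<inter> shadow (arc g) = {}" if fg: "f \<in> set es" "g \<in> set es" "f \<noteq> g" for f g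
  proof -
    consider (f) "fst f = a \<or> snd f = a" | (g) "fst g = a \<or> snd g = a"
      | (n) "fst f \<noteq> a" "snd f \<noteq> a" "fst g \<noteq> a" "snd g \<noteq> a" by blast
    then show ?thesis
    proof cases
      case f
      then have "shadow ?e \<inter> shadow (arc f) = {shade a}" using edge[OF fg(1)] by simp
      moreover have "\<not> (fst g = a \<or> snd g = a)" using unique[OF fg(1,2) f] fg(3) by blast
      ultimately show ?thesis using off[OF fg(2)] by simp
    next
      case g
      then have "shadow ?e \<inter> shadow (arc g) = {shade a}" using edge[OF fg(2)] by simp
      moreover have "\<not> (fst f = a \<or> snd f = a)" using unique[OF fg(1,2) _ g] fg(3) by blast
      ultimately show ?thesis using off[OF fg(1)] unfolding perm[of f g] by simp
    next
      case n
      then have tr: "transverse ?e (arc f)" "transverse ?e (arc g)" using edge fg by simp_all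
      have ap: "shadow ?e \<inter> shadow (arc h) = {}" if "h \<in> set es" "fst h \<noteq> a" "snd h \<noteq> a" "\<not> transversal a p q h" for h
      proof -
        have b: "contact a p q (fst h) (snd h) \<noteq> Bad" using scan_edges[OF s that(1)] that(2,3) by simp
        have "contact a p q (fst h) (snd h) = Apart"
          using b that unfolding transversal_def by (cases "contact a p q (fst h) (snd h)") simp_all
        then show ?thesis using contact_sound(2)[OF refl b t] by (simp add: map_prod_def case_prod_unfold)
      qed
      show ?thesis
      proof (cases "transversal a p q f \<and> transversal a p q g")
        case False
        then show ?thesis
        proof (cases "transversal a p q f")
          case False
          then show ?thesis using ap[OF fg(1) n(1,2)] by simp
        next
          case True
          then have "\<not> transversal a p q g" using \<open>\<not> (transversal a p q f \<and> transversal a p q g)\<close> by simp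
          then show ?thesis using ap[OF fg(2) n(3,4)] unfolding perm[of f g] by simp
        qed
      next
        case True
        then consider "same_sign (concurrence a p f g) (concurrence a q f g)" |
            "same_sign (concurrence a p g f) (concurrence a q g f)" | "apart f g" | "apart g f"
          using scan_pairs[OF s, of f g] fg by auto
        then show ?thesis
        proof cases
          case 1 show ?thesis by (rule same_conc_sound[OF 1 t])
        next
          case 2 show ?thesis unfolding perm[of f g] by (rule same_conc_sound[OF 2 t])
        next
          case 3
          then have "(fst f = fst g \<or> fst f = snd g \<or> snd f = fst g \<or> snd f = snd g) \<or> shadow (arc f) \<inter> shadow
              (arc g) = {}"
            using apart_cases[OF 3] by simp
          then show ?thesis using shared_vertex_off_curve[OF G fg tr(1)] by (metis Int_assoc Int_empty_right)
        next
          case 4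
          then have "(fst g = fst f \<or> fst g = snd f \<or> snd g = fst f \<or> snd g = snd f) \<or> shadow (arc g) \<inter> shadow
              (arc f) = {}"
            using apart_cases[OF 4] by simp
          then show ?thesis
            using shared_vertex_off_curve[OF G fg(2,1) fg(3)[symmetric] tr(2)] unfolding perm[of f g]
                by (metis Int_assoc Int_empty_right)
        qed
      qed
    qed
  qed
  show ?thesis unfolding hooks_def
  proof (intro conjI ballI impI)
    show "fst (vert a) \<noteq> fst (slid p q t)" by (rule ne)
  next
    fix F assume "F \<in> diag es"
    then obtain f where f: "f \<in> set es" "F = arc f" unfolding diag_def by (rule imageE)
    have "fst F = vert a \<or> snd F = vert a \<longleftrightarrow> fst f = a \<or> snd f = a" unfolding f(2)
        by (simp add: map_prod_def case_prod_unfold)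
    then show "if fst F = vert a \<or> snd F = vert a then shadow ?e \<inter> shadow F = {shade a} else transverse ?e F"
      using edge[OF f(1)] unfolding f(2) by simp
  next
    fix F F' assume F: "F \<in> diag es" "F' \<in> diag es" "F \<noteq> F'"
    obtain f where f: "f \<in> set es" "F = arc f" using F(1) unfolding diag_def by (rule imageE)
    obtain g where g: "g \<in> set es" "F' = arc g" using F(2) unfolding diag_def by (rule imageE)
    have "f \<noteq> g" using F(3) f g by blast
    then show "shadow ?e \<inter> shadow F \<inter> shadow F' = {}" using triple f g by simp
  qed
qed

lemma inner_point_iff: "inner_point p \<longleftrightarrow> shade p \<in> ball 0 1"
proof -
  obtain x y h where p: "p = (x, y, h)" by (cases p)
  have "shade p \<in> ball 0 1 \<longleftrightarrow> (norm (shade p))\<^sup>2 < 1\<^sup>2"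
    using abs_square_less_1[of "norm (shade p)"] by simp
  also have "(norm (shade p))\<^sup>2 = of_int (x * x + y * y) / 1000000"
    unfolding power2_norm_eq_inner by (simp add: p add_divide_distrib)
  also have "\<dots> < 1\<^sup>2 \<longleftrightarrow> (of_int (x * x + y * y) :: real) < of_int 1000000" by simp
  also have "\<dots> \<longleftrightarrow> x * x + y * y < 1000000" by (rule of_int_less_iff)
  finally show ?thesis by (simp add: p)
qed

lemma bend_clean:
  assumes G: "generic_diagram (diag es)" and u: "vert u \<notin> fst ` diag es" and v: "vert v \<notin> snd ` diag es"
    and b: "bend es u v p q" and p: "shade p \<in> ball 0 1" and t: "0 \<le> t" "t \<le> 1"
  shows "clean (diag es) (vert u) (slid p q t) (vert v)"
proof -
  let ?q = "slid p q t"
  have b': "inner_point q" "scan u p q [] es" "scan v p q [] es"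
    "same_sign (orient u p v) (orient u q v) \<or> dot p u v < 0 \<and> dot q u v < 0 \<or> dot p u v < 0 \<and> orient u p v = 0
        \<and> orient u q v \<noteq> 0"
    using b unfolding bend_def by (auto split: if_splits)
  \<comment> \<open>By Thales, \<open>f\<close> is negative exactly inside the circle with diameter
    from \<open>u\<close> to \<open>v\<close>. Its quadratic part is the squared norm, so it is a
    convex function, and negative values at both ends of the motion persist in between.\<close>
  define f where "f x = (shade u - x) \<bullet> (shade v - x)" for x
  have dot: "f (shade x) = of_int (dot x u v) / 1000000" for x
    unfolding f_def by (rule dot_vert)
  have f_convex: "f ((1 - t) *\<^sub>R x + t *\<^sub>R y) \<le> (1 - t) * f x + t * f y" for x y
  proof -
    have "(1 - t) * f x + t * f y - f ((1 - t) *\<^sub>R x + t *\<^sub>R y) = (1 - t) * t * ((x - y) \<bullet> (x - y))"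
      unfolding f_def by (simp add: inner_diff inner_add algebra_simps inner_commute)
    also have "\<dots> \<ge> 0" using t by simp
    finally show ?thesis by simp
  qed
  have turn: "turn (shade u) (fst ?q) (shade v) \<noteq> 0 \<or> f (fst ?q) < 0"
    using b'(4)
  proof (elim disjE conjE)
    assume "same_sign (orient u p v) (orient u q v)"
    then show ?thesis using same_slid_nonzero[OF _ t] by (simp add: turn_slid)
  next
    assume "dot p u v < 0" "dot q u v < 0"
    then have "(1 - t) * f (shade p) + t * f (shade q) < 0"
      using slid_bounds(1)[OF t, of "f (shade p)" 0 "f (shade q)"] by (simp add: dot)
    then show ?thesis using f_convex[of "shade p" "shade q"] by simp
  next
    \<comment> \<open>At time 0 the vertex is straight and the inner product decides; afterwards the
      turn is \<open>t\<close> times its nonzero final value.\<close>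
    assume "dot p u v < 0" "orient u p v = 0" "orient u q v \<noteq> 0"
    then show ?thesis by (cases "t = 0") (simp_all add: turn_slid dot)
  qed
  have uq: "shade u \<noteq> fst ?q" "shade v \<noteq> fst ?q"
  proof -
    have "x \<noteq> y" if "turn x y z \<noteq> 0 \<or> (x - y) \<bullet> (z - y) < 0" for x y z :: "real \<times> real"
      using that by (cases "x = y") simp_all
    then show "shade u \<noteq> fst ?q" using turn unfolding f_def by blast
    have "z \<noteq> y" if "turn x y z \<noteq> 0 \<or> (x - y) \<bullet> (z - y) < 0" for x y z :: "real \<times> real"
      using that by (cases "z = y") simp_all
    then show "shade v \<noteq> fst ?q" using turn unfolding f_def by blast
  qed
  have uniq: "f = g" if fg: "f \<in> set es" "g \<in> set es" and w: "w = u \<or> w = v"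
    "fst f = w \<or> snd f = w" "fst g = w \<or> snd g = w" for f g w
  proof -
    have mem: "arc f \<in> diag es" "arc g \<in> diag es" using fg by (simp_all add: diag_def)
    have nu: "fst h \<noteq> u" "snd h \<noteq> v" if "h \<in> set es" for h
    proof -
      have "arc h \<in> diag es" using that by (simp add: diag_def)
      then have "fst (arc h) \<noteq> vert u" "snd (arc h) \<noteq> vert v" using u v by (metis imageI)+
      then show "fst h \<noteq> u" "snd h \<noteq> v" by auto
    qed
    then have "fst f = fst g \<or> snd f = snd g" using w fg by metis
    then have "arc f = arc g"
      using inj_onD[OF genericD(2)[OF G] _ mem] inj_onD[OF genericD(3)[OF G] _ mem] by auto
    then show ?thesis using arc_inj by (simp add: inj_eq)
  qed
  show ?thesis unfolding clean_def
  proof (intro conjI)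
    show "hooks (diag es) (vert u) ?q"
      by (rule scan_hooks[OF G b'(2) t uq(1)]) (use uniq in blast)
    show "hooks (diag es) (vert v) ?q"
      by (rule scan_hooks[OF G b'(3) t uq(2)]) (use uniq in blast)
    show "shadow (vert u, ?q) \<inter> shadow (?q, vert v) = {fst ?q}"
      unfolding shadow_def fst_conv snd_conv by (rule segments_meet_at_corner[OF turn[unfolded f_def]])
    have "shade q \<in> ball 0 1" using b'(1) inner_point_iff by blast
    then have "(1 - t) *\<^sub>R shade p + t *\<^sub>R shade q \<in> ball 0 1"
      using p t convex_ball[of "0 :: real \<times> real" 1] by (intro convexD) simp_all
    then show "fst ?q \<in> ball 0 1" by simp
  qed
qed

section \<open>Soundness of the edits that concern one vertex\<close>

lemma generic_inj:
  assumes "generic_diagram (diag es)"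
  shows "inj_on fst (set es)" "inj_on snd (set es)"
proof -
  have "e = f" if "e \<in> set es" "f \<in> set es" "fst e = fst f \<or> snd e = snd f" for e f
  proof -
    have m: "arc e \<in> diag es" "arc f \<in> diag es" using that by (simp_all add: diag_def)
    have "fst (arc e) = fst (arc f) \<or> snd (arc e) = snd (arc f)"
      using that(3) unfolding fst_map_prod snd_map_prod by (elim disjE) simp_all
    then have "arc e = arc f"
      using inj_onD[OF genericD(2)[OF assms] _ m] inj_onD[OF genericD(3)[OF assms] _ m] by blast
    then show ?thesis using arc_inj by (simp add: inj_eq)
  qed
  then show "inj_on fst (set es)" "inj_on snd (set es)" by (simp_all add: inj_onI)
qed

lemma before_mem: "before p es = Some u \<Longrightarrow> (u, p) \<in> set es"
  by (induction p es rule: before.induct) (auto split: if_splits)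

lemma after_mem: "after p es = Some v \<Longrightarrow> (p, v) \<in> set es"
  by (induction p es rule: after.induct) (auto split: if_splits)

lemma mem_without: "e \<in> set (without p es) \<longleftrightarrow> e \<in> set es \<and> fst e \<noteq> p \<and> snd e \<noteq> p"
proof (induction es)
  case (Cons f es)
  obtain a b where f: "f = (a, b)" by (cases f)
  have "e \<in> set (without p ((a, b) # es)) \<longleftrightarrow> a \<noteq> p \<and> b \<noteq> p \<and> e = (a, b) \<or> e \<in> set (without p es)"
    by simp
  then show ?case unfolding f Cons.IH by (cases "e = (a, b)") auto
qed simp

lemma set_without: "set (without p es) = {e \<in> set es. fst e \<noteq> p \<and> snd e \<noteq> p}"
  using mem_without by (intro set_eqI) (simp only: mem_Collect_eq)

lemma fst_diag: "vert u \<in> fst ` diag es \<longleftrightarrow> u \<in> fst ` set es"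
  "vert u \<in> snd ` diag es \<longleftrightarrow> u \<in> snd ` set es"
proof -
  have "inj vert" by (rule injI) (simp only: vert_inj)
  moreover have "fst ` diag es = vert ` fst ` set es" "snd ` diag es = vert ` snd ` set es"
    unfolding diag_def image_image fst_map_prod snd_map_prod by (rule refl)+
  ultimately show "vert u \<in> fst ` diag es \<longleftrightarrow> u \<in> fst ` set es" "vert u \<in> snd ` diag es \<longleftrightarrow> u \<in> snd ` set es"
    by (simp_all only: inj_image_mem_iff)
qed

lemma diag_bent: "diag ((u, q) # (q, v) # es) = bent (diag es) (vert u) (vert q) (vert v)"
  by (simp add: diag_def bent_def insert_commute)

text \<open>A vertex has at most one edge in and one edge out, so removing the edges at
  \<open>p\<close> leaves exactly the rest \<open>R\<close> of a bent strand. Having both,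
  \<open>p\<close> is not an end and must lie in the open disk.\<close>

lemma pivot:
  assumes D: "disk_diagram (diag es)" and b: "before p es = Some u" and a: "after p es = Some v"
  shows "diag es = bent (diag (without p es)) (vert u) (vert p) (vert v)"
    and "vert u \<notin> fst ` diag (without p es)" "vert v \<notin> snd ` diag (without p es)"
    and "shade p \<in> ball 0 1" "shade u \<in> cball 0 1" "shade v \<in> cball 0 1"
proof -
  note up = before_mem[OF b] and pv = after_mem[OF a]
  have inj: "inj_on fst (set es)" "inj_on snd (set es)"
    using generic_inj disk_diagramD(1)[OF D] by blast+
  have "e = (u, p) \<or> e = (p, v)" if "e \<in> set es" "fst e = p \<or> snd e = p" for e
    using that(2) inj_onD[OF inj(1) _ that(1) pv] inj_onD[OF inj(2) _ that(1) up] by auto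
  then have "set es = set ((u, p) # (p, v) # without p es)"
    using up pv unfolding list.set set_without by blast
  then have "diag es = diag ((u, p) # (p, v) # without p es)" by (simp only: diag_def)
  then show "diag es = bent (diag (without p es)) (vert u) (vert p) (vert v)"
    unfolding diag_bent .
  have "u \<notin> fst ` set (without p es)"
  proof
    assume "u \<in> fst ` set (without p es)"
    then obtain e where e: "e \<in> set es" "snd e \<noteq> p" "fst e = u" unfolding set_without by blast
    then show False using inj_onD[OF inj(1) _ e(1) up] by auto
  qed
  then show "vert u \<notin> fst ` diag (without p es)" unfolding fst_diag .
  have "v \<notin> snd ` set (without p es)"
  proof
    assume "v \<in> snd ` set (without p es)"
    then obtain e where e: "e \<in> set es" "fst e \<noteq> p" "snd e = v" unfolding set_without by blast
    then show False using inj_onD[OF inj(2) _ e(1) pv] by auto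
  qed
  then show "vert v \<notin> snd ` diag (without p es)" unfolding fst_diag .
  have "p \<in> fst ` set es" "p \<in> snd ` set es" "u \<in> fst ` set es" "v \<in> snd ` set es" using up pv by force+
  then have m: "vert p \<in> fst ` diag es" "vert p \<in> snd ` diag es" "vert u \<in> fst ` diag es" "vert v \<in> snd ` diag es"
    unfolding fst_diag .
  then have V: "vert p \<in> verts D'" "vert u \<in> verts D'" "vert v \<in> verts D'" if "D' = diag es" for D'
    unfolding verts_def that by blast+
  have "vert p \<notin> ends (diag es)" using m(1,2) unfolding ends_def by blast
  then show "shade p \<in> ball 0 1"
    using disk_diagramD(2,3)[OF D V(1)[OF refl]] by (simp add: mem_sphere less_le)
  show "shade u \<in> cball 0 1" "shade v \<in> cball 0 1" using disk_diagramD(2)[OF D] V by blast+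
qed

lemma on_segment_open:
  assumes "on_segment u m v"
  shows "vert m \<in> open_segment (vert u) (vert v)" "shade m \<in> open_segment (shade u) (shade v)"
proof -
  obtain ux uy uh mx my mh vx vy vh where e: "u = (ux, uy, uh)" "m = (mx, my, mh)" "v = (vx, vy, vh)"
    by (cases u; cases m; cases v)
  define dx dy dh ex ey eh where d: "dx = real_of_int (vx - ux)" "dy = real_of_int (vy - uy)"
      "dh = real_of_int (vh - uh)"
     "ex = real_of_int (mx - ux)" "ey = real_of_int (my - uy)" "eh = real_of_int (mh - uh)"
  have "(mx - ux) * (vy - uy) = (my - uy) * (vx - ux)" "(mx - ux) * (vh - uh) = (mh - uh) * (vx - ux)"
    "(my - uy) * (vh - uh) = (mh - uh) * (vy - uy)" "(ux - mx) * (vx - mx) + (uy - my) * (vy - my) < 0"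
    using assms unfolding e by simp_all
  then have "real_of_int ((mx - ux) * (vy - uy)) = real_of_int ((my - uy) * (vx - ux))"
    "real_of_int ((mx - ux) * (vh - uh)) = real_of_int ((mh - uh) * (vx - ux))"
    "real_of_int ((my - uy) * (vh - uh)) = real_of_int ((mh - uh) * (vy - uy))"
    "real_of_int ((ux - mx) * (vx - mx) + (uy - my) * (vy - my)) < 0"
    by (simp_all only: of_int_less_0_iff)
  then have 1: "ex * dy = ey * dx" "ex * dh = eh * dx" "ey * dh = eh * dy"
    and 2: "ex * ex + ey * ey < ex * dx + ey * dy"
    unfolding d by (simp_all add: algebra_simps)
  \<comment> \<open>The parameter of \<open>m\<close> is \<open>l = s / N\<close>, the coefficient
    of the orthogonal projection of \<open>m - u\<close> to \<open>v - u\<close> in the plane;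
    collinearity in space makes the height obey the same \<open>l\<close>. The inequality
    \<open>2\<close> becomes \<open>l * l * N < l * N\<close>, which gives
    \<open>l < 1\<close>.\<close>
  define N where "N = dx * dx + dy * dy"
  define s where "s = ex * dx + ey * dy"
  have s: "0 < s" using 2 zero_le_square[of ex] zero_le_square[of ey] unfolding s_def by linarith
  have "dx \<noteq> 0 \<or> dy \<noteq> 0" using s unfolding s_def by auto
  then have N: "0 < N" unfolding N_def by (metis add_nonneg_pos add_pos_nonneg zero_le_square not_real_square_gt_zero)
  define l where "l = s / N"
  have "ex * N = s * dx" "ey * N = s * dy" "eh * N = s * dh"
    using 1 unfolding N_def s_def by algebra+
  then have l: "ex = l * dx" "ey = l * dy" "eh = l * dh"
    using N unfolding l_def by (simp_all add: field_simps)
  have "0 < l" using s N by (simp add: l_def)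
  have "l * l * N < l * N" using 2 unfolding l N_def by (simp add: algebra_simps)
  then have "l < 1" using N \<open>0 < l\<close> by simp
  have m: "vert m = (1 - l) *\<^sub>R vert u + l *\<^sub>R vert v"
    using l unfolding d e by (simp add: field_simps)
  have uv: "shade u \<noteq> shade v" using \<open>dx \<noteq> 0 \<or> dy \<noteq> 0\<close> unfolding d e by auto
  then have "vert u \<noteq> vert v" by metis
  then show "vert m \<in> open_segment (vert u) (vert v)"
    unfolding in_segment using m \<open>0 < l\<close> \<open>l < 1\<close> by blast
  have "shade m = (1 - l) *\<^sub>R shade u + l *\<^sub>R shade v" using m by simp
  then show "shade m \<in> open_segment (shade u) (shade v)"
    unfolding in_segment using uv \<open>0 < l\<close> \<open>l < 1\<close> by blast
qed

lemma open_segment_in_ball: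
  fixes a b :: "'a::euclidean_space"
  assumes "a \<in> cball 0 1" "b \<in> cball 0 1" "x \<in> open_segment a b"
  shows "x \<in> ball 0 1"
  using dist_decreases_open_segment[OF assms(3), of 0] assms(1,2) by auto

text \<open>The straight vertex \<open>m\<close> is the position at time 0 of the slide to
  \<open>w\<close>. One family of clean positions thus yields both the subdivision and the isotopy
  that follows it.\<close>

lemma bend_steps:
  assumes D: "disk_diagram (insert (vert u, vert v) (diag es))"
    and u: "vert u \<notin> fst ` diag es" and v: "vert v \<notin> snd ` diag es"
    and m: "on_segment u m v" and b: "bend es u v m w"
  shows "(step S)\<^sup>*\<^sup>* (insert (vert u, vert v) (diag es)) (bent (diag es) (vert u) (vert w) (vert v))"
    and "disk_diagram (bent (diag es) (vert u) (vert w) (vert v))"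
proof -
  have G: "generic_diagram (diag es)"
    by (rule generic_subset[OF disk_diagramD(1)[OF D]]) auto
  have V: "vert u \<in> verts (insert (vert u, vert v) (diag es))" "vert v \<in> verts (insert (vert u, vert v) (diag es))"
    by (simp_all add: verts_def)
  have "shade m \<in> ball 0 1"
    by (rule open_segment_in_ball[OF disk_diagramD(2)[OF D V(1)] disk_diagramD(2)[OF D V(2)]
        on_segment_open(2)[OF m]])
  then have c: "clean (diag es) (vert u) (slid m w t) (vert v)" if "0 \<le> t" "t \<le> 1" for t
    using bend_clean[OF G u v b _ that] by blast
  have new: "(vert u, vert v) \<notin> diag es" "(vert u, vert m) \<notin> diag es" "(vert m, vert v) \<notin> diag es"
    using u v by force+
  have s: "subdivision (insert (vert u, vert v) (diag es)) (bent (diag es) (vert u) (vert m) (vert v))"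
    using subdivide_edge[OF D new(1) on_segment_open(1)[OF m]] c[of 0] by simp
  then have "disk_diagram (bent (diag es) (vert u) (vert m) (vert v))" unfolding subdivision_def by blast
  note sl = slide_isotopic[OF this new(2,3) c]
  show "(step S)\<^sup>*\<^sup>* (insert (vert u, vert v) (diag es)) (bent (diag es) (vert u) (vert w) (vert v))"
    using step.subdivide[OF s, of S] step.isotopy[OF sl(1), of S] by simp
  show "disk_diagram (bent (diag es) (vert u) (vert w) (vert v))" by (rule sl(2))
qed

lemma exec_slide:
  assumes "exec (Slide p q) es = Some es'" and D: "disk_diagram (diag es)"
  shows "(step S)\<^sup>*\<^sup>* (diag es) (diag es')" "disk_diagram (diag es')"
proof -
  obtain u v where uv: "before p es = Some u" "after p es = Some v" "bend (without p es) u v p q"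
    "es' = (u, q) # (q, v) # without p es"
    using assms(1) by (auto split: option.splits if_splits)
  note pv = pivot[OF D uv(1,2)]
  have G: "generic_diagram (diag (without p es))"
    by (rule generic_subset[OF disk_diagramD(1)[OF D]]) (auto simp: pv(1) bent_def)
  have new: "(vert u, vert p) \<notin> diag (without p es)" "(vert p, vert v) \<notin> diag (without p es)"
    using pv(2,3) by force+
  note sl = slide_isotopic[OF D[unfolded pv(1)] new bend_clean[OF G pv(2,3) uv(3) pv(4)]]
  show "(step S)\<^sup>*\<^sup>* (diag es) (diag es')" "disk_diagram (diag es')"
    unfolding uv(4) diag_bent using sl(2) step.isotopy[OF sl(1), of S] by (simp_all flip: pv(1))
qed

lemma insert_at_steps:
  assumes "insert_at u v m w es = Some es'" and uv: "(u, v) \<in> set es" and D: "disk_diagram (diag es)"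
  shows "(step S)\<^sup>*\<^sup>* (diag es) (diag es')" "disk_diagram (diag es')"
proof -
  have m: "(u, v) \<in> set es" "on_segment u m v" "bend (removeAll (u, v) es) u v m w"
    "es' = (u, w) # (w, v) # removeAll (u, v) es"
    using assms(1) uv unfolding insert_at_def by (simp_all split: if_split_asm)
  have d: "diag es = insert (vert u, vert v) (diag (removeAll (u, v) es))"
  proof -
    have "set es = insert (u, v) (set (removeAll (u, v) es))" using m(1) by (simp only: set_removeAll insert_Diff)
    then show ?thesis by (simp only: diag_def image_insert map_prod_simp)
  qed
  have inj: "inj_on fst (set es)" "inj_on snd (set es)" using generic_inj disk_diagramD(1)[OF D] by blast+
  have "u \<notin> fst ` set (removeAll (u, v) es)" "v \<notin> snd ` set (removeAll (u, v) es)"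
  proof -
    have "e = (u, v)" if "e \<in> set es" "fst e = u \<or> snd e = v" for e
      using that(2) inj_onD[OF inj(1) _ that(1) m(1)] inj_onD[OF inj(2) _ that(1) m(1)] by (elim disjE) simp_all
    then show "u \<notin> fst ` set (removeAll (u, v) es)" "v \<notin> snd ` set (removeAll (u, v) es)"
      unfolding set_removeAll by blast+
  qed
  then have uv: "vert u \<notin> fst ` diag (removeAll (u, v) es)" "vert v \<notin> snd ` diag (removeAll (u, v) es)"
    unfolding fst_diag .
  show "(step S)\<^sup>*\<^sup>* (diag es) (diag es')" "disk_diagram (diag es')"
    unfolding m(4) diag_bent unfolding d using bend_steps[OF D[unfolded d] uv m(2,3)] by blast+
qed

lemma exec_insert:
  assumes "exec (Insert u v m w) es = Some es'" and D: "disk_diagram (diag es)"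
  shows "(step S)\<^sup>*\<^sup>* (diag es) (diag es')" "disk_diagram (diag es')"
proof -
  consider "(u, v) \<in> set es" "insert_at u v m w es = Some es'" | "(v, u) \<in> set es" "insert_at v u m w es = Some es'"
    using assms(1) unfolding exec.simps List.member_iff by (simp split: if_split_asm)
  then show "(step S)\<^sup>*\<^sup>* (diag es) (diag es')" "disk_diagram (diag es')"
    using insert_at_steps D by (cases; blast)+
qed

text \<open>The steps are those of \<open>bend_steps\<close> read backwards. These start from the
  merged diagram, whose genericity is not given in advance; it comes from
  \<open>generic_merge\<close>, applied to the clean position \<open>m\<close>.\<close>

lemma exec_delete:
  assumes "exec (Delete p m) es = Some es'" and D: "disk_diagram (diag es)"
  shows "(step S)\<^sup>*\<^sup>* (diag es) (diag es')" "disk_diagram (diag es')"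
proof -
  obtain u v where uv: "before p es = Some u" "after p es = Some v" "on_segment u m v" "bend (without p es) u v m p"
    "es' = (u, v) # without p es"
    using assms(1) unfolding exec.simps by (auto split: option.split_asm if_split_asm)
  let ?R = "diag (without p es)"
  note pv = pivot[OF D uv(1,2)]
  have d': "diag es' = insert (vert u, vert v) ?R" by (simp add: uv(5) diag_def)
  have G: "generic_diagram ?R"
    by (rule generic_subset[OF disk_diagramD(1)[OF D]]) (auto simp: pv(1) bent_def)
  have m: "vert m \<in> open_segment (vert u) (vert v)" by (rule on_segment_open(1)[OF uv(3)])
  have "shade m \<in> ball 0 1"
    by (rule open_segment_in_ball[OF pv(5,6) on_segment_open(2)[OF uv(3)]])
  then have c: "clean ?R (vert u) (slid m p t) (vert v)" if "0 \<le> t" "t \<le> 1" for t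
    using bend_clean[OF G pv(2,3) uv(4) _ that] by blast
  have c0: "clean ?R (vert u) (vert m) (vert v)" and c1: "clean ?R (vert u) (vert p) (vert v)"
    using c[of 0] c[of 1] by simp_all
  have "generic_diagram (insert (vert u, vert v) ?R)"
    by (rule generic_merge[OF G pv(2,3) _ c0]) (use m open_segment_def in blast)
  moreover have "framed (insert (vert u, vert v) ?R)"
    using D[unfolded pv(1) disk_diagram_iff] framed_bent[OF cleanD(9,10,7,8,4)[OF c1]] by blast
  ultimately have D': "disk_diagram (insert (vert u, vert v) ?R)" unfolding disk_diagram_iff by blast
  then show "disk_diagram (diag es')" unfolding d' .
  show "(step S)\<^sup>*\<^sup>* (diag es) (diag es')"
    using steps_sym[OF bend_steps(1)[OF D' pv(2,3) uv(3,4)]] unfolding d' by (simp flip: pv(1))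
qed

section \<open>Exchanging the inside of a disk\<close>

text \<open>\<open>B\<close> will be an open disk: strands run in \<open>B\<close> and have their
  ends off it. Since the boundary circle does not belong to \<open>B\<close>, the rest of the
  diagram, which only has to avoid \<open>B\<close>, can join the strands there.\<close>

definition inside :: "(real \<times> real) set \<Rightarrow> edge set \<Rightarrow> bool" where
  "inside B E \<longleftrightarrow> generic_diagram E \<and> (\<forall>e\<in>E. open_shadow e \<subseteq> B) \<and>
     (\<forall>v\<in>verts E. v \<in> ends E \<longleftrightarrow> fst v \<notin> B)"

definition avoiding :: "(real \<times> real) set \<Rightarrow> edge set \<Rightarrow> bool" where
  "avoiding B Out \<longleftrightarrow> (\<forall>e\<in>Out. shadow e \<inter> B = {})"

lemma avoidingD: "avoiding B Out \<Longrightarrow> e \<in> Out \<Longrightarrow> x \<in> shadow e \<Longrightarrow> x \<notin> B"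
  unfolding avoiding_def by blast

lemma insideD:
  assumes "inside B E"
  shows "generic_diagram E" "\<And>e. e \<in> E \<Longrightarrow> open_shadow e \<subseteq> B"
    "\<And>v. v \<in> verts E \<Longrightarrow> v \<in> ends E \<longleftrightarrow> fst v \<notin> B"
  using assms unfolding inside_def by blast+

lemma verts_mem: "e \<in> D \<Longrightarrow> fst e \<in> verts D" "e \<in> D \<Longrightarrow> snd e \<in> verts D"
  unfolding verts_def by blast+

lemma inside_boundary:
  assumes "inside B E" "fst v \<notin> B"
  shows "v \<in> fst ` E \<longleftrightarrow> v \<in> starts E" "v \<in> snd ` E \<longleftrightarrow> v \<in> finishes E"
proof -
  have "v \<in> ends E" if "v \<in> fst ` E \<or> v \<in> snd ` E"
    using insideD(3)[OF assms(1)] assms(2) that unfolding verts_def by blast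
  then show "v \<in> fst ` E \<longleftrightarrow> v \<in> starts E" "v \<in> snd ` E \<longleftrightarrow> v \<in> finishes E"
    unfolding ends_def starts_def finishes_def by blast+
qed

lemma inside_interior:
  assumes "inside B E" "fst v \<in> B"
  shows "v \<in> fst ` E \<longleftrightarrow> v \<in> snd ` E"
proof -
  have "v \<notin> ends E" if "v \<in> fst ` E \<or> v \<in> snd ` E"
    using insideD(3)[OF assms(1)] assms(2) that unfolding verts_def by blast
  then show ?thesis unfolding ends_def by blast
qed

lemma outer_vertex:
  assumes "avoiding B Out" "v \<in> fst ` Out \<or> v \<in> snd ` Out"
  shows "fst v \<notin> B"
proof -
  obtain e where "e \<in> Out" "v = fst e \<or> v = snd e" using assms(2) by blast
  then show ?thesis using avoidingD[OF assms(1)] ends_in_shadow(1,2)[of e] by metis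
qed

text \<open>A vertex in \<open>B\<close> lies on no outside edge and has both its edges inside, so
  it is never an end. Off \<open>B\<close>, the vertices of an inside part are exactly its starts
  and finishes, and these agree for \<open>E\<close> and \<open>E'\<close>.\<close>

lemma boundary_replace:
  assumes E: "inside B E" and E': "inside B E'" and b: "starts E' = starts E" "finishes E' = finishes E"
    and O: "avoiding B Out"
  shows "starts (Out \<union> E') = starts (Out \<union> E)" "finishes (Out \<union> E') = finishes (Out \<union> E)"
    and "\<And>v. v \<in> verts (Out \<union> E') \<Longrightarrow> fst v \<notin> B \<Longrightarrow> v \<in> verts (Out \<union> E)"
    and "\<And>v. v \<in> ends (Out \<union> E') \<Longrightarrow> fst v \<notin> B"
proof -
  have out: "v \<in> fst ` E' \<longleftrightarrow> v \<in> fst ` E" "v \<in> snd ` E' \<longleftrightarrow> v \<in> snd ` E" if "fst v \<notin> B" for v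
    using inside_boundary[OF E that] inside_boundary[OF E' that] b by simp_all
  have inn: "v \<notin> starts (Out \<union> E)" "v \<notin> finishes (Out \<union> E)" "v \<notin> starts (Out \<union> E')" "v \<notin> finishes (Out \<union> E')"
    if "fst v \<in> B" for v
    using inside_interior[OF E that] inside_interior[OF E' that] outer_vertex[OF O, of v] that
    unfolding starts_def finishes_def by blast+
  have "v \<in> starts (Out \<union> E') \<longleftrightarrow> v \<in> starts (Out \<union> E)" "v \<in> finishes (Out \<union> E') \<longleftrightarrow> v \<in> finishes (Out \<union> E)" for v
  proof -
    show "v \<in> starts (Out \<union> E') \<longleftrightarrow> v \<in> starts (Out \<union> E)"
      using out[of v] inn[of v] unfolding starts_def by (cases "fst v \<in> B") blast+
    show "v \<in> finishes (Out \<union> E') \<longleftrightarrow> v \<in> finishes (Out \<union> E)"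
      using out[of v] inn[of v] unfolding finishes_def by (cases "fst v \<in> B") blast+
  qed
  then show "starts (Out \<union> E') = starts (Out \<union> E)" "finishes (Out \<union> E') = finishes (Out \<union> E)" by blast+
  show "v \<in> verts (Out \<union> E)" if "v \<in> verts (Out \<union> E')" "fst v \<notin> B" for v
    using that(1) out[OF that(2)] unfolding verts_def by blast
  show "fst v \<notin> B" if "v \<in> ends (Out \<union> E')" for v
    using that inn[of v] unfolding ends_eq by blast
qed

lemma open_shadow_nonempty:
  assumes "fst (fst e) \<noteq> fst (snd e)" shows "open_shadow e \<noteq> {}"
  using assms by (simp add: open_shadow_def)

lemma shadow_cases: "x \<in> shadow e \<Longrightarrow> x \<in> open_shadow e \<or> x = fst (fst e) \<or> x = fst (snd e)"
  unfolding shadow_def open_shadow_def open_segment_def by blast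

text \<open>
  Outside edges meet the inside only in its ends.  There the old and the new inside have edges with the same
  vertex and direction, so that an outside edge is adjacent to the one iff it is adjacent to the other.
\<close>

lemma generic_replace:
  assumes G: "generic_diagram (Out \<union> E)" and E: "inside B E" and E': "inside B E'"
    and b: "starts E' = starts E" "finishes E' = finishes E" and O: "avoiding B Out"
  shows "generic_diagram (Out \<union> E')"
proof -
  note G' = insideD(1)[OF E']
  have GO: "generic_diagram Out" by (rule generic_subset[OF G]) blast
  have disj: "e \<notin> Out" if e: "e \<in> F" "inside B F" for e F
  proof
    assume "e \<in> Out"
    obtain x where "x \<in> open_shadow e"
      using open_shadow_nonempty[OF genericD(4)[OF insideD(1)[OF e(2)] e(1)]] by blast
    moreover have "open_shadow e \<subseteq> shadow e" unfolding open_shadow_def shadow_def open_segment_def by blast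
    ultimately show False using insideD(2)[OF e(2,1)] avoidingD[OF O \<open>e \<in> Out\<close>] by blast
  qed
  have out: "v \<in> fst ` E' \<longleftrightarrow> v \<in> fst ` E" "v \<in> snd ` E' \<longleftrightarrow> v \<in> snd ` E" if "fst v \<notin> B" for v
    using inside_boundary[OF E that] inside_boundary[OF E' that] b by simp_all
  \<comment> \<open>At the vertex of \<open>f\<close> in question, the old inside has an edge
    \<open>g\<close> with the same direction there. Genericity is known for \<open>e\<close> and
    \<open>g\<close>: as an end of \<open>g\<close> is not interior to \<open>g\<close>, they cannot
    be transverse at \<open>x\<close>, so they are consecutive, and then so are \<open>e\<close> and
    \<open>f\<close>.\<close>
  have touch: "(x = fst (fst f) \<and> snd e = fst f) \<or> (x = fst (snd f) \<and> fst e = snd f)"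
    if e: "e \<in> Out" and f: "f \<in> E'" and x: "x \<in> shadow e" "x \<in> shadow f" for e f x
  proof -
    have xB: "x \<notin> B" by (rule avoidingD[OF O e x(1)])
    then have "x = fst (fst f) \<or> x = fst (snd f)"
      using shadow_cases[OF x(2)] insideD(2)[OF E' f] by blast
    then show ?thesis
    proof
      assume xf: "x = fst (fst f)"
      then have "fst f \<in> fst ` E" using out(1)[of "fst f"] xB f by blast
      then obtain g where g: "g \<in> E" "fst g = fst f" by (metis imageE)
      have xg: "x \<in> shadow g" "x \<notin> open_shadow g"
        using ends_in_shadow(1)[of g] ends_not_in_open_shadow(1)[of g] xf g(2) by simp_all
      have eg: "e \<in> Out \<union> E" "g \<in> Out \<union> E" "e \<noteq> g" using e g(1) disj[OF g(1) E] by blast+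
      have "snd e = fst g"
      proof (rule ccontr)
        assume n: "snd e \<noteq> fst g"
        show False
        proof (cases "snd g = fst e")
          case True
          then have "shadow g \<inter> shadow e = {fst (snd g)}" using genericD(5)[OF G eg(2,1)] by simp
          then have "x = fst (snd g)" using x(1) xg(1) by blast
          then show False using genericD(4)[OF G eg(2)] xf g(2) by simp
        next
          case False
          then show False using transverse_point(2)[OF genericD(6)[OF G eg n False] x(1) xg(1)] xg(2) by simp
        qed
      qed
      then show ?thesis using xf g(2) by simp
    next
      assume xf: "x = fst (snd f)"
      then have "snd f \<in> snd ` E" using out(2)[of "snd f"] xB f by blast
      then obtain g where g: "g \<in> E" "snd g = snd f" by (metis imageE)
      have xg: "x \<in> shadow g" "x \<notin> open_shadow g"
        using ends_in_shadow(2)[of g] ends_not_in_open_shadow(2)[of g] xf g(2) by simp_all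
      have eg: "e \<in> Out \<union> E" "g \<in> Out \<union> E" "e \<noteq> g" using e g(1) disj[OF g(1) E] by blast+
      have "snd g = fst e"
      proof (rule ccontr)
        assume n: "snd g \<noteq> fst e"
        show False
        proof (cases "snd e = fst g")
          case True
          then have "shadow e \<inter> shadow g = {fst (fst g)}" using genericD(5)[OF G eg(1,2)] by simp
          then have "x = fst (fst g)" using x(1) xg(1) by blast
          then show False using genericD(4)[OF G eg(2)] xf g(2) by simp
        next
          case False
          then show False using transverse_point(2)[OF genericD(6)[OF G eg False n] x(1) xg(1)] xg(2) by simp
        qed
      qed
      then show ?thesis using xf g(2) by simp
    qed
  qed
  \<comment> \<open>By convexity, an outside edge through both ends of an inside edge would contain
    its interior, which is nonempty and lies in \<open>B\<close>.\<close>
  have one: "\<not> (fst (fst f) \<in> shadow e \<and> fst (snd f) \<in> shadow e)" if "e \<in> Out" "f \<in> E'" for e f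
  proof
    assume "fst (fst f) \<in> shadow e \<and> fst (snd f) \<in> shadow e"
    then have "shadow f \<subseteq> shadow e" unfolding shadow_def subset_closed_segment .
    moreover have "open_shadow f \<subseteq> shadow f" unfolding open_shadow_def shadow_def open_segment_def by blast
    ultimately have "open_shadow f \<subseteq> shadow e" by blast
    then show False
      using insideD(2)[OF E' that(2)] avoidingD[OF O that(1)] open_shadow_nonempty[OF genericD(4)[OF G'
          that(2)]] by blast
  qed
  have inj_fst: "False" if "e \<in> Out" "f \<in> E'" "fst e = fst f" for e f
  proof -
    have "fst e \<in> fst ` E" using out(1)[of "fst f"] outer_vertex[OF O, of "fst e"] that by (metis imageI)
    then obtain g where g: "g \<in> E" "fst e = fst g" by blast
    then have "e = g" using inj_onD[OF genericD(2)[OF G] g(2)] that(1) by blast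
    then show False using disj[OF g(1) E] that(1) by simp
  qed
  have inj_snd: "False" if "e \<in> Out" "f \<in> E'" "snd e = snd f" for e f
  proof -
    have "snd e \<in> snd ` E" using out(2)[of "snd f"] outer_vertex[OF O, of "snd e"] that by (metis imageI)
    then obtain g where g: "g \<in> E" "snd e = snd g" by blast
    then have "e = g" using inj_onD[OF genericD(3)[OF G] g(2)] that(1) by blast
    then show False using disj[OF g(1) E] that(1) by simp
  qed
  have apart: "shadow e \<inter> shadow f = {}"
    if "e \<in> Out" "f \<in> E'" "snd e \<noteq> fst f" "snd f \<noteq> fst e" for e f
    using touch[OF that(1,2)] that(3,4) by (metis disjoint_iff)
  have tr: "transverse e f" if "e \<in> Out" "f \<in> E'" "snd e \<noteq> fst f" "snd f \<noteq> fst e" for e f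
  proof -
    have "solid e \<inter> solid f = {}"
      using apart[OF that] fst_in_segment unfolding solid_def shadow_def by (metis disjoint_iff)
    then show ?thesis using apart[OF that] unfolding transverse_def by simp
  qed
  \<comment> \<open>Two outside edges through the same end of \<open>g\<close> would both precede or
    both follow \<open>g\<close>, against injectivity of the projections.\<close>
  have no2: False if "e \<in> Out" "f \<in> Out" "g \<in> E'" "e \<noteq> f" "x \<in> shadow e" "x \<in> shadow f" "x \<in> shadow g" for e f g x
  proof -
    have gg: "fst (fst g) \<noteq> fst (snd g)" using genericD(4)[OF G' that(3)] .
    have "snd e = snd f \<or> fst e = fst f"
      using touch[OF that(1,3,5,7)] touch[OF that(2,3,6,7)] gg by metis
    then show False using inj_onD[OF genericD(2)[OF GO] _ that(1,2)] inj_onD[OF genericD(3)[OF GO] _ that(1,2)]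
        that(4) by blast
  qed
  have no1: False if "e \<in> Out" "f \<in> E'" "g \<in> E'" "f \<noteq> g" "x \<in> shadow e" "x \<in> shadow f" "x \<in> shadow g" for e f g x
  proof -
    have ee: "fst (fst e) \<noteq> fst (snd e)" using genericD(4)[OF GO that(1)] .
    have "snd f = snd g \<or> fst f = fst g"
      using touch[OF that(1,2,5,6)] touch[OF that(1,3,5,7)] ee by metis
    then show False using inj_onD[OF genericD(2)[OF G'] _ that(2,3)] inj_onD[OF genericD(3)[OF G'] _ that(2,3)]
        that(4) by blast
  qed
  show ?thesis
  proof (rule genericI)
    show "finite (Out \<union> E')" using genericD(1)[OF GO] genericD(1)[OF G'] by simp
    show "inj_on fst (Out \<union> E')"
    proof (rule inj_onI)
      fix e f assume a: "e \<in> Out \<union> E'" "f \<in> Out \<union> E'" "fst e = fst f"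
      then show "e = f"
        using inj_onD[OF genericD(2)[OF GO] a(3)] inj_onD[OF genericD(2)[OF G'] a(3)]
          inj_fst[of e f] inj_fst[of f e] by (metis UnE)
    qed
    show "inj_on snd (Out \<union> E')"
    proof (rule inj_onI)
      fix e f assume a: "e \<in> Out \<union> E'" "f \<in> Out \<union> E'" "snd e = snd f"
      then show "e = f"
        using inj_onD[OF genericD(3)[OF GO] a(3)] inj_onD[OF genericD(3)[OF G'] a(3)]
          inj_snd[of e f] inj_snd[of f e] by (metis UnE)
    qed
    show "fst (fst e) \<noteq> fst (snd e)" if "e \<in> Out \<union> E'" for e
      using that genericD(4)[OF GO] genericD(4)[OF G'] by blast
    show "shadow e \<inter> shadow f = {fst (snd e)}"
      if ef: "e \<in> Out \<union> E'" "f \<in> Out \<union> E'" "snd e = fst f" for e f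
    proof -
      have m: "fst (snd e) \<in> shadow e" "fst (snd e) \<in> shadow f"
        using ends_in_shadow(2)[of e] ends_in_shadow(1)[of f] ef(3) by simp_all
      consider "e \<in> Out" "f \<in> Out" | "e \<in> Out" "f \<in> E'" | "e \<in> E'" "f \<in> Out" | "e \<in> E'" "f \<in> E'"
        using ef(1,2) by blast
      then show ?thesis
      proof cases
        case 1 then show ?thesis using genericD(5)[OF GO _ _ ef(3)] by blast
      next
        case 2
        have "x = fst (snd e)" if "x \<in> shadow e" "x \<in> shadow f" for x
          using touch[OF 2 that] one[OF 2] m that ef(3) by metis
        then show ?thesis using m by blast
      next
        case 3
        have "x = fst (snd e)" if "x \<in> shadow e" "x \<in> shadow f" for x
          using touch[OF 3(2,1) that(2,1)] one[OF 3(2,1)] m that ef(3) by metis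
        then show ?thesis using m by blast
      next
        case 4 then show ?thesis using genericD(5)[OF G' _ _ ef(3)] by blast
      qed
    qed
    show "transverse e f"
      if ef: "e \<in> Out \<union> E'" "f \<in> Out \<union> E'" "e \<noteq> f" "snd e \<noteq> fst f" "snd f \<noteq> fst e" for e f
    proof -
      consider "e \<in> Out" "f \<in> Out" | "e \<in> Out" "f \<in> E'" | "e \<in> E'" "f \<in> Out" | "e \<in> E'" "f \<in> E'"
        using ef(1,2) by blast
      then show ?thesis
      proof cases
        case 1 then show ?thesis using genericD(6)[OF GO] ef by simp
      next
        case 2 then show ?thesis using tr ef by simp
      next
        case 3 then show ?thesis using tr[OF 3(2,1) ef(5,4)] transverse_sym by simp
      next
        case 4 then show ?thesis using genericD(6)[OF G'] ef by simp
      qed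
    qed
    show "shadow e \<inter> shadow f \<inter> shadow g = {}"
      if efg: "e \<in> Out \<union> E'" "f \<in> Out \<union> E'" "g \<in> Out \<union> E'" "e \<noteq> f" "f \<noteq> g" "e \<noteq> g" for e f g
    proof -
      have False if x: "x \<in> shadow e" "x \<in> shadow f" "x \<in> shadow g" for x
      proof -
        consider "e \<in> Out" "f \<in> Out" "g \<in> Out" | "e \<in> Out" "f \<in> Out" "g \<in> E'" | "e \<in> Out" "f \<in> E'" "g \<in> Out"
          | "e \<in> Out" "f \<in> E'" "g \<in> E'" | "e \<in> E'" "f \<in> Out" "g \<in> Out" | "e \<in> E'" "f \<in> Out" "g \<in> E'"
          | "e \<in> E'" "f \<in> E'" "g \<in> Out" | "e \<in> E'" "f \<in> E'" "g \<in> E'"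
          using efg(1-3) by blast
        then show False
        proof cases
          case 1 then show ?thesis using genericD(7)[OF GO 1 efg(4-6)] x by blast
        next
          case 2 then show ?thesis using no2[OF 2 efg(4) x] by simp
        next
          case 3 then show ?thesis using no2[OF 3(1,3,2) efg(6) x(1,3,2)] by simp
        next
          case 4 then show ?thesis using no1[OF 4 efg(5) x] by simp
        next
          case 5 then show ?thesis using no2[OF 5(2,3,1) efg(5) x(2,3,1)] by simp
        next
          case 6 then show ?thesis using no1[OF 6(2,1,3) efg(6) x(2,1,3)] by simp
        next
          case 7 then show ?thesis using no1[OF 7(3,1,2) efg(4) x(3,1,2)] by simp
        next
          case 8 then show ?thesis using genericD(7)[OF G' 8 efg(4-6)] x by blast
        qed
      qed
      then show ?thesis by blast
    qed
  qed
qed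

section \<open>The moves as integer pictures\<close>

definition chain :: "point list \<Rightarrow> (point \<times> point) list" where
  "chain ps = zip ps (tl ps)"

definition oriented :: "bool \<Rightarrow> point list \<Rightarrow> (point \<times> point) list" where
  "oriented d ps = chain (if d then ps else rev ps)"

definition kink_pic :: "int \<Rightarrow> int \<Rightarrow> (point \<times> point) list \<times> (point \<times> point) list" where
  "kink_pic w s =
     (chain [(-1000, 0, 0), (1000, 0, 0)],
      chain [(-1000, 0, 0), (500, 500 * s, - 1000 * w * s), (-500, 500 * s, 1000 * w * s), (1000, 0, 0)])"

definition strands2 :: "int \<Rightarrow> int \<Rightarrow> int \<Rightarrow> int \<Rightarrow> (point \<times> point) list" where
  "strands2 d e h k = chain [(- d * 800, -600, h), (0, k, h), (d * 800, -600, h)] @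
     chain [(- e * 800, 600, - h), (0, - k, - h), (e * 800, 600, - h)]"

definition bigon_pic :: "int \<Rightarrow> int \<Rightarrow> int \<Rightarrow> (point \<times> point) list \<times> (point \<times> point) list" where
  "bigon_pic d e h = (strands2 d e h (-500), strands2 d e h 500)"

text \<open>Described by heights and directions instead of crossing signs: the third strand is the
  bent one, and its height decides whether it is the top, the middle or the bottom strand. The
  pictures needed besides the given sides of the moves are thus covered as well.\<close>

definition strands3 :: "int \<Rightarrow> bool \<Rightarrow> int \<Rightarrow> bool \<Rightarrow> int \<Rightarrow> int \<Rightarrow> (point \<times> point) list" where
  "strands3 h1 d1 h2 d2 h3 k = oriented d1 [(-600, -800, h1), (600, 800, h1)] @
     oriented d2 [(600, -800, h2), (-600, 800, h2)] @ chain [(-1000, 0, h3), (0, k, h3), (1000, 0, h3)]"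

definition triangle_pic :: "int \<Rightarrow> bool \<Rightarrow> int \<Rightarrow> bool \<Rightarrow> int \<Rightarrow> (point \<times> point) list \<times> (point \<times> point) list" where
  "triangle_pic h1 d1 h2 d2 h3 = (strands3 h1 d1 h2 d2 h3 (-500), strands3 h1 d1 h2 d2 h3 500)"

fun pic :: "move \<Rightarrow> (point \<times> point) list \<times> (point \<times> point) list" where
  "pic \<Omega>1a = kink_pic 1 (-1)"
| "pic \<Omega>1b = kink_pic 1 1"
| "pic \<Omega>1c = kink_pic (-1) (-1)"
| "pic \<Omega>1d = kink_pic (-1) 1"
| "pic \<Omega>2a = bigon_pic 1 1 (-1000)"
| "pic \<Omega>2b = bigon_pic 1 1 1000"
| "pic \<Omega>2c = bigon_pic (-1) 1 1000"
| "pic \<Omega>2d = bigon_pic 1 (-1) 1000"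
| "pic \<Omega>3a = triangle_pic (-1000) False 0 True 1000"
| "pic \<Omega>3b = triangle_pic 0 True (-1000) True 1000"
| "pic \<Omega>3c = triangle_pic 0 False (-1000) False 1000"
| "pic \<Omega>3d = triangle_pic (-1000) True 0 True 1000"
| "pic \<Omega>3e = triangle_pic (-1000) True 0 False 1000"
| "pic \<Omega>3f = triangle_pic 0 True (-1000) False 1000"
| "pic \<Omega>3g = triangle_pic (-1000) False 0 False 1000"
| "pic \<Omega>3h = triangle_pic 0 False (-1000) True 1000"

section \<open>The integer pictures are the sides of the moves, and disk diagrams\<close>

lemma diag_chain: "diag (chain ps) = polyline (map vert ps)"
  unfolding diag_def chain_def polyline_def map_tl[symmetric] zip_map_map set_map
  by (intro image_cong refl) (simp add: map_prod_def)

lemma diag_append: "diag (es @ fs) = diag es \<union> diag fs"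
  by (simp add: diag_def image_Un)

lemma sides_pic: "fst (sides r) = diag (fst (pic r))" "snd (sides r) = diag (snd (pic r))"
  by (cases r; simp add: kink_pic_def bigon_pic_def triangle_pic_def strands2_def strands3_def oriented_def
      diag_append diag_chain straight_strand_def kink_def parallel_strands_def antiparallel_strands_def
      two_strands_def three_strands_def Let_def; blast?)+

text \<open>Edges are added from the end of the list, each as a hook attached at its start
  \<open>u\<close>. \<open>scan u v v\<close> is the test for a moving edge with the motion at rest.
  The head \<open>v\<close> must be new, so a strand has to be built in the order of travel; a list
  in that order is therefore reversed before it is tested.\<close>

fun valid :: "(point \<times> point) list \<Rightarrow> bool" where
  "valid [] = True"
| "valid ((u, v) # es) =
     (if valid es then if dot u v v \<noteq> 0 then if list_all (\<lambda>e. fst e \<noteq> u) es then scan u v v [] es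
      else False else False else False)"

fun boundary_point :: "point \<Rightarrow> bool" where
  "boundary_point (x, y, _) = (x * x + y * y = 1000000)"

definition heads :: "(point \<times> point) list \<Rightarrow> point list" where
  "heads es = filter (\<lambda>p. \<not> List.member (map snd es) p) (map fst es)"

definition tails :: "(point \<times> point) list \<Rightarrow> point list" where
  "tails es = filter (\<lambda>p. \<not> List.member (map fst es) p) (map snd es)"

definition well_placed :: "(point \<times> point) list \<Rightarrow> bool" where
  "well_placed es = list_all (\<lambda>p. if List.member (heads es @ tails es) p then boundary_point p else inner_point p)
     (map fst es @ map snd es)"

lemma set_heads: "set (heads es) = fst ` set es - snd ` set es" "set (tails es) = snd ` set es - fst ` set es"
  unfolding heads_def tails_def by (auto simp: List.member_iff simp del: split_paired_All split_paired_Ex)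

lemma vert_image_diff: "vert ` (A - B) = vert ` A - vert ` B"
proof -
  have "inj vert" by (rule injI) (simp only: vert_inj)
  then show ?thesis by (rule image_set_diff)
qed

lemma boundary_diag: "starts (diag es) = vert ` set (heads es)" "finishes (diag es) = vert ` set (tails es)"
  unfolding set_heads vert_image_diff starts_def finishes_def diag_def image_image fst_map_prod snd_map_prod
  by (rule refl)+

lemma dot_self: "dot u v v \<noteq> 0 \<Longrightarrow> shade u \<noteq> shade v"
  by (cases u; cases v) auto

lemma valid_generic: "valid es \<Longrightarrow> generic_diagram (diag es)"
proof (induction es)
  case Nil
  show ?case by (rule genericI) (simp_all add: diag_def)
next
  case (Cons e es)
  obtain u v where e: "e = (u, v)" by (cases e)
  have c: "valid es" "dot u v v \<noteq> 0" "list_all (\<lambda>e. fst e \<noteq> u) es" "scan u v v [] es"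
    using Cons.prems unfolding e valid.simps by (simp_all split: if_split_asm)
  have G: "generic_diagram (diag es)" using Cons.IH c(1) .
  have u: "u \<notin> fst ` set es" using c(3) by (auto simp: list_all_iff simp del: split_paired_All)
  then have u': "vert u \<notin> fst ` diag es" unfolding fst_diag .
  have h: "hooks (diag es) (vert u) (vert v)"
  proof -
    have "hooks (diag es) (vert u) (slid v v 0)"
    proof (rule scan_hooks[OF G c(4)])
      show "shade u \<noteq> fst (slid v v 0)" using dot_self[OF c(2)] by simp
      show "f = g" if "f \<in> set es" "g \<in> set es" "fst f = u \<or> snd f = u" "fst g = u \<or> snd g = u" for f g
      proof -
        have "fst f \<noteq> u" "fst g \<noteq> u" using u that(1,2) by blast+
        then have "snd f = snd g" using that by simp
        then show ?thesis using inj_onD[OF generic_inj(2)[OF G] _ that(1,2)] by blast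
      qed
    qed simp_all
    then show ?thesis by simp
  qed
  have hd: "if fst f = vert u \<or> snd f = vert u then shadow (vert u, vert v) \<inter> shadow f = {shade u}
      else transverse (vert u, vert v) f" if "f \<in> diag es" for f
    using hooksD(2)[OF h that] .
  have d: "diag (e # es) = insert (vert u, vert v) (diag es)" by (simp add: diag_def e)
  show ?case unfolding d
  proof (rule generic_insert[OF G _ u'])
    show "shade u \<noteq> shade v" using dot_self[OF c(2)] .
    show "vert v \<notin> snd ` diag es" using hooks_tip(2)[OF h] by (metis imageE)
    show "shadow f \<inter> shadow (vert u, vert v) = {shade u}" if "f \<in> diag es" "snd f = vert u" for f
      using hd[OF that(1)] that(2) by (simp add: Int_commute)
    show "shadow (vert u, vert v) \<inter> shadow f = {shade v}" if "f \<in> diag es" "fst f = vert v" for f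
      using hooks_tip(1)[OF h that(1)] that(2) by simp
    show "transverse (vert u, vert v) f" if "f \<in> diag es" "snd f \<noteq> vert u" for f
    proof -
      have "fst f \<noteq> vert u" using u' that(1) by (metis imageI)
      then show ?thesis using hd[OF that(1)] that(2) by simp
    qed
    show "shadow (vert u, vert v) \<inter> shadow f \<inter> shadow g = {}" if "f \<in> diag es" "g \<in> diag es" "f \<noteq> g" for f g
      using hooksD(3)[OF h that] .
  qed
qed

lemma boundary_point_iff: "boundary_point p \<longleftrightarrow> shade p \<in> sphere 0 1"
proof -
  obtain x y h where p: "p = (x, y, h)" by (cases p)
  have "shade p \<in> sphere 0 1 \<longleftrightarrow> (norm (shade p))\<^sup>2 = 1"
    using norm_ge_zero[of "shade p"] unfolding power2_eq_1_iff mem_sphere_0 by linarith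
  also have "(norm (shade p))\<^sup>2 = of_int (x * x + y * y) / 1000000"
    unfolding power2_norm_eq_inner by (simp add: p add_divide_distrib)
  also have "\<dots> = 1 \<longleftrightarrow> (of_int (x * x + y * y) :: real) = of_int 1000000" by simp
  also have "\<dots> \<longleftrightarrow> x * x + y * y = 1000000" by (rule of_int_eq_iff)
  finally show ?thesis by (simp add: p)
qed

lemma disk_diagram_diag:
  assumes "valid (rev es)" "well_placed es"
  shows "disk_diagram (diag es)"
proof (rule disk_diagramI)
  have "diag (rev es) = diag es" by (simp add: diag_def)
  then show "generic_diagram (diag es)" using valid_generic[OF assms(1)] by simp
  fix w assume w: "w \<in> verts (diag es)"
  have "verts (diag es) = vert ` (fst ` set es \<union> snd ` set es)"
    unfolding verts_def diag_def image_Un image_image fst_map_prod snd_map_prod ..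
  then obtain p where p: "p \<in> fst ` set es \<union> snd ` set es" "w = vert p" using w by blast
  have "w \<in> ends (diag es) \<longleftrightarrow> p \<in> set (heads es) \<union> set (tails es)"
  proof -
    have "inj vert" by (rule injI) (simp only: vert_inj)
    then show ?thesis unfolding ends_eq boundary_diag p(2) image_Un[symmetric] by (rule inj_image_mem_iff)
  qed
  moreover have "if p \<in> set (heads es) \<union> set (tails es) then boundary_point p else inner_point p"
    using assms(2) p(1) unfolding well_placed_def list_all_iff set_append set_map List.member_iff by blast
  ultimately have "if w \<in> ends (diag es) then fst w \<in> sphere 0 1 else fst w \<in> ball 0 1"
    unfolding boundary_point_iff inner_point_iff p(2) by simp
  then show "fst w \<in> cball 0 1" "w \<in> ends (diag es) \<longleftrightarrow> fst w \<in> sphere 0 1"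
    by (auto split: if_splits)
qed

definition proper :: "(point \<times> point) list \<times> (point \<times> point) list \<Rightarrow> bool" where
  "proper P = (valid (rev (fst P)) \<and> valid (rev (snd P)) \<and> well_placed (fst P) \<and> well_placed (snd P) \<and>
     heads (snd P) = heads (fst P) \<and> tails (snd P) = tails (fst P))"

lemma proper_pic: "proper (pic r)"
  by (cases r; simp only:; code_simp)

lemma sides_disk: "disk_diagram (fst (sides r))" "disk_diagram (snd (sides r))"
  "starts (snd (sides r)) = starts (fst (sides r))" "finishes (snd (sides r)) = finishes (fst (sides r))"
  using proper_pic[of r] disk_diagram_diag unfolding proper_def sides_pic boundary_diag by simp_all

section \<open>Deformations inside a larger diagram\<close>

definition lift :: "(real \<times> real \<Rightarrow> real \<times> real) \<Rightarrow> vertex \<Rightarrow> vertex" where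
  "lift A = map_prod A id"

abbreviation lift_edge :: "(real \<times> real \<Rightarrow> real \<times> real) \<Rightarrow> edge \<Rightarrow> edge" where
  "lift_edge A \<equiv> map_prod (lift A) (lift A)"

lemma place_eq: "place A D = lift_edge A ` D"
  by (simp add: place_def lift_def)

lemma mem_place: "e \<in> place A D \<longleftrightarrow> (\<exists>f\<in>D. e = lift_edge A f)"
  unfolding place_eq image_iff ..

lemma fst_lift [simp]: "fst (lift A v) = A (fst v)"
  by (simp add: lift_def)

section \<open>Affine images of diagrams\<close>

lemma affine_combination:
  assumes "orientation_preserving_affine A"
  shows "A ((1 - t) *\<^sub>R x + t *\<^sub>R y) = (1 - t) *\<^sub>R A x + t *\<^sub>R A y"
proof -
  obtain a b c d p q where "A = (\<lambda>(x, y). (a * x + b * y + p, c * x + d * y + q))"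
    using assms unfolding orientation_preserving_affine_def by blast
  then show ?thesis by (simp add: case_prod_unfold algebra_simps)
qed

lemma affine_inj:
  assumes "orientation_preserving_affine A" shows "inj A"
proof (rule injI)
  fix x y assume xy: "A x = A y"
  obtain a b c d p q where A: "0 < a * d - b * c" "A = (\<lambda>(x, y). (a * x + b * y + p, c * x + d * y + q))"
    using assms unfolding orientation_preserving_affine_def by blast
  have "a * (fst x - fst y) + b * (snd x - snd y) = 0" "c * (fst x - fst y) + d * (snd x - snd y) = 0"
    using xy unfolding A(2) by (simp_all add: case_prod_unfold algebra_simps)
  then have "(a * d - b * c) * (fst x - fst y) = 0" "(a * d - b * c) * (snd x - snd y) = 0"
    by algebra+
  then show "x = y" using A(1) by (simp add: prod_eq_iff)
qed

lemma affine_compose: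
  assumes "orientation_preserving_affine A" "orientation_preserving_affine B"
  shows "orientation_preserving_affine (A \<circ> B)"
proof -
  obtain a b c d p q where A: "0 < a * d - b * c" "A = (\<lambda>(x, y). (a * x + b * y + p, c * x + d * y + q))"
    using assms(1) unfolding orientation_preserving_affine_def by blast
  obtain a' b' c' d' p' q' where B: "0 < a' * d' - b' * c'"
      "B = (\<lambda>(x, y). (a' * x + b' * y + p', c' * x + d' * y + q'))"
    using assms(2) unfolding orientation_preserving_affine_def by blast
  have "(a * a' + b * c') * (c * b' + d * d') - (a * b' + b * d') * (c * a' + d * c') = (a * d - b * c) * (a' *
      d' - b' * c')"
    by algebra
  then have "0 < (a * a' + b * c') * (c * b' + d * d') - (a * b' + b * d') * (c * a' + d * c')"
    using A(1) B(1) by simp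
  moreover have "A \<circ> B = (\<lambda>(x, y). ((a * a' + b * c') * x + (a * b' + b * d') * y + (a * p' + b * q' + p),
      (c * a' + d * c') * x + (c * b' + d * d') * y + (c * p' + d * q' + q)))"
    unfolding A(2) B(2) by (rule ext) (simp add: case_prod_unfold algebra_simps)
  ultimately show ?thesis unfolding orientation_preserving_affine_def by blast
qed

lemma segment_image:
  assumes "\<And>t x y. F ((1 - t) *\<^sub>R x + t *\<^sub>R y) = (1 - t) *\<^sub>R F x + t *\<^sub>R F y"
  shows "closed_segment (F x) (F y) = F ` closed_segment x y"
    and "inj F \<Longrightarrow> open_segment (F x) (F y) = F ` open_segment x y"
proof -
  show c: "closed_segment (F x) (F y) = F ` closed_segment x y"
    unfolding closed_segment_image_interval image_image assms ..
  show "open_segment (F x) (F y) = F ` open_segment x y" if "inj F"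
    unfolding open_segment_def c by (simp add: image_set_diff[OF that])
qed

context
  fixes A assumes A: "orientation_preserving_affine A"
begin

lemma lift_combination: "lift A ((1 - t) *\<^sub>R x + t *\<^sub>R y) = (1 - t) *\<^sub>R lift A x + t *\<^sub>R lift A y"
  unfolding lift_def by (simp add: prod_eq_iff affine_combination[OF A])

lemma lift_inj: "inj (lift A)"
  unfolding lift_def by (intro prod.inj_map affine_inj[OF A]) simp

lemma lift_edge_inj: "inj (lift_edge A)"
  by (intro prod.inj_map lift_inj)

lemma shadow_lift: "shadow (lift_edge A e) = A ` shadow e" "open_shadow (lift_edge A e) = A ` open_shadow e"
  "solid (lift_edge A e) = lift A ` solid e"
  unfolding shadow_def open_shadow_def solid_def fst_map_prod snd_map_prod fst_lift
  by (rule segment_image affine_combination[OF A] lift_combination affine_inj[OF A])+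

lemma transverse_lift:
  assumes "transverse e f" shows "transverse (lift_edge A e) (lift_edge A f)"
proof -
  have "lift A ` solid e \<inter> lift A ` solid f = {}"
    using assms unfolding transverse_def image_Int[OF lift_inj, symmetric] by simp
  moreover have "A ` shadow e \<inter> A ` shadow f = {} \<or>
    (\<exists>p \<in> A ` open_shadow e \<inter> A ` open_shadow f. A ` shadow e \<inter> A ` shadow f = {p})"
  proof (cases "shadow e \<inter> shadow f = {}")
    case True
    then show ?thesis unfolding image_Int[OF affine_inj[OF A], symmetric] by simp
  next
    case False
    then have "\<exists>p\<in>open_shadow e \<inter> open_shadow f. shadow e \<inter> shadow f = {p}"
      using assms unfolding transverse_def by simp
    then obtain p where p: "p \<in> open_shadow e \<inter> open_shadow f" "shadow e \<inter> shadow f = {p}" by (rule bexE)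
    have "A ` shadow e \<inter> A ` shadow f = {A p}"
      unfolding image_Int[OF affine_inj[OF A], symmetric] p(2) by simp
    moreover have "A p \<in> A ` open_shadow e \<inter> A ` open_shadow f" using p(1) by simp
    ultimately show ?thesis by (intro disjI2 bexI)
  qed
  ultimately show ?thesis unfolding transverse_def shadow_lift ..
qed

lemma generic_place:
  assumes "generic_diagram D" shows "generic_diagram (place A D)"
proof -
  note G = genericD[OF assms]
  have eq: "lift A v = lift A w \<longleftrightarrow> v = w" for v w using lift_inj by (simp add: inj_eq)
  have eqA: "A x = A y \<longleftrightarrow> x = y" for x y using affine_inj[OF A] by (simp add: inj_eq)
  note mem = iffD1[OF mem_place]
  show ?thesis
  proof (rule genericI)
    show "finite (place A D)" unfolding place_eq using G(1) by simp
    show "inj_on fst (place A D)"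
    proof (rule inj_onI)
      fix e f assume "e \<in> place A D" "f \<in> place A D" and ef: "fst e = fst f"
      then obtain e' f' where e: "e' \<in> D" "e = lift_edge A e'" "f' \<in> D" "f = lift_edge A f'" using mem by metis
      then have "fst e' = fst f'" using ef eq by simp
      then show "e = f" using inj_onD[OF G(2) _ e(1,3)] e by blast
    qed
    show "inj_on snd (place A D)"
    proof (rule inj_onI)
      fix e f assume "e \<in> place A D" "f \<in> place A D" and ef: "snd e = snd f"
      then obtain e' f' where e: "e' \<in> D" "e = lift_edge A e'" "f' \<in> D" "f = lift_edge A f'" using mem by metis
      then have "snd e' = snd f'" using ef eq by simp
      then show "e = f" using inj_onD[OF G(3) _ e(1,3)] e by blast
    qed
    show "fst (fst e) \<noteq> fst (snd e)" if "e \<in> place A D" for e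
    proof -
      obtain e' where "e' \<in> D" "e = lift_edge A e'" using mem \<open>e \<in> place A D\<close> by metis
      then show ?thesis using G(4) eqA by simp
    qed
    show "shadow e \<inter> shadow f = {fst (snd e)}" if ef: "e \<in> place A D" "f \<in> place A D" "snd e = fst f" for e f
    proof -
      obtain e' f' where e: "e' \<in> D" "e = lift_edge A e'" "f' \<in> D" "f = lift_edge A f'" using mem ef by metis
      then have "snd e' = fst f'" using ef(3) eq by simp
      then have "shadow e' \<inter> shadow f' = {fst (snd e')}" using G(5) e by blast
      then have "A ` shadow e' \<inter> A ` shadow f' = {A (fst (snd e'))}"
        unfolding image_Int[OF affine_inj[OF A], symmetric] by simp
      then show ?thesis unfolding e shadow_lift by simp
    qed
    show "transverse e f"
      if ef: "e \<in> place A D" "f \<in> place A D" "e \<noteq> f" "snd e \<noteq> fst f" "snd f \<noteq> fst e" for e f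
    proof -
      obtain e' f' where e: "e' \<in> D" "e = lift_edge A e'" "f' \<in> D" "f = lift_edge A f'" using mem ef(1,2) by metis
      have "e' \<noteq> f'" "snd e' \<noteq> fst f'" "snd f' \<noteq> fst e'" using ef(3-5) eq unfolding e by auto
      then show ?thesis using G(6) e transverse_lift by blast
    qed
    show "shadow e \<inter> shadow f \<inter> shadow g = {}"
      if ef: "e \<in> place A D" "f \<in> place A D" "g \<in> place A D" "e \<noteq> f" "f \<noteq> g" "e \<noteq> g" for e f g
    proof -
      obtain e' f' g' where e: "e' \<in> D" "e = lift_edge A e'" "f' \<in> D" "f = lift_edge A f'" "g' \<in> D"
          "g = lift_edge A g'"
        using mem ef(1-3) by metis
      have "e' \<noteq> f'" "f' \<noteq> g'" "e' \<noteq> g'" using ef(4-6) unfolding e by blast+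
      then have "shadow e' \<inter> shadow f' \<inter> shadow g' = {}" using G(7) e by blast
      then show ?thesis unfolding e shadow_lift image_Int[OF affine_inj[OF A], symmetric] by simp
    qed
  qed
qed

lemma verts_place: "verts (place A D) = lift A ` verts D"
  unfolding place_eq by (rule verts_map)

lemma boundary_place: "starts (place A D) = lift A ` starts D" "finishes (place A D) = lift A ` finishes D"
  "ends (place A D) = lift A ` ends D"
proof -
  show s: "starts (place A D) = lift A ` starts D" "finishes (place A D) = lift A ` finishes D"
    unfolding place_eq using starts_map[of "lift A" D] lift_inj
        by (auto intro: inj_on_subset simp del: split_paired_All)
  show "ends (place A D) = lift A ` ends D" unfolding ends_eq s image_Un ..
qed

lemma inside_place:
  assumes D: "disk_diagram D" shows "inside (A ` ball 0 1) (place A D)"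
  unfolding inside_def
proof (intro conjI ballI)
  show "generic_diagram (place A D)" by (rule generic_place[OF disk_diagramD(1)[OF D]])
next
  fix e assume "e \<in> place A D"
  then obtain e' where e: "e' \<in> D" "e = lift_edge A e'" using iffD1[OF mem_place] by metis
  have "open_shadow e' \<subseteq> ball 0 1"
    using open_segment_in_ball[OF disk_diagramD(2)[OF D verts_mem(1)[OF e(1)]] disk_diagramD(2)[OF D
        verts_mem(2)[OF e(1)]]]
    unfolding open_shadow_def by blast
  then show "open_shadow e \<subseteq> A ` ball 0 1" unfolding e shadow_lift by blast
next
  fix v assume "v \<in> verts (place A D)"
  then obtain w where w: "w \<in> verts D" "v = lift A w" unfolding verts_place by (metis imageE)
  have "v \<in> ends (place A D) \<longleftrightarrow> w \<in> ends D"
    unfolding w boundary_place by (rule inj_image_mem_iff[OF lift_inj])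
  also have "\<dots> \<longleftrightarrow> fst w \<notin> ball 0 1" using disk_diagramD(2,3)[OF D w(1)] by auto
  also have "\<dots> \<longleftrightarrow> fst v \<notin> A ` ball 0 1"
    unfolding w fst_lift inj_image_mem_iff[OF affine_inj[OF A]] ..
  finally show "v \<in> ends (place A D) \<longleftrightarrow> fst v \<notin> A ` ball 0 1" .
qed

text \<open>Each point of the open disk is the midpoint of a nondegenerate segment in the closed
  disk, here with half vector \<open>w\<close>. An injective affine map preserves this, and an
  interior point of a segment in the closed disk lies in the open disk by strict convexity.\<close>

lemma ball_image:
  assumes "A ` cball 0 1 \<subseteq> cball 0 1" shows "A ` ball 0 1 \<subseteq> ball 0 1"
proof
  fix z assume "z \<in> A ` ball 0 1"
  then obtain x where x: "x \<in> ball 0 1" "z = A x" by blast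
  define w where "w = ((1 - norm x), 0 :: real)"
  have nw: "norm w = 1 - norm x" using x(1) by (simp add: w_def norm_Pair)
  have y: "x - w \<in> cball 0 1" "x + w \<in> cball 0 1"
    using norm_triangle_ineq4[of x w] norm_triangle_ineq[of x w] nw by simp_all
  have "w \<noteq> 0" using nw x(1) by auto
  have "x = (1 - 1/2) *\<^sub>R (x - w) + (1/2) *\<^sub>R (x + w)"
    by (simp add: algebra_simps flip: scaleR_add_left)
  moreover have "x - w \<noteq> x + w"
  proof
    assume "x - w = x + w"
    then have "2 *\<^sub>R w = 0" by (simp add: scaleR_2 algebra_simps)
    then show False using \<open>w \<noteq> 0\<close> by simp
  qed
  ultimately have "x \<in> open_segment (x - w) (x + w)" unfolding in_segment
    by (intro conjI exI[of _ "1/2 :: real"]) simp_all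
  then have "z \<in> open_segment (A (x - w)) (A (x + w))"
    unfolding x(2) segment_image(2)[OF affine_combination[OF A] affine_inj[OF A]] by blast
  then show "z \<in> ball 0 1" using open_segment_in_ball assms y by blast
qed

end

text \<open>The open image of the disk stays in the open unit disk, so new vertices in it are off
  the circle and are not ends. All other vertices and all ends are those of the old diagram.\<close>

lemma disk_replace:
  assumes A: "orientation_preserving_affine A" "A ` cball 0 1 \<subseteq> cball 0 1"
    and O: "avoiding (A ` ball 0 1) Out"
    and U: "disk_diagram (Out \<union> place A D)" and D: "disk_diagram D" and D': "disk_diagram D'"
    and b: "starts D' = starts D" "finishes D' = finishes D"
  shows "disk_diagram (Out \<union> place A D')"
proof -
  note E = inside_place[OF A(1) D] and E' = inside_place[OF A(1) D']
  have b': "starts (place A D') = starts (place A D)" "finishes (place A D') = finishes (place A D)"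
    unfolding boundary_place[OF A(1)] b by (rule refl)+
  note R = boundary_replace[OF E E' b' O]
  have ends: "ends (Out \<union> place A D') = ends (Out \<union> place A D)" unfolding ends_eq R(1,2) ..
  show ?thesis
  proof (rule disk_diagramI)
    show "generic_diagram (Out \<union> place A D')"
      by (rule generic_replace[OF disk_diagramD(1)[OF U] E E' b' O])
    fix v assume v: "v \<in> verts (Out \<union> place A D')"
    show "fst v \<in> cball 0 1"
    proof (cases "fst v \<in> A ` ball 0 1")
      case True
      then show ?thesis using ball_image[OF A] by auto
    next
      case False
      then show ?thesis using disk_diagramD(2)[OF U] R(3)[OF v] by blast
    qed
    show "v \<in> ends (Out \<union> place A D') \<longleftrightarrow> fst v \<in> sphere 0 1"
    proof (cases "fst v \<in> A ` ball 0 1")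
      case True
      then have "fst v \<in> ball 0 1" using ball_image[OF A] by blast
      then have "fst v \<notin> sphere 0 1" by simp
      then show ?thesis using R(4)[of v] True by blast
    next
      case False
      then show ?thesis using disk_diagramD(3)[OF U R(3)[OF v False]] unfolding ends by blast
    qed
  qed
qed

text \<open>The isotopy is transported by \<open>A\<close> and continued by the identity. A vertex
  common to both parts lies off the open small disk, hence is an end of \<open>D\<close>, where the
  isotopy is at rest; so the two definitions agree.\<close>

lemma isotopic_context:
  assumes A: "orientation_preserving_affine A" "A ` cball 0 1 \<subseteq> cball 0 1"
    and O: "avoiding (A ` ball 0 1) Out"
    and U: "disk_diagram (Out \<union> place A D)" and iso: "planar_isotopic D D'"
  shows "planar_isotopic (Out \<union> place A D) (Out \<union> place A D')"
proof -
  obtain \<phi> :: "real \<Rightarrow> vertex \<Rightarrow> vertex" where \<phi>: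
    "\<And>v. v \<in> verts D \<Longrightarrow> continuous_on {0..1} (\<lambda>t. \<phi> t v)"
    "\<And>v. v \<in> verts D \<Longrightarrow> \<phi> 0 v = v" "\<And>t. t \<in> {0..1} \<Longrightarrow> inj_on (\<phi> t) (verts D)"
    "\<And>t. t \<in> {0..1} \<Longrightarrow> disk_diagram (map_prod (\<phi> t) (\<phi> t) ` D)"
    "\<And>t v. t \<in> {0..1} \<Longrightarrow> v \<in> ends D \<Longrightarrow> \<phi> t v = v" "D' = map_prod (\<phi> 1) (\<phi> 1) ` D"
    by (rule isotopicD[OF iso]) (rule that)
  have D: "disk_diagram D" by (rule isotopic_boundary(1)[OF iso])
  let ?L = "lift A"
  let ?g = "inv ?L"
  have g: "?g (?L v) = v" for v by (rule inv_f_f[OF lift_inj[OF A(1)]])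
  define Dt where "Dt t = map_prod (\<phi> t) (\<phi> t) ` D" for t
  have fixed: "\<phi> t ` starts D = starts D" "\<phi> t ` finishes D = finishes D" if "t \<in> {0..1}" for t
    using image_cong[of _ _ "\<phi> t" "\<lambda>v. v"] \<phi>(5)[OF that] unfolding ends_eq by simp_all
  have bt: "starts (Dt t) = starts D" "finishes (Dt t) = finishes D" if "t \<in> {0..1}" for t
    unfolding Dt_def using starts_map[OF \<phi>(3)[OF that]] fixed[OF that] by simp_all
  have dt: "disk_diagram (Dt t)" if "t \<in> {0..1}" for t unfolding Dt_def by (rule \<phi>(4)[OF that])
  have Ut: "disk_diagram (Out \<union> place A (Dt t))" if "t \<in> {0..1}" for t
    by (rule disk_replace[OF A O U D dt[OF that] bt[OF that]])
  have ob: "fst v \<notin> A ` ball 0 1" if "v \<in> verts Out" for v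
    using outer_vertex[OF O, of v] that unfolding verts_def by blast
  have end_D: "w \<in> ends F" if w: "w \<in> verts F" "?L w \<in> verts Out" and F: "disk_diagram F" for w F
  proof -
    have "fst w \<notin> ball 0 1" using ob[OF w(2)] unfolding fst_lift by blast
    then show ?thesis using disk_diagramD(2,3)[OF F w(1)] by auto
  qed
  define \<psi> where "\<psi> t v = (if v \<in> verts Out then v else ?L (\<phi> t (?g v)))" for t v
  have \<psi>L: "\<psi> t (?L w) = ?L (\<phi> t w)" if "w \<in> verts D" "t \<in> {0..1}" for t w
  proof (cases "?L w \<in> verts Out")
    case True
    then show ?thesis using \<phi>(5)[OF that(2) end_D[OF that(1) True D]] by (simp add: \<psi>_def)
  qed (simp add: \<psi>_def g)
  have V: "verts (Out \<union> place A D) = verts Out \<union> ?L ` verts D"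
    unfolding verts_place[OF A(1), symmetric] by (simp add: verts_def image_Un Un_ac)
  have m: "map_prod (\<psi> t) (\<psi> t) ` (Out \<union> place A D) = Out \<union> place A (Dt t)" if "t \<in> {0..1}" for t
  proof -
    have "map_prod (\<psi> t) (\<psi> t) ` Out = Out"
      by (rule map_prod_ident) (simp add: \<psi>_def)
    moreover have "map_prod (\<psi> t) (\<psi> t) ` place A D = place A (Dt t)"
      unfolding place_eq Dt_def image_image
    proof (rule image_cong[OF refl])
      fix e assume "e \<in> D"
      note v = verts_mem[OF this]
      show "map_prod (\<psi> t) (\<psi> t) (lift_edge A e) = lift_edge A (map_prod (\<phi> t) (\<phi> t) e)"
        using \<psi>L[OF v(1) that] \<psi>L[OF v(2) that] by (simp add: prod_eq_iff del: fst_lift)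
    qed
    ultimately show ?thesis by (simp add: image_Un)
  qed
  have cont: "continuous_on UNIV ?L"
  proof -
    obtain a b c d p q where "A = (\<lambda>(x, y). (a * x + b * y + p, c * x + d * y + q))"
      using A(1) unfolding orientation_preserving_affine_def by blast
    then have "?L = (\<lambda>v. ((a * fst (fst v) + b * snd (fst v) + p, c * fst (fst v) + d * snd (fst v) + q), snd v))"
      unfolding lift_def by (auto simp: fun_eq_iff)
    then show ?thesis by (simp only:) (intro continuous_intros)
  qed
  have cL: "continuous_on {0..1} (\<lambda>t. ?L (\<phi> t w))" if "w \<in> verts D" for w
    by (rule continuous_on_compose2[OF cont \<phi>(1)[OF that]]) simp
  show ?thesis unfolding planar_isotopic_def
  proof (intro exI[of _ \<psi>] conjI ballI)
    fix v assume "v \<in> verts (Out \<union> place A D)"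
    then consider "v \<in> verts Out" | w where "w \<in> verts D" "v = ?L w" unfolding V by blast
    note cs = this
    show "continuous_on {0..1} (\<lambda>t. \<psi> t v)"
      using cs
    proof cases
      case 1
      then show ?thesis by (simp add: \<psi>_def)
    next
      case 2
      have "continuous_on {0..1} (\<lambda>t. \<psi> t (?L w)) \<longleftrightarrow> continuous_on {0..1} (\<lambda>t. ?L (\<phi> t w))"
        by (rule continuous_on_cong[OF refl]) (rule \<psi>L[OF 2(1)])
      then show ?thesis using cL[OF 2(1)] 2(2) by simp
    qed
    show "\<psi> 0 v = v"
      using cs
    proof cases
      case 1
      then show ?thesis by (simp add: \<psi>_def)
    next
      case 2
      then show ?thesis using \<psi>L[OF 2(1), of 0] \<phi>(2)[OF 2(1)] by simp
    qed
  next
    fix t :: real assume t: "t \<in> {0..1}"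
    \<comment> \<open>A moving vertex cannot run into an outer one: there it would be an end of the
      deformed diagram, hence an end of \<open>D\<close>, hence a fixed point of
      \<open>\<phi> t\<close>; by injectivity it then coincides with \<open>w\<close>.\<close>
    have mixed: "v = ?L w" if "v \<in> verts Out" "w \<in> verts D" "v = ?L (\<phi> t w)" for v w
    proof -
      have "\<phi> t w \<in> verts (Dt t)" unfolding Dt_def verts_map using that(2) by (rule imageI)
      then have "\<phi> t w \<in> ends (Dt t)" using end_D[OF _ _ dt[OF t]] that(1,3) by blast
      then have e: "\<phi> t w \<in> ends D" using bt[OF t] unfolding ends_eq by simp
      then have "\<phi> t (\<phi> t w) = \<phi> t w" by (rule \<phi>(5)[OF t])
      moreover have "\<phi> t w \<in> verts D" using e ends_subset_verts by (rule rev_subsetD)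
      ultimately have "\<phi> t w = w" using inj_onD[OF \<phi>(3)[OF t]] that(2) by metis
      then show ?thesis using that(3) by simp
    qed
    show "inj_on (\<psi> t) (verts (Out \<union> place A D))"
    proof (rule inj_onI)
      fix v v' assume v: "v \<in> verts (Out \<union> place A D)" "v' \<in> verts (Out \<union> place A D)" "\<psi> t v = \<psi> t v'"
      have cs: "(v \<in> verts Out \<and> \<psi> t v = v) \<or> (\<exists>w. w \<in> verts D \<and> v = ?L w \<and> \<psi> t v = ?L (\<phi> t w))"
        if "v \<in> verts (Out \<union> place A D)" for v
      proof -
        have "v \<in> verts Out \<or> (\<exists>w. w \<in> verts D \<and> v = ?L w)" using that unfolding V by blast
        then show ?thesis using \<psi>L[OF _ t] by (metis \<psi>_def)
      qed
      from cs[OF v(1)] show "v = v'"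
      proof (elim disjE exE conjE)
        assume 1: "v \<in> verts Out" "\<psi> t v = v"
        from cs[OF v(2)] show ?thesis
        proof (elim disjE exE conjE)
          assume "\<psi> t v' = v'"
          then show ?thesis using 1(2) v(3) by (metis (no_types))
        next
          fix w assume w: "w \<in> verts D" "v' = ?L w" "\<psi> t v' = ?L (\<phi> t w)"
          have "v = ?L (\<phi> t w)" by (rule trans[OF 1(2)[symmetric] trans[OF v(3) w(3)]])
          from mixed[OF 1(1) w(1) this] show ?thesis unfolding w(2) .
        qed
      next
        fix u assume 2: "u \<in> verts D" "v = ?L u" "\<psi> t v = ?L (\<phi> t u)"
        from cs[OF v(2)] show ?thesis
        proof (elim disjE exE conjE)
          assume 3: "v' \<in> verts Out" "\<psi> t v' = v'"
          have "v' = ?L (\<phi> t u)" by (rule trans[OF 3(2)[symmetric] trans[OF v(3)[symmetric] 2(3)]])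
          from mixed[OF 3(1) 2(1) this] show ?thesis unfolding 2(2) by (rule sym)
        next
          fix w assume w: "w \<in> verts D" "v' = ?L w" "\<psi> t v' = ?L (\<phi> t w)"
          have "?L (\<phi> t u) = ?L (\<phi> t w)" by (rule trans[OF 2(3)[symmetric] trans[OF v(3) w(3)]])
          then have "\<phi> t u = \<phi> t w" by (rule injD[OF lift_inj[OF A(1)]])
          then have "u = w" using inj_onD[OF \<phi>(3)[OF t]] 2(1) w(1) by blast
          then show ?thesis unfolding 2(2) w(2) by (rule arg_cong)
        qed
      qed
    qed
    show "disk_diagram (map_prod (\<psi> t) (\<psi> t) ` (Out \<union> place A D))"
      unfolding m[OF t] by (rule Ut[OF t])
    fix v assume v: "v \<in> ends (Out \<union> place A D)"
    have vB: "fst v \<notin> A ` ball 0 1"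
      using boundary_replace(4)[OF inside_place[OF A(1) D] inside_place[OF A(1) D] refl refl O v] .
    have "v \<in> verts Out \<or> (\<exists>w. w \<in> verts D \<and> v = ?L w)"
      using v ends_subset_verts[of "Out \<union> place A D"] unfolding V by blast
    then show "\<psi> t v = v"
    proof (elim disjE exE conjE)
      assume "v \<in> verts Out" then show ?thesis by (simp add: \<psi>_def)
    next
      fix w assume w: "w \<in> verts D" "v = ?L w"
      have "fst w \<notin> ball 0 1" using vB unfolding w(2) fst_lift by blast
      then have "w \<in> ends D" using disk_diagramD(2,3)[OF D w(1)] by auto
      then show ?thesis using \<psi>L[OF w(1) t] \<phi>(5)[OF t] w(2) by simp
    qed
  next
    show "Out \<union> place A D' = map_prod (\<psi> 1) (\<psi> 1) ` (Out \<union> place A D)"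
      using m[of 1] unfolding Dt_def \<phi>(6) by simp
  qed
qed

section \<open>Steps carried into a larger diagram\<close>

lemma subdivision_boundary:
  assumes "subdivision D D'"
  shows "starts D' = starts D" "finishes D' = finishes D"
proof -
  obtain u v w where d: "disk_diagram D" "disk_diagram D'" "(u, v) \<in> D" "D' = D - {(u, v)} \<union> {(u, w), (w, v)}"
    using assms unfolding subdivision_def by (elim conjE exE) (rule that)
  note G = disk_diagramD(1)[OF d(1)] and G' = disk_diagramD(1)[OF d(2)]
  have e: "(u, w) \<in> D'" "(w, v) \<in> D'" unfolding d(4) by simp_all
  have "fst u \<noteq> fst w" "fst w \<noteq> fst v" using genericD(4)[OF G' e(1)] genericD(4)[OF G' e(2)] by simp_all
  then have ne: "u \<noteq> w" "w \<noteq> v" by metis+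
  have w1: "w \<notin> fst ` D"
  proof
    assume "w \<in> fst ` D"
    then obtain f where f: "f \<in> D" "fst f = w" by (metis imageE)
    then have "f \<noteq> (u, v)" using ne(1) by (metis fst_conv)
    then have "f \<in> D'" using f(1) unfolding d(4) by simp
    then have "f = (w, v)" using inj_onD[OF genericD(2)[OF G'] _ _ e(2)] f(2) by simp
    then have "f = (u, v)" using inj_onD[OF genericD(3)[OF G] _ f(1) d(3)] by simp
    then show False using \<open>f \<noteq> (u, v)\<close> by simp
  qed
  have w2: "w \<notin> snd ` D"
  proof
    assume "w \<in> snd ` D"
    then obtain f where f: "f \<in> D" "snd f = w" by (metis imageE)
    then have "f \<noteq> (u, v)" using ne(2) by (metis snd_conv)
    then have "f \<in> D'" using f(1) unfolding d(4) by simp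
    then have "f = (u, w)" using inj_onD[OF genericD(3)[OF G'] _ _ e(1)] f(2) by simp
    then have "f = (u, v)" using inj_onD[OF genericD(2)[OF G] _ f(1) d(3)] by simp
    then show False using \<open>f \<noteq> (u, v)\<close> by simp
  qed
  define R where "R = D - {(u, v)}"
  have D: "D = insert (u, v) R" unfolding R_def using d(3) by (simp only: insert_Diff)
  have D': "D' = R \<union> {(u, w), (w, v)}" unfolding R_def by (rule d(4))
  have "fst ` D = insert u (fst ` R)" "snd ` D = insert v (snd ` R)"
    unfolding D by simp_all
  moreover have "fst ` D' = insert w (insert u (fst ` R))" "snd ` D' = insert w (insert v (snd ` R))"
    unfolding D' by (simp_all add: insert_commute)
  ultimately have "fst ` D' = insert w (fst ` D)" "snd ` D' = insert w (snd ` D)" by simp_all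
  then show "starts D' = starts D" "finishes D' = finishes D"
    using w1 w2 unfolding starts_def finishes_def by simp_all
qed

lemma apply_moveE:
  assumes "apply_move r D D'"
  obtains A Out where "disk_diagram D" "disk_diagram D'" "orientation_preserving_affine A"
    "A ` cball 0 1 \<subseteq> cball 0 1" "avoiding (A ` ball 0 1) Out"
    "D = Out \<union> place A (fst (sides r))" "D' = Out \<union> place A (snd (sides r))"
  using assms unfolding apply_move_def avoiding_def[symmetric] by (elim conjE exE) (rule that)

lemma apply_move_boundary:
  assumes "apply_move r D D'"
  shows "starts D' = starts D" "finishes D' = finishes D"
proof -
  obtain A Out where "disk_diagram D" "disk_diagram D'" and A: "orientation_preserving_affine A"
    and "A ` cball 0 1 \<subseteq> cball 0 1" and O: "avoiding (A ` ball 0 1) Out"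
    and D: "D = Out \<union> place A (fst (sides r))" "D' = Out \<union> place A (snd (sides r))"
    using assms by (rule apply_moveE)
  have "starts (place A (snd (sides r))) = starts (place A (fst (sides r)))"
    "finishes (place A (snd (sides r))) = finishes (place A (fst (sides r)))"
    unfolding boundary_place[OF A] sides_disk by (rule refl)+
  note b = boundary_replace(1,2)[OF inside_place[OF A sides_disk(1)] inside_place[OF A sides_disk(2)] this O]
  show "starts D' = starts D" "finishes D' = finishes D" unfolding D by (rule b)+
qed

lemma step_boundary:
  assumes "step S D D'"
  shows "disk_diagram D" "disk_diagram D'" "starts D' = starts D" "finishes D' = finishes D"
proof -
  have "disk_diagram D \<and> disk_diagram D' \<and> starts D' = starts D \<and> finishes D' = finishes D"
    using assms
  proof cases
    case isotopy
    then show ?thesis using isotopic_boundary[OF isotopy] by simp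
  next
    case subdivide
    then show ?thesis using subdivision_boundary[OF subdivide] unfolding subdivision_def by simp
  next
    case unsubdivide
    then show ?thesis using subdivision_boundary[OF unsubdivide] unfolding subdivision_def by simp
  next
    case (move_forward r)
    then show ?thesis using apply_move_boundary[OF move_forward(2)] unfolding apply_move_def by simp
  next
    case (move_backward r)
    then show ?thesis using apply_move_boundary[OF move_backward(2)] unfolding apply_move_def by simp
  qed
  then show "disk_diagram D" "disk_diagram D'" "starts D' = starts D" "finishes D' = finishes D" by simp_all
qed

lemma place_Un: "place A (D \<union> E) = place A D \<union> place A E"
  by (simp add: place_def image_Un)

lemma place_place: "place A (place B D) = place (A \<circ> B) D"
  unfolding place_def image_image by (intro image_cong refl) (simp add: prod_eq_iff)

context
  fixes A Out
  assumes A: "orientation_preserving_affine A" "A ` cball 0 1 \<subseteq> cball 0 1"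
    and O: "avoiding (A ` ball 0 1) Out"
begin

lemma subdivision_context:
  assumes s: "subdivision D D'" and U: "disk_diagram (Out \<union> place A D)"
  shows "subdivision (Out \<union> place A D) (Out \<union> place A D')"
proof -
  obtain u v w where d: "disk_diagram D" "disk_diagram D'" "(u, v) \<in> D" "w \<in> open_segment u v"
      "D' = D - {(u, v)} \<union> {(u, w), (w, v)}"
    using s unfolding subdivision_def by (elim conjE exE) (rule that)
  have U': "disk_diagram (Out \<union> place A D')"
    by (rule disk_replace[OF A O U d(1,2) subdivision_boundary[OF s]])
  let ?e = "(lift A u, lift A v)"
  have e: "?e = lift_edge A (u, v)" by simp
  have mem: "?e \<in> place A D" unfolding e place_eq using d(3) by (rule imageI)
  have out: "?e \<notin> Out"
  proof
    assume o: "?e \<in> Out"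
    note I = inside_place[OF A(1) d(1)]
    obtain x where x: "x \<in> open_shadow ?e"
      using open_shadow_nonempty[OF genericD(4)[OF insideD(1)[OF I] mem]] by blast
    have "open_shadow ?e \<subseteq> shadow ?e" unfolding open_shadow_def shadow_def open_segment_def by (rule Diff_subset)
    then have "x \<in> shadow ?e" using x by (rule subsetD)
    then show False using avoidingD[OF O o] subsetD[OF insideD(2)[OF I mem] x] by simp
  qed
  have w: "lift A w \<in> open_segment (lift A u) (lift A v)"
    unfolding segment_image(2)[OF lift_combination[OF A(1)] lift_inj[OF A(1)]] using d(4) by (rule imageI)
  have "place A D' = (place A D - {?e}) \<union> {(lift A u, lift A w), (lift A w, lift A v)}"
    unfolding d(5) place_eq image_Un image_set_diff[OF lift_edge_inj[OF A(1)]] by simp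
  moreover have "Out - {?e} = Out" using out by simp
  ultimately have "Out \<union> place A D' = (Out \<union> place A D) - {?e} \<union> {(lift A u, lift A w), (lift A w, lift A v)}"
    by (simp only: Un_Diff Un_assoc)
  then show ?thesis unfolding subdivision_def using U U' mem w by blast
qed

text \<open>The small disk of the move is nested in the disk of \<open>A\<close>. The placements are
  composed, and what surrounds the move is \<open>Out\<close> together with the image of the former
  surroundings.\<close>

lemma apply_move_context:
  assumes m: "apply_move r D D'" and U: "disk_diagram (Out \<union> place A D)" "disk_diagram (Out \<union> place A D')"
  shows "apply_move r (Out \<union> place A D) (Out \<union> place A D')"
proof -
  obtain B Out' where "disk_diagram D" "disk_diagram D'" and B: "orientation_preserving_affine B"
      "B ` cball 0 1 \<subseteq> cball 0 1" "avoiding (B ` ball 0 1) Out'"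
    and D: "D = Out' \<union> place B (fst (sides r))" "D' = Out' \<union> place B (snd (sides r))"
    using m by (rule apply_moveE)
  have av: "avoiding ((A \<circ> B) ` ball 0 1) (Out \<union> place A Out')"
    unfolding avoiding_def
  proof
    fix e assume "e \<in> Out \<union> place A Out'"
    then show "shadow e \<inter> (A \<circ> B) ` ball 0 1 = {}"
    proof
      assume "e \<in> Out"
      then have "shadow e \<inter> A ` ball 0 1 = {}" using O unfolding avoiding_def by simp
      moreover have "(A \<circ> B) ` ball 0 1 \<subseteq> A ` ball 0 1"
        unfolding image_comp[symmetric] by (intro image_mono ball_image[OF B(1,2)])
      ultimately show ?thesis by blast
    next
      assume "e \<in> place A Out'"
      then obtain f where f: "f \<in> Out'" "e = lift_edge A f" using iffD1[OF mem_place] by metis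
      have "shadow f \<inter> B ` ball 0 1 = {}" using B(3) f(1) unfolding avoiding_def by simp
      then show ?thesis
        unfolding f(2) shadow_lift[OF A(1)] image_comp[symmetric] image_Int[OF affine_inj[OF A(1)], symmetric] by simp
    qed
  qed
  have sub: "(A \<circ> B) ` cball 0 1 \<subseteq> cball 0 1"
    unfolding image_comp[symmetric] by (rule order_trans[OF image_mono[OF B(2)] A(2)])
  have e: "Out \<union> place A D = (Out \<union> place A Out') \<union> place (A \<circ> B) (fst (sides r))"
    "Out \<union> place A D' = (Out \<union> place A Out') \<union> place (A \<circ> B) (snd (sides r))"
    unfolding D place_Un place_place by (simp_all only: Un_assoc)
  show ?thesis unfolding apply_move_def
    using U affine_compose[OF A(1) B(1)] sub av[unfolded avoiding_def] e by (intro conjI exI)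
qed

lemma step_context:
  assumes s: "step S D D'" and U: "disk_diagram (Out \<union> place A D)"
  shows "step S (Out \<union> place A D) (Out \<union> place A D')" "disk_diagram (Out \<union> place A D')"
proof -
  note b = step_boundary[OF s]
  show U': "disk_diagram (Out \<union> place A D')" by (rule disk_replace[OF A O U b])
  from s show "step S (Out \<union> place A D) (Out \<union> place A D')"
  proof cases
    case isotopy
    show ?thesis by (rule step.isotopy[OF isotopic_context[OF A O U isotopy]])
  next
    case subdivide
    show ?thesis by (rule step.subdivide[OF subdivision_context[OF subdivide U]])
  next
    case unsubdivide
    show ?thesis by (rule step.unsubdivide[OF subdivision_context[OF unsubdivide U']])
  next
    case (move_forward r)
    show ?thesis by (rule step.move_forward[OF move_forward(1) apply_move_context[OF move_forward(2) U U']])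
  next
    case (move_backward r)
    show ?thesis by (rule step.move_backward[OF move_backward(1) apply_move_context[OF move_backward(2) U' U]])
  qed
qed

lemma steps_context:
  assumes "(step S)\<^sup>*\<^sup>* D D'" and U: "disk_diagram (Out \<union> place A D)"
  shows "(step S)\<^sup>*\<^sup>* (Out \<union> place A D) (Out \<union> place A D') \<and> disk_diagram (Out \<union> place A D')"
  using assms(1)
proof (induction rule: rtranclp_induct)
  case base
  show ?case using U by simp
next
  case (step D1 D2)
  note c = step_context[OF step(2) conjunct2[OF step.IH]]
  show ?case using rtranclp.rtrancl_into_rtrancl[OF conjunct1[OF step.IH] c(1)] c(2) by simp
qed

end

section \<open>Placements with integer coefficients\<close>

fun affine_map :: "affine \<Rightarrow> real \<times> real \<Rightarrow> real \<times> real" where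
  "affine_map (a, b, c, d, r, s) (x, y) =
     ((of_int a * x + of_int b * y + of_int r) / 1000, (of_int c * x + of_int d * y + of_int s) / 1000)"

lemma small_affine:
  assumes "small A"
  shows "orientation_preserving_affine (affine_map A)" "affine_map A ` cball 0 1 \<subseteq> cball 0 1"
proof -
  obtain a b c d r s where A: "A = (a, b, c, d, r, s)" by (cases A)
  have 1: "0 < a * d - b * c" and 2: "2 * (a * a + b * b + c * c + d * d + r * r + s * s) \<le> 1000000"
    using assms unfolding A by simp_all
  have "0 < (of_int (a * d - b * c) :: real)" using 1 by (simp only: of_int_0_less_iff)
  then have "0 < (of_int a / 1000) * (of_int d / 1000) - (of_int b / 1000) * (of_int c / 1000 :: real)" by simp
  moreover have "affine_map A = (\<lambda>(x, y). (of_int a / 1000 * x + of_int b / 1000 * y + of_int r / 1000,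
      of_int c / 1000 * x + of_int d / 1000 * y + of_int s / 1000))"
    unfolding A by (simp add: fun_eq_iff add_divide_distrib)
  ultimately show "orientation_preserving_affine (affine_map A)"
    unfolding orientation_preserving_affine_def by blast
  show "affine_map A ` cball 0 1 \<subseteq> cball 0 1"
  proof
    fix z assume "z \<in> affine_map A ` cball 0 1"
    then obtain x y where xy: "(x, y) \<in> cball 0 1" "z = affine_map A (x, y)" by (metis imageE surj_pair)
    have "(norm (x, y))\<^sup>2 \<le> 1" using xy(1) by (simp add: power_le_one)
    then have n: "x * x + y * y \<le> 1" by (simp add: norm_Pair power2_eq_square)
    define X where "X = of_int a * x + of_int b * y"
    define Y where "Y = of_int c * x + of_int d * y"
    \<comment> \<open>Cauchy-Schwarz for each row of the matrix, from Lagrange's identity.\<close>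
    have cs: "(\<alpha> * x + \<beta> * y) * (\<alpha> * x + \<beta> * y) \<le> \<alpha> * \<alpha> + \<beta> * \<beta>" for \<alpha> \<beta> :: real
    proof -
      have "(\<alpha> * x + \<beta> * y) * (\<alpha> * x + \<beta> * y) + (\<alpha> * y - \<beta> * x) * (\<alpha> * y - \<beta> * x) = (\<alpha> * \<alpha> + \<beta> * \<beta>) * (x * x + y * y)"
        by algebra
      also have "\<dots> \<le> (\<alpha> * \<alpha> + \<beta> * \<beta>) * 1" using n by (intro mult_left_mono) simp_all
      finally have "(\<alpha> * x + \<beta> * y) * (\<alpha> * x + \<beta> * y) + (\<alpha> * y - \<beta> * x) * (\<alpha> * y - \<beta> * x) \<le> \<alpha> * \<alpha> + \<beta> * \<beta>"
        by (simp only: mult_1_right)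
      then show ?thesis by (rule order_trans[rotated]) (simp only: le_add_same_cancel1 zero_le_square)
    qed
    \<comment> \<open>The parallelogram law bounds the square of a sum by twice the sum of the
      squares; this is the factor 2 in \<open>small\<close>.\<close>
    have "(X + of_int r) * (X + of_int r) + (X - of_int r) * (X - of_int r) = 2 * (X * X + of_int r * of_int r)"
      "(Y + of_int s) * (Y + of_int s) + (Y - of_int s) * (Y - of_int s) = 2 * (Y * Y + of_int s * of_int s)"
      by algebra+
    moreover have "X * X \<le> of_int a * of_int a + of_int b * of_int b"
        "Y * Y \<le> of_int c * of_int c + of_int d * of_int d"
      unfolding X_def Y_def by (rule cs)+
    moreover have "2 * (of_int a * of_int a + of_int b * of_int b + of_int c * of_int c + of_int d * of_int d +
       of_int r * of_int r + of_int s * of_int s) \<le> (1000000 :: real)"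
      using 2 by (metis (mono_tags, lifting) of_int_add of_int_le_iff of_int_mult of_int_numeral)
    ultimately have "(X + of_int r) * (X + of_int r) + (Y + of_int s) * (Y + of_int s) \<le> 1000000"
      using zero_le_square[of "X - of_int r"] zero_le_square[of "Y - of_int s"] by (smt (verit))
    then have "((X + of_int r) / 1000)\<^sup>2 + ((Y + of_int s) / 1000)\<^sup>2 \<le> 1" by (simp add: power2_eq_square)
    then show "z \<in> cball 0 1" unfolding xy(2) A by (simp add: norm_Pair X_def Y_def power_divide)
  qed
qed

section \<open>Certificates\<close>

lemma lift_vert:
  assumes "exact A p" shows "lift (affine_map A) (vert p) = vert (carry A p)"
proof -
  obtain a b c d r s where A: "A = (a, b, c, d, r, s)" by (cases A)
  obtain x y h where p: "p = (x, y, h)" by (cases p)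
  have "(a * x + b * y) mod 1000 = 0" "(c * x + d * y) mod 1000 = 0"
    using assms unfolding A p by simp_all
  moreover have k: "1000 * (k div 1000) = k" if "k mod 1000 = 0" for k :: int
    using mult_div_mod_eq[of 1000 k] that by simp
  ultimately have "1000 * ((a * x + b * y) div 1000) = a * x + b * y"
      "1000 * ((c * x + d * y) div 1000) = c * x + d * y"
    by (simp_all only: k)
  then have "real_of_int (1000 * ((a * x + b * y) div 1000)) = real_of_int (a * x + b * y)"
    "real_of_int (1000 * ((c * x + d * y) div 1000)) = real_of_int (c * x + d * y)" by simp_all
  then show ?thesis unfolding A p lift_def by (simp add: field_simps)
qed

lemma diag_image:
  assumes "list_all (\<lambda>(u, v). exact A u \<and> exact A v) es"
  shows "diag (carry_edges A es) = place (affine_map A) (diag es)"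
proof -
  have "arc (carry A (fst e), carry A (snd e)) = lift_edge (affine_map A) (arc e)" if "e \<in> set es" for e
  proof -
    have "exact A (fst e)" "exact A (snd e)" using assms that unfolding list_all_iff
        by (simp_all add: case_prod_unfold)
    then show ?thesis by (simp add: lift_vert prod_eq_iff del: fst_lift)
  qed
  then show ?thesis
    unfolding diag_def carry_edges_def[of A es] place_eq set_map image_image
        by (intro image_cong refl) (simp add: case_prod_unfold)
qed

text \<open>Three ways to bound the distance from the origin below. If
  \<open>U \<bullet> U \<le> U \<bullet> V\<close>, the segment leads away from the origin when it
  starts at \<open>U\<close>; the same holds at \<open>V\<close>. Otherwise the whole line is far
  enough, its distance being the absolute value of the cross product of \<open>U\<close> and
  \<open>V\<close> divided by the length of \<open>D\<close>.\<close>

lemma outside_disk: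
  fixes U V D :: "real \<times> real" and n t :: real
  assumes t: "0 \<le> t" "t \<le> 1" and D: "D = V - U" "D \<noteq> 0" and n: "0 \<le> n"
    and c: "n * n \<le> U \<bullet> U \<and> U \<bullet> U \<le> U \<bullet> V \<or> n * n \<le> V \<bullet> V \<and> V \<bullet> V \<le> U \<bullet> V \<or>
      n * n * (D \<bullet> D) \<le> (fst U * snd V - snd U * fst V) * (fst U * snd V - snd U * fst V)"
  shows "n * n \<le> ((1 - t) *\<^sub>R U + t *\<^sub>R V) \<bullet> ((1 - t) *\<^sub>R U + t *\<^sub>R V)"
proof -
  define W where "W = (1 - t) *\<^sub>R U + t *\<^sub>R V"
  have "n * n \<le> W \<bullet> W"
    using c
  proof (elim disjE conjE)
    assume a: "n * n \<le> U \<bullet> U" "U \<bullet> U \<le> U \<bullet> V"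
    have "W \<bullet> W = U \<bullet> U + 2 * t * (U \<bullet> V - U \<bullet> U) + t * t * (D \<bullet> D)"
      unfolding W_def D by (simp add: inner_simps inner_commute algebra_simps)
    moreover have "0 \<le> 2 * t * (U \<bullet> V - U \<bullet> U)" "0 \<le> t * t * (D \<bullet> D)" using a t by simp_all
    ultimately show ?thesis using a(1) by linarith
  next
    assume a: "n * n \<le> V \<bullet> V" "V \<bullet> V \<le> U \<bullet> V"
    have "W \<bullet> W = V \<bullet> V + 2 * (1 - t) * (U \<bullet> V - V \<bullet> V) + (1 - t) * (1 - t) * (D \<bullet> D)"
      unfolding W_def D by (simp add: inner_simps inner_commute algebra_simps)
    moreover have "0 \<le> 2 * (1 - t) * (U \<bullet> V - V \<bullet> V)" "0 \<le> (1 - t) * (1 - t) * (D \<bullet> D)" using a t by simp_all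
    ultimately show ?thesis using a(1) by linarith
  next
    assume a: "n * n * (D \<bullet> D) \<le> (fst U * snd V - snd U * fst V) * (fst U * snd V - snd U * fst V)"
    have x: "fst U * snd V - snd U * fst V = fst W * snd D - snd W * fst D"
      unfolding W_def D by (simp add: algebra_simps)
    have "(fst W * snd D - snd W * fst D) * (fst W * snd D - snd W * fst D) + (W \<bullet> D) * (W \<bullet> D) = (W \<bullet> W) * (D \<bullet> D)"
      by (simp add: inner_prod_def algebra_simps)
    then have "(fst W * snd D - snd W * fst D) * (fst W * snd D - snd W * fst D) \<le> (W \<bullet> W) * (D \<bullet> D)"
      using zero_le_square[of "W \<bullet> D"] by linarith
    then have "n * n * (D \<bullet> D) \<le> (W \<bullet> W) * (D \<bullet> D)" using a unfolding x by linarith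
    moreover have "0 < D \<bullet> D" using D(2) by simp
    ultimately show ?thesis by (simp only: mult_le_cancel_right_pos)
  qed
  then show ?thesis unfolding W_def .
qed

text \<open>The real form of \<open>pull\<close>. In these coordinates the elliptical image of the
  disk becomes a round disk around the origin, while segments remain segments.\<close>

definition pull_back :: "affine \<Rightarrow> real \<times> real \<Rightarrow> real \<times> real" where
  "pull_back A z = (case A of (a, b, c, d, r, s) \<Rightarrow>
     (of_int d * (1000 * fst z - of_int r) - of_int b * (1000 * snd z - of_int s),
      of_int a * (1000 * snd z - of_int s) - of_int c * (1000 * fst z - of_int r)))"

lemma pull_back_affine_map: "pull_back A (affine_map A z) = of_int (area A) *\<^sub>R z"
  by (cases A; cases z) (simp add: pull_back_def field_simps)

lemma pull_back_shade: "pull_back A (shade p) = (of_int (fst (pull A p)), of_int (snd (pull A p)))"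
  by (cases A; cases p) (simp add: pull_back_def)

lemma pull_back_convex: "pull_back A ((1 - t) *\<^sub>R x + t *\<^sub>R y) = (1 - t) *\<^sub>R pull_back A x + t *\<^sub>R pull_back A y"
  by (cases A) (simp add: pull_back_def algebra_simps)

lemma pull_back_inj:
  assumes "0 < area A" "pull_back A x = pull_back A y" shows "x = y"
proof -
  obtain a b c d r s where A: "A = (a, b, c, d, r, s)" by (cases A)
  have n: "0 < (of_int a * of_int d - of_int b * of_int c :: real)"
    using assms(1) unfolding A by (simp only: area.simps of_int_mult[symmetric] of_int_diff[symmetric]
        of_int_0_less_iff)
  have "of_int d * (fst x - fst y) - of_int b * (snd x - snd y) = 0"
      "of_int a * (snd x - snd y) - of_int c * (fst x - fst y) = 0"
    using assms(2) unfolding A pull_back_def by (simp_all add: algebra_simps)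
  then have "(of_int a * of_int d - of_int b * of_int c) * (fst x - fst y) = 0"
    "(of_int a * of_int d - of_int b * of_int c) * (snd x - snd y) = 0"
    by algebra+
  then show ?thesis using n by (simp add: prod_eq_iff)
qed

lemma avoids_sound:
  assumes A: "small A" and a: "avoids (area A) (pull A u) (pull A v)" and uv: "shade u \<noteq> shade v"
  shows "shadow (arc (u, v)) \<inter> affine_map A ` ball 0 1 = {}"
proof -
  have n: "0 < area A" using A by (cases A) simp
  define U where "U = pull_back A (shade u)"
  define V where "V = pull_back A (shade v)"
  have D: "V - U \<noteq> 0" unfolding U_def V_def using pull_back_inj[OF n] uv by (metis eq_iff_diff_eq_0)
  obtain x y x' y' where p: "pull A u = (x, y)" "pull A v = (x', y')" by (metis surj_pair)
  have UV: "U = (of_int x, of_int y)" "V = (of_int x', of_int y')"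
    unfolding U_def V_def pull_back_shade p by simp_all
  let ?n = "area A"
  have "?n * ?n \<le> x * x + y * y \<and> x * x + y * y \<le> x * x' + y * y' \<or>
      ?n * ?n \<le> x' * x' + y' * y' \<and> x' * x' + y' * y' \<le> x * x' + y * y' \<or>
      ?n * ?n * ((x' - x) * (x' - x) + (y' - y) * (y' - y)) \<le> (x * y' - y * x') * (x * y' - y * x')"
    using a unfolding p by (simp split: if_splits)
  then have "(of_int (?n * ?n) :: real) \<le> of_int (x * x + y * y) \<and> (of_int (x * x + y * y) :: real) \<le> of_int (x
      * x' + y * y') \<or>
      (of_int (?n * ?n) :: real) \<le> of_int (x' * x' + y' * y') \<and> (of_int (x' * x' + y' * y') :: real) \<le> of_int (x
          * x' + y * y') \<or>
      (of_int (?n * ?n * ((x' - x) * (x' - x) + (y' - y) * (y' - y))) :: real) \<le> of_int ((x * y' - y * x') * (x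
          * y' - y * x'))"
    unfolding of_int_le_iff .
  then have c: "of_int ?n * of_int ?n \<le> U \<bullet> U \<and> U \<bullet> U \<le> U \<bullet> V \<or> of_int ?n * of_int ?n \<le> V \<bullet> V \<and> V \<bullet> V \<le> U \<bullet> V \<or>
      of_int ?n * of_int ?n * ((V - U) \<bullet> (V - U)) \<le> (fst U * snd V - snd U * fst V) * (fst U * snd V - snd U * fst V)"
    unfolding UV by simp
  have False if z: "z \<in> ball 0 1" "affine_map A z \<in> closed_segment (shade u) (shade v)" for z
  proof -
    obtain t where t: "0 \<le> t" "t \<le> 1" "affine_map A z = (1 - t) *\<^sub>R shade u + t *\<^sub>R shade v"
      using z(2) unfolding closed_segment_def by blast
    have "of_int ?n *\<^sub>R z = (1 - t) *\<^sub>R U + t *\<^sub>R V"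
      unfolding pull_back_affine_map[symmetric] t(3) pull_back_convex U_def V_def ..
    then have "of_int ?n * of_int ?n \<le> (of_int ?n *\<^sub>R z) \<bullet> (of_int ?n *\<^sub>R z)"
      using outside_disk[OF t(1,2) refl D _ c] n by simp
    also have "\<dots> = (of_int ?n * of_int ?n) * (z \<bullet> z)" by simp
    finally have "of_int ?n * of_int ?n * 1 \<le> (of_int ?n * of_int ?n) * (z \<bullet> z)" by simp
    moreover have "0 < (of_int ?n * of_int ?n :: real)" using n by simp
    ultimately have "1 \<le> z \<bullet> z" by (simp only: mult_le_cancel_left_pos)
    moreover have "z \<bullet> z < 1" using z(1) by (simp add: dot_square_norm abs_square_less_1)
    ultimately show False by simp
  qed
  then show ?thesis unfolding shadow_def by auto
qed

text \<open>The notion \<open>realizes\<close> for arbitrary pictures, so that triangles with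
  another bent strand can take part. The condition on the first side supports the induction along a
  script and also covers the empty sequence of steps.\<close>

definition realizable :: "move set \<Rightarrow> picture \<Rightarrow> bool" where
  "realizable S P \<longleftrightarrow> disk_diagram (diag (fst P)) \<and> (step S)\<^sup>*\<^sup>* (diag (fst P)) (diag (snd P))"

section \<open>Soundness of scripts\<close>

lemma steps_disk:
  assumes "(step S)\<^sup>*\<^sup>* D D'" "disk_diagram D" shows "disk_diagram D'"
  using assms by (induction rule: rtranclp_induct) (auto dest: step_boundary(2))

lemma substitute_sound:
  assumes s: "substitute L R A es = Some es'" and D: "disk_diagram (diag es)"
    and L: "disk_diagram (diag L)" "(step S)\<^sup>*\<^sup>* (diag L) (diag R)"
  shows "(step S)\<^sup>*\<^sup>* (diag es) (diag es') \<and> disk_diagram (diag es')"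
proof -
  have c: "small A" "list_all (\<lambda>(u, v). exact A u \<and> exact A v) (L @ R)" "list_all (List.member es) (carry_edges A L)"
    "list_all (\<lambda>(u, v). avoids (area A) (pull A u) (pull A v)) (outer A L es)" "es' = carry_edges A R @ outer A L es"
    using s unfolding substitute_def by (simp_all split: if_split_asm)
  have LR: "diag (carry_edges A L) = place (affine_map A) (diag L)"
      "diag (carry_edges A R) = place (affine_map A) (diag R)"
    using c(2) diag_image unfolding list_all_append by blast+
  have "set es = set (outer A L es) \<union> set (carry_edges A L)"
    using c(3) unfolding outer_def list_all_iff List.member_iff set_filter by blast
  then have "diag es = diag (outer A L es) \<union> diag (carry_edges A L)" by (simp only: diag_def image_Un)
  then have es: "diag es = diag (outer A L es) \<union> place (affine_map A) (diag L)" unfolding LR .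
  have es': "diag es' = diag (outer A L es) \<union> place (affine_map A) (diag R)"
    unfolding c(5) diag_append LR by (rule Un_commute)
  have "avoiding (affine_map A ` ball 0 1) (diag (outer A L es))"
    unfolding avoiding_def
  proof
    fix e assume "e \<in> diag (outer A L es)"
    then obtain f where f: "f \<in> set (outer A L es)" "e = arc f" unfolding diag_def by (metis imageE)
    obtain u v where uv: "f = (u, v)" by (cases f)
    have "e \<in> diag es" using f(1) unfolding f(2) outer_def diag_def by simp
    from genericD(4)[OF disk_diagramD(1)[OF D] this] have "shade u \<noteq> shade v"
      unfolding f(2) uv map_prod_simp fst_conv snd_conv .
    moreover have "avoids (area A) (pull A u) (pull A v)"
      using bspec[OF c(4)[unfolded list_all_iff] f(1)] unfolding uv prod.case .
    ultimately show "shadow e \<inter> affine_map A ` ball 0 1 = {}" unfolding f(2) uv by (intro avoids_sound[OF c(1)])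
  qed
  from steps_context[OF small_affine[OF c(1)] this L(2) D[unfolded es]] show ?thesis unfolding es es' .
qed

fun legal :: "move set \<Rightarrow> edit \<Rightarrow> bool" where
  "legal S (Forward P A) = realizable S P"
| "legal S (Backward P A) = realizable S P"
| "legal S e = True"

lemma exec_sound:
  assumes e: "exec e es = Some es'" and D: "disk_diagram (diag es)" and l: "legal S e"
  shows "(step S)\<^sup>*\<^sup>* (diag es) (diag es') \<and> disk_diagram (diag es')"
proof (cases e)
  case (Slide p q)
  then show ?thesis using exec_slide e D by blast
next
  case (Insert u v m w)
  then show ?thesis using exec_insert e D by blast
next
  case (Delete p m)
  then show ?thesis using exec_delete e D by blast
next
  case (Forward P A)
  then have "substitute (fst P) (snd P) A es = Some es'" "realizable S P" using e l by simp_all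
  then show ?thesis using substitute_sound D unfolding realizable_def by blast
next
  case (Backward P A)
  then have s: "substitute (snd P) (fst P) A es = Some es'" "realizable S P" using e l by simp_all
  then show ?thesis
    using substitute_sound[OF s(1) D steps_disk steps_sym] unfolding realizable_def by blast
qed

lemma run_sound:
  assumes "run ss es = Some es'" "disk_diagram (diag es)" "list_all (legal S) ss"
  shows "(step S)\<^sup>*\<^sup>* (diag es) (diag es')"
  using assms
proof (induction ss arbitrary: es)
  case (Cons s ss)
  obtain es1 where 1: "exec s es = Some es1" "run ss es1 = Some es'"
    using Cons.prems(1) unfolding run.simps by (simp split: option.split_asm)
  have l: "legal S s" "list_all (legal S) ss" using Cons.prems(3) by simp_all
  note x = exec_sound[OF 1(1) Cons.prems(2) l(1)]
  show ?case using rtranclp_trans[OF conjunct1[OF x] Cons.IH[OF 1(2) conjunct2[OF x] l(2)]] .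
qed simp

text \<open>Edits permute the list of edges, so the result is compared with the target as a
  set.\<close>

definition certifies :: "edit list \<Rightarrow> picture \<Rightarrow> bool" where
  "certifies ss P = (case run ss (fst P) of None \<Rightarrow> False
     | Some es \<Rightarrow> list_all (List.member (snd P)) es \<and> list_all (List.member es) (snd P))"

lemma certified:
  assumes "certifies ss P" "proper P" "list_all (legal S) ss"
  shows "realizable S P"
proof -
  obtain es where es: "run ss (fst P) = Some es" "list_all (List.member (snd P)) es"
      "list_all (List.member es) (snd P)"
    using assms(1) unfolding certifies_def by (auto split: option.splits)
  have D: "disk_diagram (diag (fst P))" using assms(2) disk_diagram_diag unfolding proper_def by blast
  have "set es = set (snd P)" using es(2,3) unfolding list_all_iff List.member_iff by blast
  then have "diag es = diag (snd P)" by (simp only: diag_def)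
  then show ?thesis using run_sound[OF es(1) D assms(3)] D unfolding realizable_def by simp
qed

lemma place_id: "place id D = D"
  by (simp add: place_def prod.map_id0)

lemma generator_realizable:
  assumes "r \<in> S" shows "realizable S (pic r)"
proof -
  have "apply_move r (fst (sides r)) (snd (sides r))"
    unfolding apply_move_def
  proof (intro conjI exI)
    show "orientation_preserving_affine id" unfolding orientation_preserving_affine_def
      by (intro exI[of _ 1] exI[of _ 0] conjI) (auto simp: fun_eq_iff)
    show "fst (sides r) = {} \<union> place id (fst (sides r))" "snd (sides r) = {} \<union> place id (snd (sides r))"
      by (simp_all add: place_id)
  qed (simp_all add: sides_disk)
  then have "step S (fst (sides r)) (snd (sides r))" by (rule step.move_forward[OF assms])
  then show ?thesis using sides_disk(1)[of r] unfolding realizable_def sides_pic by blast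
qed

lemma realizes_iff: "realizes S r \<longleftrightarrow> realizable S (pic r)"
  unfolding realizes_def realizable_def sides_pic[symmetric] using sides_disk(1) by simp

text \<open>
  \<open>bottom_x\<close> and \<open>middle_x\<close> are pictures of \<open>\<Omega>3x\<close> in which the bottom or the middle strand is the bent one.
\<close>

definition bottom_a :: picture where
  "bottom_a = triangle_pic 0 False 1000 True (-1000)"

definition middle_a :: picture where
  "middle_a = triangle_pic 1000 False (-1000) True 0"

definition bottom_b :: picture where
  "bottom_b = triangle_pic 1000 False 0 False (-1000)"

definition middle_b :: picture where
  "middle_b = triangle_pic (-1000) True 1000 False 0"

definition bottom_c :: picture where
  "bottom_c = triangle_pic 1000 True 0 False (-1000)"

definition bottom_d :: picture where
  "bottom_d = triangle_pic 0 True 1000 False (-1000)"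

definition bottom_e :: picture where
  "bottom_e = triangle_pic 0 False 1000 False (-1000)"

definition bottom_h :: picture where
  "bottom_h = triangle_pic 1000 False 0 True (-1000)"

lemma proper_bent: "proper bottom_a" "proper middle_a" "proper bottom_b" "proper middle_b" "proper bottom_c"
    "proper bottom_d" "proper bottom_e" "proper bottom_h"
  by code_simp+

text \<open>
  The strand is bent into an arch; a bigon between the two legs makes the top of the arch a kink, whose removal
  leaves a kink with the opposite crossing and the opposite sense of rotation.
\<close>

definition opposite_kink :: "int \<Rightarrow> edit \<Rightarrow> edit \<Rightarrow> edit list" where
  "opposite_kink h e1 e2 =
    [Insert (-1000, 0, 0) (1000, 0, 0) (0, 0, 0) (0, 400, 0),
     Insert (-1000, 0, 0) (0, 400, 0) (-500, 200, 0) (-180, 240, h),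
     Insert (0, 400, 0) (1000, 0, 0) (500, 200, 0) (180, 240, - h),
     Insert (180, 240, - h) (1000, 0, 0) (590, 120, (- h) div 2) (150, 0, - h),
     Insert (-1000, 0, 0) (-180, 240, h) (-590, 120, h div 2) (-180, -240, h),
     Insert (-180, -240, h) (-180, 240, h) (-180, 0, h) (-150, 0, h),
     Insert (150, 0, - h) (1000, 0, 0) (575, 0, (- h) div 2) (180, -240, - h), e1,
     Insert (-180, -240, h) (150, 0, h) (40, -80, h) (120, -80, h),
     Insert (-150, 0, - h) (180, -240, - h) (15, -120, - h) (-120, -80, - h),
     Slide (180, 240, - h) (100, 100, - h), Slide (-180, -240, h) (-240, -400, h),
     Slide (150, 0, h) (200, 0, 0), Slide (-150, 0, - h) (-200, 0, 0), Slide (180, -240, - h) (240, -400, - h),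
     Slide (-180, 240, h) (-100, 100, h), Slide (120, -80, h) (240, -240, h), Delete (0, 400, 0) (0, 100, 0),
     Slide (-120, -80, - h) (-240, -240, - h), e2, Delete (-240, -240, - h) (20, -200, (- h) div 2),
     Delete (-240, -400, h) (-380, -120, h div 2), Slide (-200, 0, 0) (-500, 500, - h),
     Delete (240, -240, h) (0, 0, 0), Slide (200, 0, 0) (500, 500, h),
     Delete (240, -400, - h) (250, 250, (- h) div 2)]"

text \<open>The legs of the arch are vertical, hence the quarter turn of the bigon, scaled by 3/10.
  The loop at the top is traversed from right to left, hence the half turn of the kink that is
  removed. The reflection makes the resulting loop clockwise.\<close>

lemma realize_1a_from_1d_2d:
  assumes "realizable S (pic \<Omega>1d)" "realizable S (pic \<Omega>2d)"
  shows "realizable S (pic \<Omega>1a)"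
proof (rule certified)
  show "certifies
    (map (reflect 1 (-1)) (opposite_kink 1000
      (Forward (pic \<Omega>2d) (0, 300, -300, 0, 0, 0))
      (Backward (pic \<Omega>1d) (-200, 0, 0, -200, 0, 0))))
    (pic \<Omega>1a)"
    by code_simp
qed (simp_all add: assms proper_pic proper_bent opposite_kink_def del: pic.simps)

lemma realize_1b_from_1c_2c:
  assumes "realizable S (pic \<Omega>1c)" "realizable S (pic \<Omega>2c)"
  shows "realizable S (pic \<Omega>1b)"
proof (rule certified)
  show "certifies
    (opposite_kink (-1000)
      (Forward (pic \<Omega>2c) (0, -300, 300, 0, 0, 0))
      (Backward (pic \<Omega>1c) (-200, 0, 0, -200, 0, 0)))
    (pic \<Omega>1b)"
    by code_simp
qed (simp_all add: assms proper_pic proper_bent opposite_kink_def del: pic.simps)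

lemma realize_1c_from_1b_2d:
  assumes "realizable S (pic \<Omega>1b)" "realizable S (pic \<Omega>2d)"
  shows "realizable S (pic \<Omega>1c)"
proof (rule certified)
  show "certifies
    (map (reflect 1 (-1)) (opposite_kink (-1000)
      (Forward (pic \<Omega>2d) (0, -300, 300, 0, 0, 0))
      (Backward (pic \<Omega>1b) (-200, 0, 0, -200, 0, 0))))
    (pic \<Omega>1c)"
    by code_simp
qed (simp_all add: assms proper_pic proper_bent opposite_kink_def del: pic.simps)

lemma realize_1d_from_1a_2c:
  assumes "realizable S (pic \<Omega>1a)" "realizable S (pic \<Omega>2c)"
  shows "realizable S (pic \<Omega>1d)"
proof (rule certified)
  show "certifies
    (opposite_kink 1000
      (Forward (pic \<Omega>2c) (0, 300, -300, 0, 0, 0))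
      (Backward (pic \<Omega>1a) (-200, 0, 0, -200, 0, 0)))
    (pic \<Omega>1d)"
    by code_simp
qed (simp_all add: assms proper_pic proper_bent opposite_kink_def del: pic.simps)

text \<open>
  The upper strand gets a kink towards the lower strand, so that the far side of its loop runs in the opposite direction.
  The lower strand is pushed over or under that side, then past the crossing of the kink, and the kink is removed.
  The lower strand has height \<open>h\<close> and the upper one height \<open>- h\<close>; at the crossing of the kink the latter
  has the heights \<open>i\<close> and \<open>j\<close>, and \<open>k\<close> is positive iff \<open>i > j\<close>.
\<close>

definition reverse_strand :: "int \<Rightarrow> int \<Rightarrow> int \<Rightarrow> int \<Rightarrow> edit \<Rightarrow> edit \<Rightarrow> edit \<Rightarrow> edit \<Rightarrow> edit list" where
  "reverse_strand h k i j e1 e2 e3 e4 =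
    [Insert (-800, 600, - h) (0, 500, - h) (-400, 550, - h) (-200, 400, 0),
     Insert (0, 500, - h) (800, 600, - h) (400, 550, - h) (200, 400, 0), Delete (0, 500, - h) (0, 400, 0), e1,
     Slide (100, 300, k) (300, 100, k), Slide (-100, 300, - k) (-300, 100, - k),
     Insert (300, 100, k) (-300, 100, - k) (0, 100, 0) (-160, -40, - h),
     Insert (300, 100, k) (-160, -40, - h) (70, 30, (k - h) div 2) (0, -50, - h),
     Slide (0, -500, h) (0, -150, h),
     Insert (300, 100, k) (0, -50, - h) (150, 25, (k - h) div 2) (160, -40, - h),
     Insert (-800, -600, h) (0, -150, h) (-400, -375, h) (-160, -160, h),
     Insert (0, -150, h) (800, -600, h) (400, -375, h) (160, -160, h), e2,
     Delete (160, -40, - h) (150, -25, (k - h) div 2), Delete (-160, -40, - h) (-150, -25, (- h - k) div 2),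
     Insert (300, 100, k) (0, -150, - h) (54, -105, (9 * k - 41 * h) div 50) (60, -120, i),
     Slide (-200, 400, 0) (-240, 400, i), Slide (200, 400, 0) (240, 400, j),
     Insert (0, -150, - h) (-300, 100, - k) (-48, -110, (- 21 * h - 4 * k) div 25) (-60, -120, j),
     Slide (-160, -160, h) (-400, 0, h), Slide (240, 400, j) (240, 240, j),
     Slide (0, -150, - h) (0, -400, - h), Slide (-240, 400, i) (-240, 240, i),
     Slide (160, -160, h) (400, 0, h), Slide (60, -120, i) (240, -240, i), Delete (-300, 100, - k) (90, 60, j),
     Delete (300, 100, k) (40, -40, i), Slide (-60, -120, j) (-240, -240, j), Slide (0, -50, h) (0, -150, h),
     e3, Delete (-400, 0, h) (-400, -225, h), Delete (400, 0, h) (400, -225, h), Slide (0, 150, h) (0, 500, h),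
     Insert (-240, 240, i) (240, -240, i) (-80, 80, i) (-100, 100, 0),
     Insert (-240, -240, j) (240, 240, j) (80, 80, j) (100, 100, 0), Slide (-240, -240, j) (-100, -250, - k),
     Slide (100, 100, 0) (200, -150, 0), Slide (240, -240, i) (100, -250, k),
     Delete (240, 240, j) (500, 225, (- h) div 2), Slide (-100, 100, 0) (-200, -150, 0),
     Delete (-240, 240, i) (-500, 225, (- h) div 2), Delete (0, -400, - h) (0, -250, 0), e4,
     Delete (200, -150, 0) (132, 99, (- 83 * h) div 250), Slide (-200, -150, 0) (0, -500, - h)]"

text \<open>The small kink hangs at height 400; the flat bigon lies on the far side of the widened
  loop; the triangle surrounds the crossing of the loop at the origin; the second kink is the loop,
  pulled below that crossing by then. The crossing of the kink is that of the middle and the bottom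
  strand, and its sign is + as in \<open>\<Omega>3e\<close>.\<close>

lemma realize_2b_from_1a_2d_3e:
  assumes "realizable S (pic \<Omega>1a)" "realizable S (pic \<Omega>2d)" "realizable S (pic \<Omega>3e)"
  shows "realizable S (pic \<Omega>2b)"
proof (rule certified)
  show "certifies
    (reverse_strand 1000 1000 0 (-1000)
      (Forward (pic \<Omega>1a) (200, 0, 0, 200, 0, 400))
      (Forward (pic \<Omega>2d) (200, 0, 0, 100, 0, -100))
      (Forward (pic \<Omega>3e) (400, 0, 0, 300, 0, 0))
      (Backward (pic \<Omega>1a) (200, 0, 0, 200, 0, -150)))
    (pic \<Omega>2b)"
    by code_simp
qed (simp_all add: assms proper_pic proper_bent reverse_strand_def del: pic.simps)

lemma realize_2b_from_1c_2d_3f: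
  assumes "realizable S (pic \<Omega>1c)" "realizable S (pic \<Omega>2d)" "realizable S (pic \<Omega>3f)"
  shows "realizable S (pic \<Omega>2b)"
proof (rule certified)
  show "certifies
    (reverse_strand 1000 (-1000) (-1000) 0
      (Forward (pic \<Omega>1c) (200, 0, 0, 200, 0, 400))
      (Forward (pic \<Omega>2d) (200, 0, 0, 100, 0, -100))
      (Forward (pic \<Omega>3f) (400, 0, 0, 300, 0, 0))
      (Backward (pic \<Omega>1c) (200, 0, 0, 200, 0, -150)))
    (pic \<Omega>2b)"
    by code_simp
qed (simp_all add: assms proper_pic proper_bent reverse_strand_def del: pic.simps)

lemma realize_2c_from_1a_2a_3a:
  assumes "realizable S (pic \<Omega>1a)" "realizable S (pic \<Omega>2a)" "realizable S (pic \<Omega>3a)"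
  shows "realizable S (pic \<Omega>2c)"
proof (rule certified)
  show "certifies
    (reverse_strand 1000 1000 0 (-1000)
      (Forward (pic \<Omega>1a) (200, 0, 0, 200, 0, 400))
      (Forward (pic \<Omega>2a) (-200, 0, 0, -100, 0, -100))
      (Backward (pic \<Omega>3a) (-400, 0, 0, -300, 0, 0))
      (Backward (pic \<Omega>1a) (200, 0, 0, 200, 0, -150)))
    (pic \<Omega>2c)"
    by code_simp
qed (simp_all add: assms proper_pic proper_bent reverse_strand_def del: pic.simps)

lemma realize_2c_from_1c_2a_3h:
  assumes "realizable S (pic \<Omega>1c)" "realizable S (pic \<Omega>2a)" "realizable S (pic \<Omega>3h)"
  shows "realizable S (pic \<Omega>2c)"
proof (rule certified)
  show "certifies
    (reverse_strand 1000 (-1000) (-1000) 0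
      (Forward (pic \<Omega>1c) (200, 0, 0, 200, 0, 400))
      (Forward (pic \<Omega>2a) (-200, 0, 0, -100, 0, -100))
      (Backward (pic \<Omega>3h) (-400, 0, 0, -300, 0, 0))
      (Backward (pic \<Omega>1c) (200, 0, 0, 200, 0, -150)))
    (pic \<Omega>2c)"
    by code_simp
qed (simp_all add: assms proper_pic proper_bent reverse_strand_def del: pic.simps)

text \<open>With \<open>\<Omega>2b\<close> instead of \<open>\<Omega>2a\<close>, the strand is
  pushed under the loop rather than over it, so the triangle has a bent bottom strand. In the
  picture of \<open>\<Omega>2c\<close> the strand passing below is the upper one, which explains the
  half turn of the script.\<close>

lemma realize_2c_from_1a_2b_bottom_a:
  assumes "realizable S (pic \<Omega>1a)" "realizable S (pic \<Omega>2b)" "realizable S bottom_a"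
  shows "realizable S (pic \<Omega>2c)"
proof (rule certified)
  show "certifies
    (map (reflect (-1) (-1)) (reverse_strand (-1000) 1000 1000 0
      (Forward (pic \<Omega>1a) (-200, 0, 0, -200, 0, -400))
      (Forward (pic \<Omega>2b) (200, 0, 0, 100, 0, 100))
      (Backward bottom_a (400, 0, 0, 300, 0, 0))
      (Backward (pic \<Omega>1a) (-200, 0, 0, -200, 0, 150))))
    (pic \<Omega>2c)"
    by code_simp
qed (simp_all add: assms proper_pic proper_bent reverse_strand_def del: pic.simps)

lemma realize_2c_from_1c_2b_bottom_h:
  assumes "realizable S (pic \<Omega>1c)" "realizable S (pic \<Omega>2b)" "realizable S bottom_h"
  shows "realizable S (pic \<Omega>2c)"
proof (rule certified)
  show "certifies
    (map (reflect (-1) (-1)) (reverse_strand (-1000) (-1000) 0 1000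
      (Forward (pic \<Omega>1c) (-200, 0, 0, -200, 0, -400))
      (Forward (pic \<Omega>2b) (200, 0, 0, 100, 0, 100))
      (Backward bottom_h (400, 0, 0, 300, 0, 0))
      (Backward (pic \<Omega>1c) (-200, 0, 0, -200, 0, 150))))
    (pic \<Omega>2c)"
    by code_simp
qed (simp_all add: assms proper_pic proper_bent reverse_strand_def del: pic.simps)

lemma realize_2d_from_1b_2b_3a:
  assumes "realizable S (pic \<Omega>1b)" "realizable S (pic \<Omega>2b)" "realizable S (pic \<Omega>3a)"
  shows "realizable S (pic \<Omega>2d)"
proof (rule certified)
  show "certifies
    (reverse_strand 1000 1000 0 (-1000)
      (Forward (pic \<Omega>1b) (-200, 0, 0, -200, 0, 400))
      (Forward (pic \<Omega>2b) (200, 0, 0, 100, 0, -100))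
      (Forward (pic \<Omega>3a) (400, 0, 0, 300, 0, 0))
      (Backward (pic \<Omega>1b) (-200, 0, 0, -200, 0, -150)))
    (pic \<Omega>2d)"
    by code_simp
qed (simp_all add: assms proper_pic proper_bent reverse_strand_def del: pic.simps)

lemma realize_2d_from_1d_2b_3h:
  assumes "realizable S (pic \<Omega>1d)" "realizable S (pic \<Omega>2b)" "realizable S (pic \<Omega>3h)"
  shows "realizable S (pic \<Omega>2d)"
proof (rule certified)
  show "certifies
    (reverse_strand 1000 (-1000) (-1000) 0
      (Forward (pic \<Omega>1d) (-200, 0, 0, -200, 0, 400))
      (Forward (pic \<Omega>2b) (200, 0, 0, 100, 0, -100))
      (Forward (pic \<Omega>3h) (400, 0, 0, 300, 0, 0))
      (Backward (pic \<Omega>1d) (-200, 0, 0, -200, 0, -150)))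
    (pic \<Omega>2d)"
    by code_simp
qed (simp_all add: assms proper_pic proper_bent reverse_strand_def del: pic.simps)

lemma realize_2d_from_1b_2a_bottom_a:
  assumes "realizable S (pic \<Omega>1b)" "realizable S (pic \<Omega>2a)" "realizable S bottom_a"
  shows "realizable S (pic \<Omega>2d)"
proof (rule certified)
  show "certifies
    (map (reflect (-1) (-1)) (reverse_strand (-1000) 1000 1000 0
      (Forward (pic \<Omega>1b) (200, 0, 0, 200, 0, -400))
      (Forward (pic \<Omega>2a) (-200, 0, 0, -100, 0, 100))
      (Forward bottom_a (-400, 0, 0, -300, 0, 0))
      (Backward (pic \<Omega>1b) (200, 0, 0, 200, 0, 150))))
    (pic \<Omega>2d)"
    by code_simp
qed (simp_all add: assms proper_pic proper_bent reverse_strand_def del: pic.simps)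

lemma realize_2d_from_1d_2a_bottom_h:
  assumes "realizable S (pic \<Omega>1d)" "realizable S (pic \<Omega>2a)" "realizable S bottom_h"
  shows "realizable S (pic \<Omega>2d)"
proof (rule certified)
  show "certifies
    (map (reflect (-1) (-1)) (reverse_strand (-1000) (-1000) 0 1000
      (Forward (pic \<Omega>1d) (200, 0, 0, 200, 0, -400))
      (Forward (pic \<Omega>2a) (-200, 0, 0, -100, 0, 100))
      (Forward bottom_h (-400, 0, 0, -300, 0, 0))
      (Backward (pic \<Omega>1d) (200, 0, 0, 200, 0, 150))))
    (pic \<Omega>2d)"
    by code_simp
qed (simp_all add: assms proper_pic proper_bent reverse_strand_def del: pic.simps)

text \<open>The strand at height 1000, which is pushed over the loop, is the upper one in the
  picture of \<open>\<Omega>2a\<close>; again the script is turned by a half turn.\<close>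

lemma realize_2a_from_1b_2c_3e:
  assumes "realizable S (pic \<Omega>1b)" "realizable S (pic \<Omega>2c)" "realizable S (pic \<Omega>3e)"
  shows "realizable S (pic \<Omega>2a)"
proof (rule certified)
  show "certifies
    (map (reflect (-1) (-1)) (reverse_strand 1000 1000 0 (-1000)
      (Forward (pic \<Omega>1b) (200, 0, 0, 200, 0, -400))
      (Forward (pic \<Omega>2c) (-200, 0, 0, -100, 0, 100))
      (Backward (pic \<Omega>3e) (400, 0, 0, 300, 0, 0))
      (Backward (pic \<Omega>1b) (200, 0, 0, 200, 0, 150))))
    (pic \<Omega>2a)"
    by code_simp
qed (simp_all add: assms proper_pic proper_bent reverse_strand_def del: pic.simps)

lemma realize_2a_from_1d_2c_3f:
  assumes "realizable S (pic \<Omega>1d)" "realizable S (pic \<Omega>2c)" "realizable S (pic \<Omega>3f)"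
  shows "realizable S (pic \<Omega>2a)"
proof (rule certified)
  show "certifies
    (map (reflect (-1) (-1)) (reverse_strand 1000 (-1000) (-1000) 0
      (Forward (pic \<Omega>1d) (200, 0, 0, 200, 0, -400))
      (Forward (pic \<Omega>2c) (-200, 0, 0, -100, 0, 100))
      (Backward (pic \<Omega>3f) (400, 0, 0, 300, 0, 0))
      (Backward (pic \<Omega>1d) (200, 0, 0, 200, 0, 150))))
    (pic \<Omega>2a)"
    by code_simp
qed (simp_all add: assms proper_pic proper_bent reverse_strand_def del: pic.simps)

text \<open>
  The first strand, instead of the third, is moved past the crossing of the other two.
\<close>

definition bend_other :: "int \<Rightarrow> int \<Rightarrow> int \<Rightarrow> edit \<Rightarrow> edit list" where
  "bend_other h1 h2 h3 e1 =
    [Slide (0, -500, h3) (0, -100, h3),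
     Insert (600, 800, h1) (-600, -800, h1) (-201, -268, h1) (-120, -160, h1),
     Insert (600, 800, h1) (-120, -160, h1) (240, 320, h1) (120, 160, h1),
     Insert (120, 160, h1) (-120, -160, h1) (-42, -56, h1) (-135, 60, h1),
     Insert (-1000, 0, h3) (0, -100, h3) (-500, -50, h3) (-288, 0, h3),
     Insert (600, -800, h2) (-600, 800, h2) (201, -268, h2) (144, -192, h2),
     Insert (144, -192, h2) (-600, 800, h2) (-228, 304, h2) (-144, 192, h2),
     Insert (0, -100, h3) (1000, 0, h3) (500, -50, h3) (288, 0, h3), Delete (0, -100, h3) (-96, 0, h3), e1,
     Insert (-288, 0, h3) (288, 0, h3) (96, 0, h3) (0, 100, h3), Delete (-288, 0, h3) (-500, 50, h3),
     Delete (144, -192, h2) (228, -304, h2), Delete (-144, 192, h2) (-201, 268, h2),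
     Delete (288, 0, h3) (500, 50, h3), Delete (135, -60, h1) (42, 56, h1),
     Delete (-120, -160, h1) (-240, -320, h1), Delete (120, 160, h1) (201, 268, h1),
     Slide (0, 100, h3) (0, 500, h3)]"

text \<open>The placement is no similarity. It permutes the three lines of the picture: the
  horizontal line goes to the line of the first strand, and the two diameters go to the horizontal
  line and to the line of the second strand. So the bent strand of \<open>\<Omega>3a\<close> lies on
  the first strand of the new picture.\<close>

lemma realize_bottom_a_from_3a:
  assumes "realizable S (pic \<Omega>3a)"
  shows "realizable S bottom_a"
proof (rule certified)
  show "certifies
    (map (reflect (-1) 1) (bend_other 1000 0 (-1000)
      (Forward (pic \<Omega>3a) (-120, -270, 160, -120, 0, 0))))
    bottom_a"
    by code_simp
qed (simp_all add: assms proper_pic proper_bent bend_other_def del: pic.simps)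

lemma realize_3c_from_bottom_c:
  assumes "realizable S bottom_c"
  shows "realizable S (pic \<Omega>3c)"
proof (rule certified)
  show "certifies
    (map (reflect (-1) 1) (bend_other (-1000) 0 1000
      (Backward bottom_c (120, 270, -160, 120, 0, 0))))
    (pic \<Omega>3c)"
    by code_simp
qed (simp_all add: assms proper_pic proper_bent bend_other_def del: pic.simps)

lemma realize_middle_a_from_3a:
  assumes "realizable S (pic \<Omega>3a)"
  shows "realizable S middle_a"
proof (rule certified)
  show "certifies
    (bend_other 1000 (-1000) 0
      (Forward (pic \<Omega>3a) (-120, 270, -160, -120, 0, 0)))
    middle_a"
    by code_simp
qed (simp_all add: assms proper_pic proper_bent bend_other_def del: pic.simps)

lemma realize_3b_from_middle_b:
  assumes "realizable S middle_b"
  shows "realizable S (pic \<Omega>3b)"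
proof (rule certified)
  show "certifies
    (bend_other 0 (-1000) 1000
      (Backward middle_b (120, -270, 160, 120, 0, 0)))
    (pic \<Omega>3b)"
    by code_simp
qed (simp_all add: assms proper_pic proper_bent bend_other_def del: pic.simps)

lemma realize_bottom_b_from_3b:
  assumes "realizable S (pic \<Omega>3b)"
  shows "realizable S bottom_b"
proof (rule certified)
  show "certifies
    (bend_other 1000 0 (-1000)
      (Forward (pic \<Omega>3b) (-120, 270, -160, -120, 0, 0)))
    bottom_b"
    by code_simp
qed (simp_all add: assms proper_pic proper_bent bend_other_def del: pic.simps)

lemma realize_3e_from_bottom_e:
  assumes "realizable S bottom_e"
  shows "realizable S (pic \<Omega>3e)"
proof (rule certified)
  show "certifies
    (bend_other (-1000) 0 1000
      (Backward bottom_e (120, -270, 160, 120, 0, 0)))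
    (pic \<Omega>3e)"
    by code_simp
qed (simp_all add: assms proper_pic proper_bent bend_other_def del: pic.simps)

lemma realize_bottom_h_from_3h:
  assumes "realizable S (pic \<Omega>3h)"
  shows "realizable S bottom_h"
proof (rule certified)
  show "certifies
    (bend_other 1000 0 (-1000)
      (Forward (pic \<Omega>3h) (-120, 270, -160, -120, 0, 0)))
    bottom_h"
    by code_simp
qed (simp_all add: assms proper_pic proper_bent bend_other_def del: pic.simps)

lemma realize_3d_from_bottom_d:
  assumes "realizable S bottom_d"
  shows "realizable S (pic \<Omega>3d)"
proof (rule certified)
  show "certifies
    (bend_other (-1000) 0 1000
      (Backward bottom_d (120, -270, 160, 120, 0, 0)))
    (pic \<Omega>3d)"
    by code_simp
qed (simp_all add: assms proper_pic proper_bent bend_other_def del: pic.simps)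

lemma realize_middle_b_from_3b:
  assumes "realizable S (pic \<Omega>3b)"
  shows "realizable S middle_b"
proof (rule certified)
  show "certifies
    (map (reflect (-1) 1) (bend_other 1000 (-1000) 0
      (Backward (pic \<Omega>3b) (120, 270, -160, 120, 0, 0))))
    middle_b"
    by code_simp
qed (simp_all add: assms proper_pic proper_bent bend_other_def del: pic.simps)

lemma realize_3a_from_middle_a:
  assumes "realizable S middle_a"
  shows "realizable S (pic \<Omega>3a)"
proof (rule certified)
  show "certifies
    (map (reflect (-1) 1) (bend_other 0 (-1000) 1000
      (Forward middle_a (-120, -270, 160, -120, 0, 0))))
    (pic \<Omega>3a)"
    by code_simp
qed (simp_all add: assms proper_pic proper_bent bend_other_def del: pic.simps)

text \<open>
  The first two strands get a bigon on the far side of the third strand.  Its first crossing is opposite in sign to the original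
  one; once the third strand has been moved past it, these two crossings cancel.
\<close>

definition opposite_crossing :: "int \<Rightarrow> int \<Rightarrow> int \<Rightarrow> int \<Rightarrow> edit \<Rightarrow> edit \<Rightarrow> edit \<Rightarrow> edit list" where
  "opposite_crossing h1 h2 h3 k e1 e2 e3 =
    [Slide (0, -500, h3) (0, -30, h3), Insert (-600, -800, h1) (600, 800, h1) (-201, -268, h1) (-180, -60, k),
     Insert (-600, 800, h2) (600, -800, h2) (201, -268, h2) (180, -60, - k), Slide (0, -30, h3) (0, 70, h3),
     Insert (180, -60, - k) (600, -800, h2) (390, -430, (h2 - k) div 2) (150, -300, - k),
     Insert (-600, -800, h1) (-180, -60, k) (-390, -430, (h1 + k) div 2) (-180, -540, k),
     Insert (-600, 800, h2) (180, -60, - k) (63, 69, (3 * h2 - 17 * k) div 20) (100, 150, h2),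
     Insert (150, -300, - k) (600, -800, h2) (375, -550, (h2 - k) div 2) (180, -540, - k),
     Insert (-180, -60, k) (600, 800, h1) (-63, 69, (3 * h1 + 17 * k) div 20) (-100, 150, h1),
     Insert (-180, -540, k) (-180, -60, k) (-180, -300, k) (-150, -300, k), e1, Slide (0, 70, h3) (0, 150, h3),
     Slide (-150, -300, - k) (-240, -240, h2), Insert (-1000, 0, h3) (0, 150, h3) (-500, 75, h3) (-400, 0, h3),
     Delete (-180, -540, k) (-225, -550, (h1 + k) div 2), Delete (-180, -60, k) (25, -75, (h1 + k) div 2),
     Slide (100, 150, h2) (240, 240, h2), Slide (150, -300, k) (240, -240, h1),
     Delete (180, -540, - k) (180, -520, h2), Delete (180, -60, - k) (80, 80, h2),
     Slide (-100, 150, h1) (-240, 240, h1), Insert (0, 150, h3) (1000, 0, h3) (500, 75, h3) (400, 0, h3), e2,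
     Delete (-400, 0, h3) (-500, -75, h3), Slide (240, -240, h1) (100, -150, h1),
     Insert (240, 240, h2) (-240, -240, h2) (-80, -80, h2) (-180, 60, - k),
     Insert (-600, 800, h2) (240, 240, h2) (-180, 520, h2) (-180, 540, - k),
     Slide (-240, 240, h1) (-150, 300, k), Slide (-240, -240, h2) (-100, -150, h2),
     Insert (100, -150, h1) (-150, 300, k) (-25, 75, (h1 + k) div 2) (180, 60, k),
     Insert (-150, 300, k) (600, 800, h1) (225, 550, (h1 + k) div 2) (180, 540, k),
     Delete (400, 0, h3) (500, -75, h3), Slide (240, 240, h2) (150, 300, - k),
     Slide (0, -150, h3) (0, -70, h3), e3, Delete (150, 300, k) (180, 300, k),
     Delete (100, -150, h1) (63, -69, (3 * h1 + 17 * k) div 20),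
     Delete (-180, 540, - k) (-375, 550, (h2 - k) div 2),
     Delete (-100, -150, h2) (-63, -69, (3 * h2 - 17 * k) div 20),
     Delete (180, 540, k) (390, 430, (h1 + k) div 2), Delete (-150, 300, - k) (-390, 430, (h2 - k) div 2),
     Slide (0, -70, h3) (0, 30, h3), Delete (-180, 60, - k) (-201, 268, h2),
     Delete (180, 60, k) (201, 268, h1), Slide (0, 30, h3) (0, 500, h3)]"

text \<open>The bigon that is removed lies on the other side of the crossing that it shares with the
  created one. Across a crossing of antiparallel strands the sense of rotation is reversed, so
  \<open>\<Omega>2c\<close> creates and \<open>\<Omega>2d\<close> removes. For parallel strands the
  order of the signs is reversed instead, and \<open>\<Omega>2a\<close> is paired with
  \<open>\<Omega>2b\<close>.\<close>

lemma realize_3f_from_2c_2d_3a: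
  assumes "realizable S (pic \<Omega>2c)" "realizable S (pic \<Omega>2d)" "realizable S (pic \<Omega>3a)"
  shows "realizable S (pic \<Omega>3f)"
proof (rule certified)
  show "certifies
    (opposite_crossing 0 (-1000) 1000 1000
      (Forward (pic \<Omega>2c) (0, 300, -300, 0, 0, -300))
      (Backward (pic \<Omega>3a) (400, 0, 0, 300, 0, 0))
      (Backward (pic \<Omega>2d) (0, -300, 300, 0, 0, 300)))
    (pic \<Omega>3f)"
    by code_simp
qed (simp_all add: assms proper_pic proper_bent opposite_crossing_def del: pic.simps)

lemma realize_bottom_c_from_2c_2d_bottom_a:
  assumes "realizable S (pic \<Omega>2c)" "realizable S (pic \<Omega>2d)" "realizable S bottom_a"
  shows "realizable S bottom_c"
proof (rule certified)
  show "certifies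
    (opposite_crossing 1000 0 (-1000) 1000
      (Forward (pic \<Omega>2c) (0, 300, -300, 0, 0, -300))
      (Backward bottom_a (400, 0, 0, 300, 0, 0))
      (Backward (pic \<Omega>2d) (0, -300, 300, 0, 0, 300)))
    bottom_c"
    by code_simp
qed (simp_all add: assms proper_pic proper_bent opposite_crossing_def del: pic.simps)

lemma realize_middle_b_from_2c_2d_middle_a:
  assumes "realizable S (pic \<Omega>2c)" "realizable S (pic \<Omega>2d)" "realizable S middle_a"
  shows "realizable S middle_b"
proof (rule certified)
  show "certifies
    (opposite_crossing (-1000) 1000 0 (-1000)
      (Forward (pic \<Omega>2c) (0, -300, 300, 0, 0, -300))
      (Backward middle_a (400, 0, 0, 300, 0, 0))
      (Backward (pic \<Omega>2d) (0, 300, -300, 0, 0, 300)))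
    middle_b"
    by code_simp
qed (simp_all add: assms proper_pic proper_bent opposite_crossing_def del: pic.simps)

lemma realize_3g_from_2a_2b_3c:
  assumes "realizable S (pic \<Omega>2a)" "realizable S (pic \<Omega>2b)" "realizable S (pic \<Omega>3c)"
  shows "realizable S (pic \<Omega>3g)"
proof (rule certified)
  show "certifies
    (opposite_crossing (-1000) 0 1000 (-1000)
      (Forward (pic \<Omega>2a) (0, 300, -300, 0, 0, -300))
      (Backward (pic \<Omega>3c) (400, 0, 0, 300, 0, 0))
      (Backward (pic \<Omega>2b) (0, 300, -300, 0, 0, 300)))
    (pic \<Omega>3g)"
    by code_simp
qed (simp_all add: assms proper_pic proper_bent opposite_crossing_def del: pic.simps)

lemma realize_3d_from_2a_2b_3b:
  assumes "realizable S (pic \<Omega>2a)" "realizable S (pic \<Omega>2b)" "realizable S (pic \<Omega>3b)"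
  shows "realizable S (pic \<Omega>3d)"
proof (rule certified)
  show "certifies
    (opposite_crossing (-1000) 0 1000 (-1000)
      (Forward (pic \<Omega>2b) (0, -300, 300, 0, 0, -300))
      (Backward (pic \<Omega>3b) (400, 0, 0, 300, 0, 0))
      (Backward (pic \<Omega>2a) (0, -300, 300, 0, 0, 300)))
    (pic \<Omega>3d)"
    by code_simp
qed (simp_all add: assms proper_pic proper_bent opposite_crossing_def del: pic.simps)

lemma realize_bottom_e_from_2a_2b_bottom_b:
  assumes "realizable S (pic \<Omega>2a)" "realizable S (pic \<Omega>2b)" "realizable S bottom_b"
  shows "realizable S bottom_e"
proof (rule certified)
  show "certifies
    (opposite_crossing 0 1000 (-1000) (-1000)
      (Forward (pic \<Omega>2a) (0, 300, -300, 0, 0, -300))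
      (Backward bottom_b (400, 0, 0, 300, 0, 0))
      (Backward (pic \<Omega>2b) (0, 300, -300, 0, 0, 300)))
    bottom_e"
    by code_simp
qed (simp_all add: assms proper_pic proper_bent opposite_crossing_def del: pic.simps)

lemma realize_3h_from_2c_2d_3e:
  assumes "realizable S (pic \<Omega>2c)" "realizable S (pic \<Omega>2d)" "realizable S (pic \<Omega>3e)"
  shows "realizable S (pic \<Omega>3h)"
proof (rule certified)
  show "certifies
    (opposite_crossing 0 (-1000) 1000 1000
      (Forward (pic \<Omega>2d) (0, 300, -300, 0, 0, -300))
      (Backward (pic \<Omega>3e) (400, 0, 0, 300, 0, 0))
      (Backward (pic \<Omega>2c) (0, -300, 300, 0, 0, 300)))
    (pic \<Omega>3h)"
    by code_simp
qed (simp_all add: assms proper_pic proper_bent opposite_crossing_def del: pic.simps)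

lemma realize_3e_from_2c_2d_3h:
  assumes "realizable S (pic \<Omega>2c)" "realizable S (pic \<Omega>2d)" "realizable S (pic \<Omega>3h)"
  shows "realizable S (pic \<Omega>3e)"
proof (rule certified)
  show "certifies
    (opposite_crossing (-1000) 0 1000 (-1000)
      (Forward (pic \<Omega>2c) (0, -300, 300, 0, 0, -300))
      (Backward (pic \<Omega>3h) (400, 0, 0, 300, 0, 0))
      (Backward (pic \<Omega>2d) (0, 300, -300, 0, 0, 300)))
    (pic \<Omega>3e)"
    by code_simp
qed (simp_all add: assms proper_pic proper_bent opposite_crossing_def del: pic.simps)

lemma realize_bottom_d_from_2c_2d_bottom_h:
  assumes "realizable S (pic \<Omega>2c)" "realizable S (pic \<Omega>2d)" "realizable S bottom_h"
  shows "realizable S bottom_d"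
proof (rule certified)
  show "certifies
    (opposite_crossing 0 1000 (-1000) (-1000)
      (Forward (pic \<Omega>2c) (0, -300, 300, 0, 0, -300))
      (Backward bottom_h (400, 0, 0, 300, 0, 0))
      (Backward (pic \<Omega>2d) (0, 300, -300, 0, 0, 300)))
    bottom_d"
    by code_simp
qed (simp_all add: assms proper_pic proper_bent opposite_crossing_def del: pic.simps)

lemma realize_3b_from_2a_2b_3d:
  assumes "realizable S (pic \<Omega>2a)" "realizable S (pic \<Omega>2b)" "realizable S (pic \<Omega>3d)"
  shows "realizable S (pic \<Omega>3b)"
proof (rule certified)
  show "certifies
    (opposite_crossing 0 (-1000) 1000 1000
      (Forward (pic \<Omega>2a) (0, -300, 300, 0, 0, -300))
      (Backward (pic \<Omega>3d) (400, 0, 0, 300, 0, 0))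
      (Backward (pic \<Omega>2b) (0, -300, 300, 0, 0, 300)))
    (pic \<Omega>3b)"
    by code_simp
qed (simp_all add: assms proper_pic proper_bent opposite_crossing_def del: pic.simps)

lemma realize_middle_a_from_2c_2d_middle_b:
  assumes "realizable S (pic \<Omega>2c)" "realizable S (pic \<Omega>2d)" "realizable S middle_b"
  shows "realizable S middle_a"
proof (rule certified)
  show "certifies
    (opposite_crossing 1000 (-1000) 0 1000
      (Forward (pic \<Omega>2d) (0, 300, -300, 0, 0, -300))
      (Backward middle_b (400, 0, 0, 300, 0, 0))
      (Backward (pic \<Omega>2c) (0, -300, 300, 0, 0, 300)))
    middle_a"
    by code_simp
qed (simp_all add: assms proper_pic proper_bent opposite_crossing_def del: pic.simps)

section \<open>Generating sets\<close>

text \<open>The reversed sign is \<open>mb\<close>, \<open>tm\<close> or \<open>tb\<close> according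
  as the top, bottom or middle strand is bent. From (+,-,+) these give \<open>\<Omega>3f\<close>,
  \<open>\<Omega>3c\<close> and \<open>\<Omega>3b\<close>, all by antiparallel bigons.
  \<open>\<Omega>3f\<close> is the key to \<open>\<Omega>2a\<close> and \<open>\<Omega>2b\<close>,
  which open the edges of the cube to \<open>\<Omega>3d\<close>, \<open>\<Omega>3e\<close> and
  \<open>\<Omega>3g\<close>; the last edge to \<open>\<Omega>3h\<close> is antiparallel
  again.\<close>

lemma all_from_3a:
  assumes k: "realizable S (pic \<Omega>1a)" "realizable S (pic \<Omega>1b)" "realizable S (pic \<Omega>1c)" "realizable S (pic \<Omega>1d)"
    and c: "realizable S (pic \<Omega>2c)" and d: "realizable S (pic \<Omega>2d)" and a3: "realizable S (pic \<Omega>3a)"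
  shows "realizable S (pic r)"
proof -
  note f3 = realize_3f_from_2c_2d_3a[OF c d a3]
  note b = realize_2b_from_1c_2d_3f[OF k(3) d f3] and a = realize_2a_from_1d_2c_3f[OF k(4) c f3]
  note c3 = realize_3c_from_bottom_c[OF realize_bottom_c_from_2c_2d_bottom_a[OF c d realize_bottom_a_from_3a[OF a3]]]
  note b3 = realize_3b_from_middle_b[OF realize_middle_b_from_2c_2d_middle_a[OF c d realize_middle_a_from_3a[OF a3]]]
  note e3 = realize_3e_from_bottom_e[OF realize_bottom_e_from_2a_2b_bottom_b[OF a b realize_bottom_b_from_3b[OF b3]]]
  show ?thesis
    using k a b c d a3 b3 c3 realize_3d_from_2a_2b_3b[OF a b b3] e3 f3 realize_3g_from_2a_2b_3c[OF a b c3]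
      realize_3h_from_2c_2d_3e[OF c d e3]
    by (cases r) (simp_all del: pic.simps)
qed

text \<open>A path through the cube from \<open>\<Omega>3h\<close> to the opposite corner
  \<open>\<Omega>3a\<close> by way of \<open>\<Omega>3d\<close> and \<open>\<Omega>3b\<close>. Only
  its middle edge needs parallel bigons, and these are obtained from \<open>\<Omega>3e\<close>, a
  neighbour of \<open>\<Omega>3h\<close>.\<close>

lemma all_from_3h:
  assumes k: "realizable S (pic \<Omega>1a)" "realizable S (pic \<Omega>1b)" "realizable S (pic \<Omega>1c)" "realizable S (pic \<Omega>1d)"
    and c: "realizable S (pic \<Omega>2c)" and d: "realizable S (pic \<Omega>2d)" and h3: "realizable S (pic \<Omega>3h)"
  shows "realizable S (pic r)"
proof -
  note e3 = realize_3e_from_2c_2d_3h[OF c d h3]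
  note b = realize_2b_from_1a_2d_3e[OF k(1) d e3] and a = realize_2a_from_1b_2c_3e[OF k(2) c e3]
  note d3 = realize_3d_from_bottom_d[OF realize_bottom_d_from_2c_2d_bottom_h[OF c d realize_bottom_h_from_3h[OF h3]]]
  note b3 = realize_3b_from_2a_2b_3d[OF a b d3]
  note a3 = realize_3a_from_middle_a[OF realize_middle_a_from_2c_2d_middle_b[OF c d realize_middle_b_from_3b[OF b3]]]
  show ?thesis by (rule all_from_3a[OF k c d a3])
qed

text \<open>The crossing of the loop takes the place of \<open>mb\<close> under a bent top strand
  and of \<open>tm\<close> under a bent bottom strand. Both are + in \<open>\<Omega>3a\<close>, so
  only positive kinks serve: the clockwise one yields \<open>\<Omega>2c\<close>, the other
  \<open>\<Omega>2d\<close>. Which parallel move is at hand decides between the bent top and the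
  bent bottom strand.\<close>

lemma antiparallel_from_3a:
  assumes "realizable S (pic \<Omega>3a)" "realizable S (pic \<Omega>2a) \<or> realizable S (pic \<Omega>2b)"
  shows "realizable S (pic \<Omega>1a) \<Longrightarrow> realizable S (pic \<Omega>2c)" "realizable S (pic \<Omega>1b) \<Longrightarrow> realizable S (pic \<Omega>2d)"
  using assms(2) realize_2c_from_1a_2a_3a[OF _ _ assms(1)] realize_2c_from_1a_2b_bottom_a[OF _ _
      realize_bottom_a_from_3a[OF assms(1)]]
    realize_2d_from_1b_2b_3a[OF _ _ assms(1)] realize_2d_from_1b_2a_bottom_a[OF _ _ realize_bottom_a_from_3a[OF
        assms(1)]]
  by blast+

text \<open>Here \<open>mb\<close> and \<open>tm\<close> are both -, so the negative kinks take
  over.\<close>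

lemma antiparallel_from_3h:
  assumes "realizable S (pic \<Omega>3h)" "realizable S (pic \<Omega>2a) \<or> realizable S (pic \<Omega>2b)"
  shows "realizable S (pic \<Omega>1c) \<Longrightarrow> realizable S (pic \<Omega>2c)" "realizable S (pic \<Omega>1d) \<Longrightarrow> realizable S (pic \<Omega>2d)"
  using assms(2) realize_2c_from_1c_2a_3h[OF _ _ assms(1)] realize_2c_from_1c_2b_bottom_h[OF _ _
      realize_bottom_h_from_3h[OF assms(1)]]
    realize_2d_from_1d_2b_3h[OF _ _ assms(1)] realize_2d_from_1d_2a_bottom_h[OF _ _ realize_bottom_h_from_3h[OF
        assms(1)]]
  by blast+

text \<open>If only one positive kink is given, it yields one antiparallel move, which turns the
  negative kink with the same sense of rotation into the missing positive kink; this in turn yields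
  the other antiparallel move.\<close>

lemma generating_3a:
  assumes "\<Omega>3a \<in> X" "\<Omega>2a \<in> X \<or> \<Omega>2b \<in> X"
    and "\<Omega>1a \<in> X \<and> \<Omega>1c \<in> X \<or> \<Omega>1b \<in> X \<and> \<Omega>1d \<in> X \<or> \<Omega>1a \<in> X \<and> \<Omega>1b \<in> X"
  shows "generating_set X"
proof -
  note g = generator_realizable[of _ X]
  have 2: "realizable X (pic \<Omega>2a) \<or> realizable X (pic \<Omega>2b)" using assms(2) g by blast
  note q = antiparallel_from_3a[OF g[OF assms(1)] 2]
  have "realizable X (pic \<Omega>1a) \<and> realizable X (pic \<Omega>1b) \<and> realizable X (pic \<Omega>1c) \<and> realizable X (pic \<Omega>1d)
    \<and> realizable X (pic \<Omega>2c) \<and> realizable X (pic \<Omega>2d)"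
    using assms(3)
  proof (elim disjE conjE)
    assume "\<Omega>1a \<in> X" "\<Omega>1c \<in> X"
    note a = g[OF this(1)] and c = g[OF this(2)]
    note b = realize_1b_from_1c_2c[OF c q(1)[OF a]]
    show ?thesis using a b c realize_1d_from_1a_2c[OF a q(1)[OF a]] q(1)[OF a] q(2)[OF b] by blast
  next
    assume "\<Omega>1b \<in> X" "\<Omega>1d \<in> X"
    note b = g[OF this(1)] and d = g[OF this(2)]
    note a = realize_1a_from_1d_2d[OF d q(2)[OF b]]
    show ?thesis using a b d realize_1c_from_1b_2d[OF b q(2)[OF b]] q(1)[OF a] q(2)[OF b] by blast
  next
    assume "\<Omega>1a \<in> X" "\<Omega>1b \<in> X"
    note a = g[OF this(1)] and b = g[OF this(2)]
    show ?thesis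
      using a b realize_1c_from_1b_2d[OF b q(2)[OF b]] realize_1d_from_1a_2c[OF a q(1)[OF a]] q(1)[OF a] q(2)[OF
          b] by blast
  qed
  then show ?thesis
    unfolding generating_set_def realizes_iff using all_from_3a[OF _ _ _ _ _ _ g[OF assms(1)]] by blast
qed

text \<open>The same bootstrap with the two signs interchanged: the given negative kink provides the
  antiparallel move, and the positive kink with the same sense of rotation is converted into the
  missing negative one.\<close>

lemma generating_3h:
  assumes "\<Omega>3h \<in> X" "\<Omega>2a \<in> X \<or> \<Omega>2b \<in> X"
    and "\<Omega>1a \<in> X \<and> \<Omega>1c \<in> X \<or> \<Omega>1b \<in> X \<and> \<Omega>1d \<in> X \<or> \<Omega>1c \<in> X \<and> \<Omega>1d \<in> X"
  shows "generating_set X"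
proof -
  note g = generator_realizable[of _ X]
  have 2: "realizable X (pic \<Omega>2a) \<or> realizable X (pic \<Omega>2b)" using assms(2) g by blast
  note q = antiparallel_from_3h[OF g[OF assms(1)] 2]
  have "realizable X (pic \<Omega>1a) \<and> realizable X (pic \<Omega>1b) \<and> realizable X (pic \<Omega>1c) \<and> realizable X (pic \<Omega>1d)
    \<and> realizable X (pic \<Omega>2c) \<and> realizable X (pic \<Omega>2d)"
    using assms(3)
  proof (elim disjE conjE)
    assume "\<Omega>1a \<in> X" "\<Omega>1c \<in> X"
    note a = g[OF this(1)] and c = g[OF this(2)]
    note d = realize_1d_from_1a_2c[OF a q(1)[OF c]]
    show ?thesis using a c d realize_1b_from_1c_2c[OF c q(1)[OF c]] q(1)[OF c] q(2)[OF d] by blast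
  next
    assume "\<Omega>1b \<in> X" "\<Omega>1d \<in> X"
    note b = g[OF this(1)] and d = g[OF this(2)]
    note c = realize_1c_from_1b_2d[OF b q(2)[OF d]]
    show ?thesis using b c d realize_1a_from_1d_2d[OF d q(2)[OF d]] q(1)[OF c] q(2)[OF d] by blast
  next
    assume "\<Omega>1c \<in> X" "\<Omega>1d \<in> X"
    note c = g[OF this(1)] and d = g[OF this(2)]
    show ?thesis
      using c d realize_1b_from_1c_2c[OF c q(1)[OF c]] realize_1a_from_1d_2d[OF d q(2)[OF d]] q(1)[OF c] q(2)[OF
          d] by blast
  qed
  then show ?thesis
    unfolding generating_set_def realizes_iff using all_from_3h[OF _ _ _ _ _ _ g[OF assms(1)]] by blast
qed

theorem theorem2:
  fixes \<A> \<H> :: "move set set" and X :: "move set"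
  assumes "\<A> = {{\<Omega>1a, \<Omega>1c, \<Omega>2a, \<Omega>3a}, {\<Omega>1a, \<Omega>1c, \<Omega>2b, \<Omega>3a},
                 {\<Omega>1b, \<Omega>1d, \<Omega>2a, \<Omega>3a}, {\<Omega>1b, \<Omega>1d, \<Omega>2b, \<Omega>3a},
                 {\<Omega>1a, \<Omega>1b, \<Omega>2a, \<Omega>3a}, {\<Omega>1a, \<Omega>1b, \<Omega>2b, \<Omega>3a}}"
    and "\<H> = {{\<Omega>1a, \<Omega>1c, \<Omega>2a, \<Omega>3h}, {\<Omega>1a, \<Omega>1c, \<Omega>2b, \<Omega>3h},
                 {\<Omega>1b, \<Omega>1d, \<Omega>2a, \<Omega>3h}, {\<Omega>1b, \<Omega>1d, \<Omega>2b, \<Omega>3h},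
                 {\<Omega>1c, \<Omega>1d, \<Omega>2a, \<Omega>3h}, {\<Omega>1c, \<Omega>1d, \<Omega>2b, \<Omega>3h}}"
    and "X \<in> \<A> \<union> \<H>"
  shows "generating_set X"
  proof (cases "\<Omega>3a \<in> X")
  case True
  then show ?thesis using assms by (intro generating_3a) auto
next
  case False
  then show ?thesis using assms by (intro generating_3h) auto
qed

end
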